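(* Let $d\ge 3$ and let $\{\mathbf S_n\}_{n\ge 0}$ be the simple symmetric random walk on $\mathbb{Z}^d$ started at $\mathbf 0$. For each $\varepsilon>0$, with probability 1 there exists a (random) $n_0=n_0(\varepsilon)$ such that if $n\ge n_0$ then: (i) $(\xi(\mathbf S_j,\infty),\xi(\mathbf S_j+\mathbf e_i,\infty))\in ((1+\varepsilon)\log n)\,\mathcal B$ for all $j=0,1,2,\dots,n$ and all $i=1,2,\dots,2d$; (ii) for any pair of nonnegative integers $(k,\ell)\in ((1-\varepsilon)\log n)\,\mathcal B$ and for arbitrary $i\in\{1,2,\dots,2d\}$ there exists a random integer $j=j(k,\ell)\le n$ for which $$(\xi(\mathbf S_j,\infty),\xi(\mathbf S_j+\mathbf e_i,\infty))=(k+1,\ell).$$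
   Context: Simple symmetric random walk on $\mathbb{Z}^d$: $\mathbf S_0=\mathbf 0$, $\mathbf S_n=\sum_{k=1}^n\mathbf X_k$, with $\mathbf X_k$ i.i.d., $\mathbf P(\mathbf X_1=\mathbf e_i)=\frac1{2d}$ for $i=1,\dots,2d$, where $\mathbf e_1,\dots,\mathbf e_d$ are the standard orthogonal unit vectors and $\mathbf e_{d+j}=-\mathbf e_j$, $j=1,\dots,d$. Total local time: $\xi(\mathbf z,\infty)=\#\{k: k>0,\ \mathbf S_k=\mathbf z\}$ (time $0$ is not counted). $\gamma=\gamma(d)>0$ is the probability that the walk never returns to its starting point, and $\alpha=\frac{1-\gamma}{2-\gamma}$. $\mathcal B=\{(x,y)\in\mathbb{R}^2: x\ge0,\ y\ge 0,\ -(x+y)\log(x+y)+x\log x+y\log y-(x+y)\log\alpha\le 1\}$, with the convention $0\log 0=0$. For real $c$, $c\,\mathcal B=\{(cx,cy):(x,y)\in\mathcal B\}$. *)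

theory Defs
  imports "HOL-Probability.Probability"
begin

text \<open>
  The lattice of dimension \<open>d\<close> is \<open>int ^ 'd\<close> with \<open>d = CARD('d)\<close>. The \<open>2d\<close> directions are indexed by
  \<open>'d + 'd\<close>: \<open>Inl j\<close> is the \<open>j\<close>-th positive direction and \<open>Inr j\<close> its negative.
\<close>

definition unit_step :: "'d + 'd \<Rightarrow> int ^ 'd" where
  "unit_step i = (case i of Inl j \<Rightarrow> axis j 1 | Inr j \<Rightarrow> - axis j 1)"

text \<open>The steps are \<open>X 1, X 2, \<dots>\<close>; the value \<open>X 0\<close> is unconstrained and never used.\<close>

locale simple_random_walk = prob_space M
  for M :: "'a measure" and X :: "nat \<Rightarrow> 'a \<Rightarrow> int ^ 'd" +
  assumes steps_indep: "indep_vars (\<lambda>_. count_space UNIV) X {1..}"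
    and steps_uniform:
      "\<And>k i. k \<ge> 1 \<Longrightarrow> measure M {\<omega> \<in> space M. X k \<omega> = unit_step i} = 1 / (2 * real CARD('d))"

definition walk :: "(nat \<Rightarrow> 'a \<Rightarrow> int ^ 'd) \<Rightarrow> nat \<Rightarrow> 'a \<Rightarrow> int ^ 'd" where
  "walk X n \<omega> = (\<Sum>k = 1..n. X k \<omega>)"

text \<open>The value is \<open>\<infinity>\<close> if the site is visited infinitely often (\<open>card\<close> would give \<open>0\<close>).\<close>

definition local_time :: "(nat \<Rightarrow> 'a \<Rightarrow> int ^ 'd) \<Rightarrow> int ^ 'd \<Rightarrow> 'a \<Rightarrow> enat" where
  "local_time X z \<omega> =
    (let V = {k. k > 0 \<and> walk X k \<omega> = z} in if finite V then enat (card V) else \<infinity>)"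

definition escape_prob :: "'a measure \<Rightarrow> (nat \<Rightarrow> 'a \<Rightarrow> int ^ 'd) \<Rightarrow> real" where
  "escape_prob M X = measure M {\<omega> \<in> space M. \<forall>k>0. walk X k \<omega> \<noteq> 0}"

definition alpha :: "'a measure \<Rightarrow> (nat \<Rightarrow> 'a \<Rightarrow> int ^ 'd) \<Rightarrow> real" where
  "alpha M X = (1 - escape_prob M X) / (2 - escape_prob M X)"

text \<open>The convention \<open>0 log 0 = 0\<close> holds automatically, being a product with \<open>0\<close>.\<close>

definition region :: "real \<Rightarrow> (real \<times> real) set" where
  "region a = {(x, y). x \<ge> 0 \<and> y \<ge> 0 \<and>
     - (x + y) * ln (x + y) + x * ln x + y * ln y - (x + y) * ln a \<le> 1}"

end

theory Submission imports Defs "HOL-Real_Asymp.Real_Asymp"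
begin

text \<open>
  The local times at two neighbouring sites \<open>0\<close> and \<open>e\<close> are an exchangeable pair of counters: from
  either site the walk next enters \<open>{0, e}\<close> at \<open>0\<close> or at \<open>e\<close> with the same probability \<open>\<alpha>\<close>, by the
  reflection \<open>x \<mapsto> e - x\<close> and because the return probability is the probability of hitting \<open>0\<close> from
  \<open>e\<close>. Hence the counts are \<open>(k, l)\<close> with probability \<open>(1 - 2 \<alpha>) (k+l choose k) \<alpha>^(k+l)\<close>, whose
  negative logarithm is the convex homogeneous function defining the region, up to \<open>O(log (k + l))\<close>.

  For the upper bound, restart the walk at the first visit to a pair and apply Borel--Cantelli.
  For the lower bound, cut the first \<open>N = 2^m\<close> steps into blocks of length \<open>3L\<close> with \<open>L\<close> polynomial
  in \<open>m\<close>. That a site in a block is new within the block, collects \<open>(k, l)\<close> visits during the next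
  \<open>L\<close> steps and none in the \<open>L\<close> steps after is independent between blocks and nearly as likely as for
  the infinite walk; by transience (\<open>P(S_n = x) \<le> C n^(-3/2)\<close>) only a fraction \<open>O(L^(-1/2))\<close> of these
  blocks is spoilt by visits outside the block.
\<close>

section \<open>Averages over step sequences\<close>

text \<open>Finite-horizon probabilities are finite averages over words of steps
  (\<open>path_avg\<close>), so that first-step analysis becomes plain induction;
  \<open>prob_seg\<close> transfers the results to \<open>M\<close>. The joint law is not evaluated
  exactly: the upper part uses a bound that drops the factor \<open>1 - 2 \<alpha>\<close>, the
  lower part one that loses a constant factor, both uniform in \<open>(k, l)\<close>. The obstacle
  in the lower part is that spoiling is only polynomially unlikely, whereas a good block may have
  probability as small as about \<open>2^(-\<theta> m)\<close>. The spoiling bound must therefore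
  carry the same weight as the good event. This is why a block ends with \<open>L\<close> idle
  steps: they separate the counted visits from later returns, and the heat kernel bound is uniform
  in the position where they begin. About \<open>m^2\<close> pairs occur for each \<open>m\<close>,
  so \<open>m^2 L^(-1/2)\<close> has to be summable over \<open>m\<close>; \<open>L = m^8\<close>
  achieves this. Such a bound, a power of \<open>log n\<close>, is not summable over
  \<open>n\<close>, hence the powers of two.\<close>

definition avg :: "(int ^ 'd \<Rightarrow> real) \<Rightarrow> real" where
  "avg g = (\<Sum>i\<in>UNIV. g (unit_step i)) / (2 * real CARD('d))"

lemma avg_cong: "(\<And>i. g (unit_step i) = h (unit_step i)) \<Longrightarrow> avg g = avg h"
  by (simp add: avg_def)

lemma avg_mono: "(\<And>i. g (unit_step i) \<le> h (unit_step i)) \<Longrightarrow> avg g \<le> avg h"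
  unfolding avg_def by (intro divide_right_mono sum_mono) auto

lemma avg_const [simp]: "avg (\<lambda>_. c) = c"
  by (simp add: avg_def)

lemma avg_add: "avg (\<lambda>v. g v + h v) = avg g + avg h"
  by (simp add: avg_def sum.distrib add_divide_distrib)

lemma avg_diff: "avg (\<lambda>v. g v - h v) = avg g - avg h"
  by (simp add: avg_def sum_subtractf diff_divide_distrib)

lemma avg_cmult: "avg (\<lambda>v. c * g v) = c * avg g"
  by (simp add: avg_def sum_distrib_left[symmetric])

lemma avg_multc: "avg (\<lambda>v. g v * c) = avg g * c"
  by (simp add: avg_def sum_distrib_right[symmetric])

lemma avg_sum: "avg (\<lambda>v. \<Sum>c\<in>A. G c v) = (\<Sum>c\<in>A. avg (G c))"
  unfolding avg_def by (subst sum.swap) (simp add: sum_divide_distrib)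

lemma avg_swap: "avg (\<lambda>u. avg (\<lambda>v. G u v)) = avg (\<lambda>v. avg (\<lambda>u. G u v))"
  unfolding avg_def by (subst (2) sum_divide_distrib[symmetric], subst sum.swap) (simp add: sum_divide_distrib mult.commute)

lemma avg_nonneg: "(\<And>i. g (unit_step i) \<ge> 0) \<Longrightarrow> avg g \<ge> 0"
  unfolding avg_def by (intro divide_nonneg_nonneg sum_nonneg) auto

lemma avg_le_const: "(\<And>i. g (unit_step i) \<le> c) \<Longrightarrow> avg g \<le> c"
  using avg_mono[of g "\<lambda>_. c"] by simp

lemma avg_tendsto:
  assumes "\<And>i. (\<lambda>n. G n (unit_step i)) \<longlonglongrightarrow> g (unit_step i)"
  shows "(\<lambda>n. avg (G n)) \<longlonglongrightarrow> avg g"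
  unfolding avg_def by (intro tendsto_intros assms) auto

lemma avg_bij:
  fixes \<pi> :: "'d::finite + 'd \<Rightarrow> 'd + 'd" and g h :: "int ^ 'd \<Rightarrow> real"
  assumes "bij \<pi>" "\<And>i. g (unit_step i) = h (unit_step (\<pi> i))"
  shows "avg g = avg h"
  using sum.reindex_bij_betw[OF assms(1), of "\<lambda>i. h (unit_step i)"] by (simp add: avg_def assms(2))

text \<open>Expectation over \<open>n\<close> independent uniform steps, by conditioning on the
  first one.\<close>

primrec path_avg :: "nat \<Rightarrow> ((int ^ 'd) list \<Rightarrow> real) \<Rightarrow> real" where
  "path_avg 0 F = F []"
| "path_avg (Suc n) F = avg (\<lambda>v. path_avg n (\<lambda>xs. F (v # xs)))"

lemma path_avg_mono: "(\<And>xs. length xs = n \<Longrightarrow> F xs \<le> G xs) \<Longrightarrow> path_avg n F \<le> path_avg n G"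
  by (induction n arbitrary: F G) (auto intro!: avg_mono)

lemma path_avg_cong: "(\<And>xs. length xs = n \<Longrightarrow> F xs = G xs) \<Longrightarrow> path_avg n F = path_avg n G"
  by (intro antisym path_avg_mono) auto

lemma path_avg_const [simp]: "path_avg n (\<lambda>_. c) = c"
  by (induction n) auto

lemma path_avg_add: "path_avg n (\<lambda>xs. F xs + G xs) = path_avg n F + path_avg n G"
  by (induction n arbitrary: F G) (auto simp: avg_add)

lemma path_avg_diff: "path_avg n (\<lambda>xs. F xs - G xs) = path_avg n F - path_avg n G"
  by (induction n arbitrary: F G) (auto simp: avg_diff)

lemma path_avg_cmult: "path_avg n (\<lambda>xs. c * F xs) = c * path_avg n F"
  by (induction n arbitrary: F) (auto simp: avg_cmult)

lemma path_avg_multc: "path_avg n (\<lambda>xs. F xs * c) = path_avg n F * c"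
  using path_avg_cmult[of n c F] by (simp add: mult.commute)

lemma path_avg_nonneg: "(\<And>xs. length xs = n \<Longrightarrow> F xs \<ge> 0) \<Longrightarrow> path_avg n F \<ge> 0"
  using path_avg_mono[of n "\<lambda>_. 0" F] by simp

lemma path_avg_le_const: "(\<And>xs. length xs = n \<Longrightarrow> F xs \<le> c) \<Longrightarrow> path_avg n F \<le> c"
  using path_avg_mono[of n F "\<lambda>_. c"] by simp

lemma path_avg_append: "path_avg (m + n) F = path_avg m (\<lambda>xs. path_avg n (\<lambda>ys. F (xs @ ys)))"
  by (induction m arbitrary: F) auto

lemma path_avg_avg: "path_avg n (\<lambda>xs. avg (\<lambda>v. F v xs)) = avg (\<lambda>v. path_avg n (F v))"
proof (induction n arbitrary: F)
  case (Suc n)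
  have "path_avg n (\<lambda>xs. avg (\<lambda>v. F v (u # xs))) = avg (\<lambda>v. path_avg n (\<lambda>xs. F v (u # xs)))" for u
    by (rule Suc)
  then have "path_avg (Suc n) (\<lambda>xs. avg (\<lambda>v. F v xs)) = avg (\<lambda>u. avg (\<lambda>v. path_avg n (\<lambda>xs. F v (u # xs))))"
    by simp
  also have "\<dots> = avg (\<lambda>v. avg (\<lambda>u. path_avg n (\<lambda>xs. F v (u # xs))))"
    by (rule avg_swap)
  finally show ?case by simp
qed auto

lemma path_avg_Suc_snoc: "path_avg (Suc n) F = path_avg n (\<lambda>xs. avg (\<lambda>v. F (xs @ [v])))"
  using path_avg_append[of n 1 F] by simp

text \<open>Independent identically distributed steps are exchangeable. This allows the stretch
  before a block centre to be read backwards.\<close>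

lemma path_avg_rev: "path_avg n (\<lambda>xs. F (rev xs)) = path_avg n F"
proof (induction n arbitrary: F)
  case (Suc n)
  have "path_avg (Suc n) (\<lambda>xs. F (rev xs)) = avg (\<lambda>v. path_avg n (\<lambda>xs. F (rev xs @ [v])))"
    by simp
  also have "\<dots> = avg (\<lambda>v. path_avg n (\<lambda>xs. F (xs @ [v])))"
    using Suc[of "\<lambda>xs. F (xs @ [_])"] by simp
  also have "\<dots> = path_avg (Suc n) F"
    unfolding path_avg_Suc_snoc by (rule path_avg_avg[symmetric])
  finally show ?case .
qed auto

text \<open>Independence of two consecutive stretches of the walk.\<close>

lemma path_avg_prod: "path_avg (m + n) (\<lambda>xs. F (take m xs) * G (drop m xs)) = path_avg m F * path_avg n G"
proof -
  have "path_avg (m + n) (\<lambda>xs. F (take m xs) * G (drop m xs)) = path_avg m (\<lambda>xs. F xs * path_avg n G)"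
    unfolding path_avg_append by (rule path_avg_cong) (simp add: path_avg_cmult)
  then show ?thesis by (simp add: path_avg_multc)
qed

section \<open>Heat kernel bound\<close>

primrec srw1 :: "nat \<Rightarrow> int \<Rightarrow> real" where
  "srw1 0 y = of_bool (y = 0)"
| "srw1 (Suc n) y = (srw1 n (y + 1) + srw1 n (y - 1)) / 2"

lemma srw1_nonneg: "srw1 n y \<ge> 0"
  by (induction n arbitrary: y) auto

text \<open>Position \<open>y\<close> after \<open>n\<close> steps means \<open>(n + y) / 2\<close>
  steps up; the recursion is Pascal's rule.\<close>

lemma srw1_binomial:
  "srw1 n y = (if even (int n + y) \<and> int n + y \<ge> 0 then real (n choose nat ((int n + y) div 2)) / 2 ^ n else 0)"
proof (induction n arbitrary: y)
  case 0
  show ?case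
  proof (cases "even y \<and> y \<ge> 0")
    case True
    then obtain m where m: "y = 2 * m" "m \<ge> 0" by (auto elim: evenE)
    show ?thesis using m by (cases "m = 0") (auto simp: binomial_eq_0)
  qed auto
next
  case (Suc n)
  show ?case
  proof (cases "even (int n + 1 + y)")
    case True
    then obtain m where "int n + 1 + y = 2 * m" by (rule evenE)
    then have y: "y = 2 * m - int n - 1" by simp
    show ?thesis
    proof (cases "m \<ge> 1")
      case True
      define i where "i = nat (m - 1)"
      have mi: "m = int i + 1" using True by (simp add: i_def)
      have e: "nat (1 + int i) = Suc i" by simp
      show ?thesis unfolding srw1.simps Suc y mi
        by (simp add: e add_divide_distrib) 
    next
      case False
      then show ?thesis unfolding srw1.simps Suc y by (cases "m = 0") auto
    qed
  next
    case False
    then show ?thesis unfolding srw1.simps Suc by auto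
  qed
qed

text \<open>Consecutive terms have ratio \<open>(2n + 1) / (2n + 2)\<close>, and
  \<open>(2n + 1) (2n + 3) <= (2n + 2)^2\<close> carries the bound through the induction.\<close>

lemma central_binomial_upper: "real (2 * n choose n) / 4 ^ n \<le> 1 / sqrt (2 * real n + 1)"
proof (induction n)
  case (Suc n)
  have eq: "real (2 * Suc n choose Suc n) / 4 ^ Suc n = real (2 * n choose n) / 4 ^ n * ((2 * real n + 1) / (2 * real n + 2))"
  proof -
    have f: "real (2 * k choose k) = fact (2 * k) / (fact k * fact k)" for k
      using binomial_fact[of k "2 * k", where ?'a = real] by simp
    have g: "fact (2 * Suc n) = (2 * real n + 2) * ((2 * real n + 1) * fact (2 * n))"
      by (simp add: algebra_simps)
    have h: "fact (Suc n) = (real n + 1) * fact n"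
      by (simp add: algebra_simps)
    have "(2 * p + 2) * ((2 * p + 1) * F) / ((p + 1) * G * ((p + 1) * G)) / (4 * H)
        = F / (G * G) / H * ((2 * p + 1) / (2 * p + 2))" if "p \<ge> 0" "G > 0" "H > 0" for p F G H :: real
    proof -
      have "p + 1 \<noteq> 0" "2 * p + 2 \<noteq> 0" using that by auto
      then show ?thesis using that by (simp add: divide_simps) (simp add: algebra_simps)
    qed
    from this[of "real n" "fact n" "4 ^ n" "fact (2 * n)"] show ?thesis
      unfolding f g h by simp
  qed
  have "real (2 * Suc n choose Suc n) / 4 ^ Suc n \<le> 1 / sqrt (2 * real n + 1) * ((2 * real n + 1) / (2 * real n + 2))"
    unfolding eq by (intro mult_right_mono Suc) auto
  also have "\<dots> = (2 * real n + 1) / sqrt (2 * real n + 1) / (2 * real n + 2)"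
    by simp
  also have "\<dots> = sqrt (2 * real n + 1) / (2 * real n + 2)"
    by (subst real_div_sqrt) auto
  also have "\<dots> \<le> 1 / sqrt (2 * real (Suc n) + 1)"
  proof -
    have "sqrt (2 * real n + 1) * sqrt (2 * real n + 3) = sqrt ((2 * real n + 1) * (2 * real n + 3))"
      by (simp add: real_sqrt_mult)
    also have "\<dots> \<le> sqrt ((2 * real n + 2)\<^sup>2)"
      by (rule real_sqrt_le_mono) (simp add: power2_eq_square algebra_simps)
    finally have "sqrt (2 * real n + 1) * sqrt (2 * real n + 3) \<le> 2 * real n + 2" by simp
    then show ?thesis by (simp add: field_simps add.commute)
  qed
  finally show ?case .
qed auto

lemma srw1_even_le: "srw1 (2 * k) y \<le> 1 / sqrt (2 * real k + 1)"
proof -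
  have "real (2 * k choose i) / 2 ^ (2 * k) \<le> 1 / sqrt (2 * real k + 1)" for i
  proof -
    have "real (2 * k choose i) / 2 ^ (2 * k) \<le> real (2 * k choose k) / 2 ^ (2 * k)"
      by (intro divide_right_mono of_nat_mono binomial_maximum') auto
    then show ?thesis using central_binomial_upper[of k] by (simp add: power_mult)
  qed
  then show ?thesis by (auto simp: srw1_binomial)
qed

text \<open>At odd times the value is the mean of two values one step earlier. The form with
  \<open>n + 1\<close> serves both parities and is finite at \<open>n = 0\<close>.\<close>

lemma srw1_le: "srw1 n y \<le> sqrt (2 / (real n + 1))"
proof -
  have *: "1 / sqrt (2 * real k + 1) \<le> sqrt (2 / (2 * real k + 2))" for k
  proof -
    have "1 / sqrt (2 * real k + 1) = sqrt (1 / (2 * real k + 1))"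
      by (simp add: real_sqrt_divide)
    also have "\<dots> \<le> sqrt (2 / (2 * real k + 2))"
      by (intro real_sqrt_le_mono) (simp add: divide_simps)
    finally show ?thesis .
  qed
  have **: "sqrt (2 / (2 * real k + 2)) \<le> sqrt (2 / (2 * real k + 1))" for k
    by (simp add: frac_le)
  show ?thesis
  proof (cases "even n")
    case True
    then obtain k where "n = 2 * k" by (auto elim: evenE)
    then show ?thesis using order_trans[OF srw1_even_le[of k y] order_trans[OF *[of k] **[of k]]] by simp
  next
    case False
    then obtain k where k: "n = Suc (2 * k)" by (auto elim: oddE)
    have "srw1 n y \<le> 1 / sqrt (2 * real k + 1)"
      unfolding k using srw1_even_le[of k "y+1"] srw1_even_le[of k "y-1"] by simp
    then show ?thesis using *[of k] k by (simp add: add.commute)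
  qed
qed


section \<open>The lattice kernel through coordinate counters\<close>

primrec steps_avg :: "nat \<Rightarrow> (int ^ 'd \<Rightarrow> real) \<Rightarrow> int ^ 'd \<Rightarrow> real" where
  "steps_avg 0 g x = g x"
| "steps_avg (Suc m) g x = steps_avg m (\<lambda>y. avg (\<lambda>v. g (y + v))) x"

lemma steps_avg_path_avg: "steps_avg m g x = path_avg m (\<lambda>xs. g (x + sum_list xs))"
proof (induction m arbitrary: g)
  case (Suc m)
  show ?case unfolding path_avg_Suc_snoc steps_avg.simps Suc by (simp add: add.assoc)
qed auto

text \<open>Probability of going from \<open>x\<close> to 0 once it is known that \<open>n c\<close>
  steps are spent in coordinate \<open>c\<close>: the coordinates are then independent
  one-dimensional walks.\<close>

definition coord_kernel :: "('d \<Rightarrow> nat) \<Rightarrow> int ^ 'd \<Rightarrow> real" where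
  "coord_kernel n x = (\<Prod>c\<in>UNIV. srw1 (n c) (x $ c))"

lemma sum_UNIV_plus: "(\<Sum>i\<in>(UNIV::('a::finite + 'b::finite) set). f i) = (\<Sum>a\<in>UNIV. f (Inl a)) + (\<Sum>b\<in>UNIV. f (Inr b))"
proof -
  have "(UNIV::('a + 'b) set) = range Inl \<union> range Inr"
    by (auto, metis rangeI sum.exhaust)
  moreover have "sum f (range Inl \<union> range Inr) = sum f (range Inl) + sum f (range Inr)"
    by (rule sum.union_disjoint) auto
  ultimately have "(\<Sum>i\<in>(UNIV::('a + 'b) set). f i) = sum f (range Inl) + sum f (range Inr)"
    by metis
  then show ?thesis by (simp add: sum.reindex)
qed

text \<open>A uniform lattice step picks a coordinate uniformly and then a sign, so each counter
  advances with probability \<open>1/d\<close>.\<close>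

lemma avg_coord_kernel:
  fixes x :: "int ^ 'd"
  shows "avg (\<lambda>v. coord_kernel n (x + v)) = (\<Sum>c\<in>UNIV. coord_kernel (n(c := Suc (n c))) x) / real CARD('d)"
proof -
  define R where "R c = (\<Prod>c'\<in>UNIV - {c}. srw1 (n c') (x $ c'))" for c
  have split: "(\<Prod>c\<in>UNIV. f c) = f c0 * (\<Prod>c\<in>UNIV - {c0}. f c)" for f :: "'d \<Rightarrow> real" and c0
    by (simp add: prod.remove)
  have 1: "coord_kernel n (x + axis c 1) = srw1 (n c) (x $ c + 1) * R c" for c
    unfolding coord_kernel_def by (subst split[of _ c]) (simp add: R_def axis_def cong: prod.cong_simp)
  have 2: "coord_kernel n (x + - axis c 1) = srw1 (n c) (x $ c - 1) * R c" for c
    unfolding coord_kernel_def by (subst split[of _ c]) (simp add: R_def axis_def cong: prod.cong_simp)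
  have 3: "coord_kernel (n(c := Suc (n c))) x = srw1 (Suc (n c)) (x $ c) * R c" for c
    unfolding coord_kernel_def by (subst split[of _ c]) (simp add: R_def cong: prod.cong_simp)
  have "avg (\<lambda>v. coord_kernel n (x + v)) = (\<Sum>c\<in>UNIV. 2 * coord_kernel (n(c := Suc (n c))) x) / (2 * real CARD('d))"
    unfolding avg_def sum_UNIV_plus unit_step_def sum.case 1 2 3 sum.distrib[symmetric]
    by (simp add: algebra_simps add_divide_distrib)
  then show ?thesis by (simp add: sum_distrib_left[symmetric])
qed

lemma steps_avg_linear: "steps_avg m (\<lambda>y. (\<Sum>c\<in>A. G c y) / k) x = (\<Sum>c\<in>A. steps_avg m (G c) x) / k"
proof -
  have *: "path_avg m (\<lambda>xs. \<Sum>c\<in>A. F c xs) = (\<Sum>c\<in>A. path_avg m (F c))" for F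
  proof (induction m arbitrary: F)
    case (Suc m)
    have "path_avg m (\<lambda>xs. \<Sum>c\<in>A. F c (v # xs)) = (\<Sum>c\<in>A. path_avg m (\<lambda>xs. F c (v # xs)))" for v
      by (rule Suc)
    then show ?case by (simp add: avg_sum)
  qed auto
  show ?thesis unfolding steps_avg_path_avg divide_inverse path_avg_multc * ..
qed

text \<open>One step of a counter that advances with probability \<open>p\<close>. Bounding the
  power 3/2 of \<open>\<sigma> / (\<sigma> + 1)\<close> by its first power leaves
  \<open>1 - p / (\<sigma> + 1)\<close>, which for \<open>\<sigma> >= 1\<close> is at most
  \<open>1 - p / (2 \<sigma>)\<close>. The third is chosen because \<open>3/2 * 1/3 = 1/2\<close>
  matches this loss.\<close>

lemma inverse_power_three_halves:
  fixes \<sigma> p :: real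
  assumes "\<sigma> \<ge> 1" "0 \<le> p" "p \<le> 1"
  shows "p * (\<sigma> + 1) powr (-3/2) + (1 - p) * \<sigma> powr (-3/2) \<le> (\<sigma> + p / 3) powr (-3/2)"
proof -
  have 1: "(\<sigma> + 1) powr (-3/2) \<le> (\<sigma> / (\<sigma> + 1)) * \<sigma> powr (-3/2)"
  proof -
    have "(\<sigma> + 1) powr (-3/2) = (\<sigma> / (\<sigma> + 1)) powr (3/2) * \<sigma> powr (-3/2)"
      using assms by (simp add: powr_divide powr_minus field_simps)
    also have "(\<sigma> / (\<sigma> + 1)) powr (3/2) \<le> (\<sigma> / (\<sigma> + 1)) powr 1"
      by (rule powr_mono') (use assms in auto)
    finally show ?thesis using assms by (simp add: mult_right_mono)
  qed
  have 2: "(1 - p / (2 * \<sigma>)) * \<sigma> powr (-3/2) \<le> (\<sigma> + p / 3) powr (-3/2)"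
  proof -
    have eq: "\<sigma> + p / 3 = \<sigma> * (1 + p / (3 * \<sigma>))" using assms by (simp add: field_simps)
    have pos: "1 + p / (3 * \<sigma>) > 0" using assms by (simp add: add_pos_nonneg)
    have "1 - p / (2 * \<sigma>) \<le> exp (- (p / (2 * \<sigma>)))"
      using exp_ge_add_one_self[of "- (p / (2 * \<sigma>))"] by simp
    also have "\<dots> \<le> exp (-3/2 * ln (1 + p / (3 * \<sigma>)))"
      using ln_add_one_self_le_self[of "p / (3 * \<sigma>)"] assms by (simp add: field_simps)
    also have "\<dots> = (1 + p / (3 * \<sigma>)) powr (-3/2)"
      using pos by (simp add: powr_def)
    finally have "1 - p / (2 * \<sigma>) \<le> (1 + p / (3 * \<sigma>)) powr (-3/2)" .
    then have "(1 - p / (2 * \<sigma>)) * \<sigma> powr (-3/2) \<le> (1 + p / (3 * \<sigma>)) powr (-3/2) * \<sigma> powr (-3/2)"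
      by (rule mult_right_mono) simp
    also have "\<dots> = (\<sigma> + p / 3) powr (-3/2)"
      unfolding eq using assms pos by (simp add: powr_mult)
    finally show ?thesis .
  qed
  have "p * (\<sigma> + 1) powr (-3/2) + (1 - p) * \<sigma> powr (-3/2) \<le> p * ((\<sigma> / (\<sigma> + 1)) * \<sigma> powr (-3/2)) + (1 - p) * \<sigma> powr (-3/2)"
    using 1 assms by (intro add_right_mono mult_left_mono) auto
  also have "\<dots> = (1 - p / (\<sigma> + 1)) * \<sigma> powr (-3/2)"
    using assms by (simp add: field_simps)
  also have "\<dots> \<le> (1 - p / (2 * \<sigma>)) * \<sigma> powr (-3/2)"
    using assms by (intro mult_right_mono diff_left_mono divide_left_mono) auto
  finally show ?thesis using 2 by simp
qed

text \<open>The supersolution that dominates the kernel: the coordinate counters advance at mean speed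
  \<open>1/d\<close>, of which the time argument \<open>m\<close> claims only a third, leaving room for convexity.\<close>

lemma steps_avg_coord_kernel_le:
  fixes T :: "'d::finite set" and x :: "int ^ 'd"
  assumes "card T = 3"
  shows "steps_avg m (coord_kernel n) x \<le>
    (\<Sum>c\<in>T. 2 powr (3/2) * (real (n c) + 1 + real m / (3 * real CARD('d))) powr (-3/2))"
proof (induction m arbitrary: n x)
  case 0
  obtain a b c where T: "T = {a, b, c}" "a \<noteq> b" "a \<noteq> c" "b \<noteq> c"
    using assms by (auto simp: card_3_iff)
  define s where "s c = sqrt (2 / (real (n c) + 1))" for c
  have s0: "s c \<ge> 0" for c by (simp add: s_def)
  have le1: "srw1 n y \<le> 1" for n y 
  proof (induction n arbitrary: y)
    case (Suc n)
    have "srw1 n (y + 1) \<le> 1" "srw1 n (y - 1) \<le> 1" by (rule Suc)+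
    then show ?case by simp
  qed auto
  \<comment> \<open>The product over three coordinates is traded for a sum of cubes, so that the
    bound is a sum of functions of one counter each and the induction step can treat them
    separately.\<close>
  have cube: "u * v * w \<le> u ^ 3 + v ^ 3 + w ^ 3" if "u \<ge> 0" "v \<ge> 0" "w \<ge> 0" for u v w :: real
  proof -
    define z where "z = max u (max v w)"
    have "u * v * w \<le> z * z * z"
      unfolding z_def using that by (intro mult_mono) auto
    also have "\<dots> \<le> u ^ 3 + v ^ 3 + w ^ 3"
      using that unfolding z_def max_def by (auto simp: power3_eq_cube)
    finally show ?thesis .
  qed
  have s3: "s c ^ 3 = 2 powr (3/2) * (real (n c) + 1) powr (-3/2)" for c
  proof -
    have "s c ^ 3 = (2 / (real (n c) + 1)) powr (3/2)"
      by (simp add: s_def powr_half_sqrt[symmetric] powr_power)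
    then show ?thesis by (simp add: powr_divide powr_minus field_simps)
  qed
  have "coord_kernel n x = (\<Prod>c\<in>T. srw1 (n c) (x $ c)) * (\<Prod>c\<in>UNIV - T. srw1 (n c) (x $ c))"
    unfolding coord_kernel_def by (metis finite subset_UNIV mult.commute prod.subset_diff)
  \<comment> \<open>Three factors with exponent 1/2 already give 3/2; the remaining coordinates are
    bounded by 1.\<close>
  also have "\<dots> \<le> (\<Prod>c\<in>T. srw1 (n c) (x $ c)) * 1"
    by (intro mult_left_mono prod_le_1 prod_nonneg) (auto simp: srw1_nonneg le1)
  also have "\<dots> \<le> (\<Prod>c\<in>T. s c)"
    unfolding s_def by (simp, intro prod_mono) (auto simp: srw1_nonneg srw1_le)
  also have "\<dots> = s a * s b * s c" using T by simp
  also have "\<dots> \<le> s a ^ 3 + s b ^ 3 + s c ^ 3" by (rule cube) (rule s0)+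
  also have "\<dots> = (\<Sum>c\<in>T. s c ^ 3)" using T by simp
  finally show ?case by (simp add: s3)
next
  case (Suc m)
  define d where "d = real CARD('d)"
  have d: "d \<ge> 1" unfolding d_def by (simp add: Suc_leI)
  define \<phi> where "\<phi> m k = (real k + 1 + real m / (3 * d)) powr (-3/2)" for m k :: nat
  have step: "(\<Sum>c\<in>UNIV. \<phi> m ((n(c := Suc (n c))) c0)) / d \<le> \<phi> (Suc m) (n c0)" for c0
  proof -
    have "(\<Sum>c\<in>UNIV. \<phi> m ((n(c := Suc (n c))) c0)) = \<phi> m (Suc (n c0)) + (\<Sum>c\<in>UNIV - {c0}. \<phi> m (n c0))"
      by (subst sum.remove[of _ c0]) (auto intro!: sum.cong)
    also have "\<dots> = \<phi> m (Suc (n c0)) + (d - 1) * \<phi> m (n c0)"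
      using d by (simp add: d_def card_Diff_singleton of_nat_diff Suc_leI)
    finally have "(\<Sum>c\<in>UNIV. \<phi> m ((n(c := Suc (n c))) c0)) / d = (1/d) * \<phi> m (Suc (n c0)) + (1 - 1/d) * \<phi> m (n c0)"
      using d by (simp add: field_simps)
    also have "\<dots> \<le> \<phi> (Suc m) (n c0)"
      using inverse_power_three_halves[of "real (n c0) + 1 + real m / (3 * d)" "1/d"] d
      by (simp add: \<phi>_def algebra_simps add_divide_distrib)
    finally show ?thesis .
  qed
  have "steps_avg (Suc m) (coord_kernel n) x = (\<Sum>c\<in>UNIV. steps_avg m (coord_kernel (n(c := Suc (n c)))) x) / d"
    by (simp add: avg_coord_kernel steps_avg_linear d_def)
  also have "\<dots> \<le> (\<Sum>c\<in>UNIV. \<Sum>c0\<in>T. 2 powr (3/2) * \<phi> m ((n(c := Suc (n c))) c0)) / d"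
    unfolding \<phi>_def d_def by (intro divide_right_mono sum_mono Suc) auto
  also have "\<dots> = (\<Sum>c0\<in>T. 2 powr (3/2) * ((\<Sum>c\<in>UNIV. \<phi> m ((n(c := Suc (n c))) c0)) / d))"
    by (subst sum.swap) (simp add: sum_divide_distrib sum_distrib_left)
  also have "\<dots> \<le> (\<Sum>c0\<in>T. 2 powr (3/2) * \<phi> (Suc m) (n c0))"
    by (intro sum_mono mult_left_mono step) auto
  finally show ?case by (simp add: \<phi>_def d_def)
qed

text \<open>Three coordinates, with \<open>2 powr (3/2)\<close> from the one-dimensional bound and
  \<open>(3 d) powr (3/2)\<close> from the time scale \<open>m / (3 d)\<close>.\<close>

definition hk_const :: "'d::finite itself \<Rightarrow> real" where
  "hk_const _ = 3 * (6 * real CARD('d)) powr (3/2)"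

text \<open>With all counters at 0 the kernel is the indicator of the origin; the dimension supplies
  the three coordinates.\<close>

lemma heat_kernel_le:
  fixes z :: "int ^ 'd"
  assumes "CARD('d) \<ge> 3" "m \<ge> 1"
  shows "path_avg m (\<lambda>xs. of_bool (x + sum_list xs = z)) \<le> hk_const TYPE('d) * real m powr (-3/2)"
proof -
  obtain T :: "'d set" where T: "card T = 3"
    using obtain_subset_with_card_n[OF assms(1)] by auto
  have ck: "coord_kernel (\<lambda>_. 0) y = of_bool (y = 0)" for y :: "int ^ 'd"
  proof (cases "y = 0")
    case False
    then obtain c where "y $ c \<noteq> 0" by (auto simp: vec_eq_iff)
    then have "coord_kernel (\<lambda>_. 0) y = 0" unfolding coord_kernel_def by (intro prod_zero) auto
    then show ?thesis using False by simp
  qed (simp add: coord_kernel_def)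
  have "path_avg m (\<lambda>xs. of_bool (x + sum_list xs = z)) = steps_avg m (coord_kernel (\<lambda>_. 0)) (x - z)"
    unfolding steps_avg_path_avg ck by (rule path_avg_cong) (auto simp: algebra_simps)
  also have "\<dots> \<le> (\<Sum>c\<in>T. 2 powr (3/2) * (1 + real m / (3 * real CARD('d))) powr (-3/2))"
    using steps_avg_coord_kernel_le[OF T, of m "\<lambda>_. 0" "x - z"] by simp
  also have "\<dots> = 3 * (2 powr (3/2) * (1 + real m / (3 * real CARD('d))) powr (-3/2))"
    using T by simp
  also have "\<dots> \<le> 3 * (2 powr (3/2) * (real m / (3 * real CARD('d))) powr (-3/2))"
    using assms by (intro mult_left_mono powr_mono2') (auto intro!: divide_pos_pos)
  also have "\<dots> = hk_const TYPE('d) * real m powr (-3/2)"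
  proof -
    have "6 powr (3/2) = 2 powr (3/2) * (3::real) powr (3/2)" by (simp add: powr_mult[symmetric])
    then show ?thesis using assms by (simp add: hk_const_def powr_divide powr_minus powr_mult field_simps)
  qed
  finally show ?thesis .
qed

text \<open>Integral comparison in telescoping form, each term being at most a difference of two
  consecutive values of \<open>2 / sqrt r\<close>.\<close>

lemma three_halves_sum_le:
  assumes "m \<ge> 1"
  shows "(\<Sum>r\<in>{m<..m + k}. real r powr (-3/2)) \<le> 2 / sqrt (real m)"
proof -
  have step: "real (Suc r) powr (-3/2) \<le> 2 / sqrt (real r) - 2 / sqrt (real (Suc r))" if "r \<ge> 1" for r
  proof -
    define s t where "s = sqrt (real r)" and "t = sqrt (real (Suc r))"
    have st: "s > 0" "t > 0" "s \<le> t" "t\<^sup>2 - s\<^sup>2 = 1" using that by (auto simp: s_def t_def)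
    have "real (Suc r) powr (-3/2) = t powr (-3)"
      by (simp add: t_def powr_half_sqrt[symmetric] powr_powr)
    also have "\<dots> = 2 / (t * t * (t + t))"
      using st by (simp add: powr_minus powr_numeral power3_eq_cube field_simps)
    also have "\<dots> \<le> 2 / (s * t * (s + t))"
      using st by (intro divide_left_mono mult_mono) auto
    also have "\<dots> = 2 * (t\<^sup>2 - s\<^sup>2) / (s * t * (s + t))" using st by simp
    also have "\<dots> = 2 / s - 2 / t"
      using st(1-3) by (simp add: divide_simps) (simp add: algebra_simps power2_eq_square)
    finally show ?thesis by (simp add: s_def t_def)
  qed
  have "(\<Sum>r\<in>{m<..m + k}. real r powr (-3/2)) \<le> 2 / sqrt (real m) - 2 / sqrt (real (m + k))"
  proof (induction k)
    case (Suc k)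
    have "{m<..m + Suc k} = insert (Suc (m + k)) {m<..m + k}" by auto
    then show ?case using Suc step[of "m + k"] assms by simp
  qed auto
  also have "\<dots> \<le> 2 / sqrt (real m)" by simp
  finally show ?thesis .
qed

section \<open>Hitting probabilities\<close>

lemma unit_step_nonzero [simp]: "unit_step i \<noteq> 0"
  by (auto simp: unit_step_def axis_eq_0_iff split: sum.split)

definition flip :: "'d + 'd \<Rightarrow> 'd + 'd" where
  "flip i = (case i of Inl j \<Rightarrow> Inr j | Inr j \<Rightarrow> Inl j)"

lemma flip_flip [simp]: "flip (flip i) = i"
  by (auto simp: flip_def split: sum.split)

lemma bij_flip: "bij flip"
  by (metis bij_betw_def flip_flip inj_def surj_def)

lemma unit_step_flip [simp]: "unit_step (flip i) = - unit_step i"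
  by (auto simp: flip_def unit_step_def split: sum.split)

text \<open>Probability that the walk from \<open>x\<close> reaches \<open>z\<close> within
  \<open>n\<close> steps and enters \<open>A\<close> at no earlier positive time. The start is not
  inspected, so \<open>x = z\<close> gives a return probability, and \<open>x\<close> may lie in
  \<open>A\<close>.\<close>

primrec hit :: "int ^ 'd \<Rightarrow> (int ^ 'd) set \<Rightarrow> nat \<Rightarrow> int ^ 'd \<Rightarrow> real" where
  "hit z A 0 x = 0"
| "hit z A (Suc n) x = avg (\<lambda>v. if x + v = z then 1 else if x + v \<in> A then 0 else hit z A n (x + v))"

definition hit_inf :: "int ^ 'd \<Rightarrow> (int ^ 'd) set \<Rightarrow> int ^ 'd \<Rightarrow> real" where
  "hit_inf z A x = (SUP n. hit z A n x)"

lemma hit_nonneg: "hit z A n x \<ge> 0"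
  by (induction n arbitrary: x) (auto intro!: avg_nonneg)

lemma hit_le_1: "hit z A n x \<le> 1"
  by (induction n arbitrary: x) (auto intro!: avg_le_const)

lemma hit_le_Suc: "hit z A n x \<le> hit z A (Suc n) x"
proof (induction n arbitrary: x)
  case (Suc n)
  show ?case unfolding hit.simps(2)[of z A "Suc n"] hit.simps(2)[of z A n]
    by (intro avg_mono) (auto intro: Suc[simplified])
qed (simp add: avg_nonneg)

lemma hit_incseq: "incseq (\<lambda>n. hit z A n x)"
  by (intro incseq_SucI hit_le_Suc)

lemma hit_bdd: "bdd_above (range (\<lambda>n. hit z A n x))"
  using hit_le_1 by (auto intro!: bdd_aboveI[of _ 1])

lemma hit_tendsto: "(\<lambda>n. hit z A n x) \<longlonglongrightarrow> hit_inf z A x"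
  unfolding hit_inf_def by (rule LIMSEQ_incseq_SUP[OF hit_bdd hit_incseq])

lemma hit_le_inf: "hit z A n x \<le> hit_inf z A x"
  unfolding hit_inf_def by (rule cSUP_upper[OF _ hit_bdd]) auto

lemma hit_inf_nonneg: "hit_inf z A x \<ge> 0"
  using hit_nonneg hit_le_inf order_trans by blast

lemma hit_inf_least: "(\<And>n. hit z A n x \<le> c) \<Longrightarrow> hit_inf z A x \<le> c"
  unfolding hit_inf_def by (rule cSUP_least) auto

lemma hit_inf_eq:
  "hit_inf z A x = avg (\<lambda>v. if x + v = z then 1 else if x + v \<in> A then 0 else hit_inf z A (x + v))"
proof (rule LIMSEQ_unique)
  show "(\<lambda>n. hit z A (Suc n) x) \<longlonglongrightarrow> hit_inf z A x"
    using hit_tendsto by (rule LIMSEQ_Suc)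
  show "(\<lambda>n. hit z A (Suc n) x) \<longlonglongrightarrow>
      avg (\<lambda>v. if x + v = z then 1 else if x + v \<in> A then 0 else hit_inf z A (x + v))"
    unfolding hit.simps by (rule avg_tendsto) (auto intro: hit_tendsto)
qed

text \<open>Permuting the directions leaves the uniform average unchanged, so lattice symmetries
  preserve hitting probabilities; injectivity transports the tests for \<open>z\<close> and
  \<open>A\<close>.\<close>

lemma hit_symmetry:
  fixes \<phi> :: "int ^ 'd \<Rightarrow> int ^ 'd"
  assumes "bij \<pi>" "inj \<phi>" "\<And>x i. \<phi> (x + unit_step i) = \<phi> x + unit_step (\<pi> i)"
  shows "hit (\<phi> z) (\<phi> ` A) n (\<phi> x) = hit z A n x"
proof (induction n arbitrary: x)
  case (Suc n)
  have "avg (\<lambda>v. if x + v = z then 1 else if x + v \<in> A then 0 else hit z A n (x + v)) =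
      avg (\<lambda>v. if \<phi> x + v = \<phi> z then 1 else if \<phi> x + v \<in> \<phi> ` A then 0 else hit (\<phi> z) (\<phi> ` A) n (\<phi> x + v))"
    by (rule avg_bij[OF assms(1)])
      (simp add: assms(3)[symmetric] inj_eq[OF assms(2)] inj_image_mem_iff[OF assms(2)] Suc)
  then show ?case by simp
qed auto

lemma hit_inf_symmetry:
  fixes \<phi> :: "int ^ 'd \<Rightarrow> int ^ 'd"
  assumes "bij \<pi>" "inj \<phi>" "\<And>x i. \<phi> (x + unit_step i) = \<phi> x + unit_step (\<pi> i)"
  shows "hit_inf (\<phi> z) (\<phi> ` A) (\<phi> x) = hit_inf z A x"
  unfolding hit_inf_def hit_symmetry[OF assms] ..

lemma hit_inf_reflect: "hit_inf (c - z) ((\<lambda>y. c - y) ` A) (c - x) = hit_inf z A x"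
  by (rule hit_inf_symmetry[OF bij_flip]) (auto simp: inj_def)

text \<open>Transposing two coordinates and reflecting in the origin both fix the origin, and
  together they carry any unit step to any other.\<close>

lemma hit_inf_unit_step_eq:
  fixes i j :: "'d::finite + 'd"
  shows "hit_inf 0 {} (unit_step i) = hit_inf 0 {} (unit_step j)"
proof -
  have pos: "hit_inf 0 {} (unit_step (Inl a)) = hit_inf 0 {} (unit_step (Inl b))" for a b :: 'd
  proof -
    define \<tau> where "\<tau> = Transposition.transpose a b"
    have \<tau>: "\<tau> (\<tau> c) = c" for c by (simp add: \<tau>_def)
    define \<phi> where "\<phi> x = (\<chi> c. x $ \<tau> c)" for x :: "int ^ 'd"
    define \<pi> where "\<pi> = map_sum \<tau> \<tau>"
    have "\<pi> (\<pi> i) = i" for i by (cases i) (auto simp: \<pi>_def \<tau>)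
    then have bij: "bij \<pi>" by (metis bij_betw_def inj_def surj_def)
    have "\<phi> (\<phi> x) = x" for x by (simp add: \<phi>_def \<tau> vec_eq_iff)
    then have inj: "inj \<phi>" by (metis injI)
    have ax: "\<phi> (axis c 1) = axis (\<tau> c) 1" for c
      by (auto simp: \<phi>_def axis_def vec_eq_iff \<tau>)
    have add: "\<phi> (x + y) = \<phi> x + \<phi> y" "\<phi> (x - y) = \<phi> x - \<phi> y" "\<phi> 0 = 0" for x y
      by (auto simp: \<phi>_def vec_eq_iff)
    have "\<phi> (x + unit_step i) = \<phi> x + unit_step (\<pi> i)" for x i
      by (cases i) (auto simp: add unit_step_def \<pi>_def ax)
    from hit_inf_symmetry[OF bij inj this, of 0 "{}" "unit_step (Inl a)"]
    have "hit_inf 0 {} (\<phi> (unit_step (Inl a))) = hit_inf 0 {} (unit_step (Inl a))"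
      by (simp add: add)
    moreover have "\<phi> (unit_step (Inl a)) = unit_step (Inl b)"
      by (simp add: unit_step_def ax \<tau>_def)
    ultimately show ?thesis by simp
  qed
  have neg: "hit_inf 0 {} (unit_step (Inr a)) = hit_inf 0 {} (unit_step (Inl a))" for a :: 'd
    using hit_inf_reflect[of 0 0 "{}" "unit_step (Inl a)"] by (simp add: unit_step_def)
  show ?thesis
    by (cases i; cases j) (metis pos neg)+
qed

definition return_prob :: "'d::finite itself \<Rightarrow> real" where
  "return_prob _ = hit_inf 0 {} (0 :: int ^ 'd)"

text \<open>The first step always leaves 0, so the return probability is the mean over the
  neighbours, where all values agree.\<close>

lemma hit_inf_unit_step: "hit_inf 0 {} (unit_step i :: int ^ 'd) = return_prob TYPE('d)"
proof -
  have "return_prob TYPE('d) = avg (\<lambda>v :: int ^ 'd. hit_inf 0 {} v)"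
    unfolding return_prob_def by (subst hit_inf_eq) (auto intro!: avg_cong)
  also have "\<dots> = avg (\<lambda>v :: int ^ 'd. hit_inf 0 {} (unit_step i :: int ^ 'd))"
    by (intro avg_cong hit_inf_unit_step_eq)
  finally show ?thesis by simp
qed

lemma return_prob_pos: "return_prob TYPE('d::finite) > 0"
proof -
  have ge: "avg g \<ge> 1 / (2 * real CARD('d))" if "g (unit_step i) = 1" "\<And>j. g (unit_step j) \<ge> 0" for g and i :: "'d + 'd"
  proof -
    have "g (unit_step i) \<le> (\<Sum>j\<in>UNIV. g (unit_step j))"
      by (rule member_le_sum) (auto intro: that(2))
    then show ?thesis using that(1) by (simp add: avg_def divide_right_mono)
  qed
  define i :: "'d + 'd" where "i = undefined"
  have "1 / (2 * real CARD('d)) \<le> hit_inf 0 {} (unit_step i :: int ^ 'd)"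
    by (subst hit_inf_eq, rule ge[of _ "flip i"]) (auto simp: hit_inf_nonneg)
  then show ?thesis
    unfolding hit_inf_unit_step by (smt (verit) zero_less_card_finite divide_pos_pos of_nat_0_less_iff)
qed

section \<open>Transience from the heat kernel bound\<close>

definition ret :: "nat \<Rightarrow> int ^ 'd \<Rightarrow> real" where
  "ret m x = path_avg m (\<lambda>xs. of_bool (x + sum_list xs = 0))"

lemma ret_0: "ret 0 x = of_bool (x = 0)"
  by (simp add: ret_def)

lemma ret_Suc: "ret (Suc m) x = avg (\<lambda>v. ret m (x + v))"
  by (simp add: ret_def add.assoc)

lemma ret_nonneg: "ret m x \<ge> 0"
  by (simp add: ret_def path_avg_nonneg)

lemma ret_le:
  fixes x :: "int ^ 'd"
  assumes "CARD('d) \<ge> 3" "m \<ge> 1"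
  shows "ret m x \<le> hk_const TYPE('d) * real m powr (-3/2)"
  unfolding ret_def by (rule heat_kernel_le[OF assms])

lemma hk_const_pos: "hk_const TYPE('d::finite) > 0"
  by (simp add: hk_const_def)

lemma ret_summable:
  fixes x :: "int ^ 'd"
  assumes "CARD('d::finite) \<ge> 3"
  shows "summable (\<lambda>m. ret (Suc m) x)"
proof (rule summable_comparison_test)
  have "summable (\<lambda>m. real m powr (-3/2))" by (subst summable_real_powr_iff) simp
  then have "summable (\<lambda>m. real (Suc m) powr (-3/2))" by (subst summable_Suc_iff)
  then show "summable (\<lambda>m. hk_const TYPE('d) * real (Suc m) powr (-3/2))" by (rule summable_mult)
  show "\<exists>N. \<forall>n\<ge>N. norm (ret (Suc n) x) \<le> hk_const TYPE('d) * real (Suc n) powr (-3/2)"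
    using ret_le[OF assms, of "Suc _"] by (simp add: ret_nonneg del: of_nat_Suc)
qed

text \<open>Transience: the expected number of visits to \<open>0\<close> satisfies the renewal equation, which
  bounds the return probability by \<open>N 0 / (1 + N 0)\<close>.\<close>

lemma return_prob_less_1:
  assumes "CARD('d::finite) \<ge> 3"
  shows "return_prob TYPE('d) < 1"
proof -
  define N where "N x = (\<Sum>m. ret (Suc m) x)" for x :: "int ^ 'd"
  have sm0: "summable (\<lambda>m. ret m x)" for x :: "int ^ 'd"
    using ret_summable[OF assms, of x] by (subst (asm) summable_Suc_iff)
  have N0: "N x \<ge> 0" for x unfolding N_def by (intro suminf_nonneg ret_summable assms ret_nonneg)
  have ren: "N x = avg (\<lambda>v. of_bool (x + v = 0) + N (x + v))" for x
  proof -
    have "(\<lambda>m. avg (\<lambda>v. ret m (x + v))) sums avg (\<lambda>v. of_bool (x + v = 0) + N (x + v))"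
    proof -
      have "(\<lambda>m. ret m y) sums (of_bool (y = 0) + N y)" for y :: "int ^ 'd"
        using sums_Suc[OF summable_sums[OF ret_summable[OF assms, of y]]]
        by (simp add: ret_0 N_def add.commute)
      then show ?thesis unfolding avg_def by (intro sums_divide sums_sum)
    qed
    then have "(\<lambda>m. ret (Suc m) x) sums avg (\<lambda>v. of_bool (x + v = 0) + N (x + v))"
      by (simp add: ret_Suc)
    then show ?thesis unfolding N_def by (simp add: sums_iff)
  qed
  \<comment> \<open>A walk that reaches 0 has this visit and \<open>N 0\<close> further expected
    ones. Induction on the horizon takes the place of a decomposition by the hitting time.\<close>
  have main: "hit 0 {} n x * (1 + N 0) \<le> N x" for n x
  proof (induction n arbitrary: x)
    case (Suc n)
    have "hit 0 {} (Suc n) x * (1 + N 0) =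
        avg (\<lambda>v. (if x + v = 0 then 1 else hit 0 {} n (x + v)) * (1 + N 0))"
      unfolding avg_multc by (auto intro!: avg_cong)
    also have "\<dots> \<le> avg (\<lambda>v. of_bool (x + v = 0) + N (x + v))"
      by (intro avg_mono) (auto simp: Suc)
    also have "\<dots> = N x" by (rule ren[symmetric])
    finally show ?case .
  qed (simp add: N0)
  have "hit 0 {} n (0 :: int ^ 'd) \<le> N 0 / (1 + N 0)" for n
    using main[of n 0] N0[of 0] by (simp add: pos_le_divide_eq)
  then have "return_prob TYPE('d) \<le> N 0 / (1 + N 0)"
    unfolding return_prob_def by (rule hit_inf_least)
  also have "\<dots> < 1" using N0[of 0] by simp
  finally show ?thesis .
qed

section \<open>Entrance probabilities of a neighbouring pair\<close>

definition \<alpha>\<^sub>d :: "'d::finite itself \<Rightarrow> real" where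
  "\<alpha>\<^sub>d T = return_prob T / (1 + return_prob T)"

lemma \<alpha>\<^sub>d_bounds:
  assumes "CARD('d::finite) \<ge> 3"
  shows "0 < \<alpha>\<^sub>d TYPE('d)" "\<alpha>\<^sub>d TYPE('d) < 1 / 2"
  using return_prob_pos[where ?'d = 'd] return_prob_less_1[OF assms] by (auto simp: \<alpha>\<^sub>d_def field_simps)

text \<open>To hit 0, either enter the pair at 0, or enter it at \<open>e\<close> and hit 0 from
  there. For one inequality the right-hand side solves the one-step equation and so dominates every
  finite horizon; the other is shown for finite horizons and passed to the limit.\<close>

lemma hit_decompose:
  fixes e x :: "int ^ 'd"
  assumes "e \<noteq> 0"
  shows "hit_inf 0 {} x = hit_inf 0 {e} x + hit_inf e {0} x * hit_inf 0 {} e"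
proof (rule antisym)
  let ?g = "\<lambda>x. hit_inf 0 {e} x + hit_inf e {0} x * hit_inf 0 {} e"
  have g: "?g x = avg (\<lambda>v. if x + v = 0 then 1 else if x + v = e then hit_inf 0 {} e else ?g (x + v))" for x
    by (subst (1) hit_inf_eq, subst (2) hit_inf_eq, subst avg_multc[symmetric], subst avg_add[symmetric])
      (use assms in \<open>auto intro!: avg_cong\<close>)
  have "hit 0 {} n x \<le> ?g x" for n x
  proof (induction n arbitrary: x)
    case (Suc n)
    show ?case unfolding g[of x] hit.simps
      by (intro avg_mono) (use Suc hit_le_inf in auto)
  qed (simp add: hit_inf_nonneg)
  then show "hit_inf 0 {} x \<le> ?g x" by (rule hit_inf_least)
  have "hit 0 {e} n x + hit e {0} n x * hit_inf 0 {} e \<le> hit_inf 0 {} x" for n x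
  proof (induction n arbitrary: x)
    case (Suc n)
    have "hit 0 {e} (Suc n) x + hit e {0} (Suc n) x * hit_inf 0 {} e =
       avg (\<lambda>v. if x + v = 0 then 1 else if x + v = e then hit_inf 0 {} e else
         hit 0 {e} n (x + v) + hit e {0} n (x + v) * hit_inf 0 {} e)"
      unfolding hit.simps avg_multc[symmetric] avg_add[symmetric]
      using assms by (auto intro!: avg_cong)
    also have "\<dots> \<le> hit_inf 0 {} x"
      by (subst (2) hit_inf_eq, intro avg_mono) (use Suc in auto)
    finally show ?case .
  qed (simp add: hit_inf_nonneg)
  then show "?g x \<le> hit_inf 0 {} x"
    by (intro LIMSEQ_le_const2[OF tendsto_add[OF hit_tendsto tendsto_mult_right[OF hit_tendsto]]]) auto
qed

text \<open>Let \<open>a\<close> and \<open>b\<close> be the chances, from 0, of entering the pair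
  at 0 and at \<open>e\<close>, and \<open>h\<close> the return probability. The decomposition from
  0 gives \<open>h = a + b h\<close>, that from \<open>e\<close> with the reflection gives
  \<open>h = b + a h\<close>. Hence \<open>(a - b) (1 - h) = 0\<close>, and transience forces
  \<open>a = b = h / (1 + h)\<close>.\<close>

lemma hit_pair:
  fixes e :: "int ^ 'd"
  assumes "CARD('d) \<ge> 3" "e = unit_step i"
  shows "hit_inf 0 {e} 0 = \<alpha>\<^sub>d TYPE('d)" "hit_inf e {0} 0 = \<alpha>\<^sub>d TYPE('d)"
    "hit_inf 0 {e} e = \<alpha>\<^sub>d TYPE('d)" "hit_inf e {0} e = \<alpha>\<^sub>d TYPE('d)"
proof -
  define h where "h = return_prob TYPE('d)"
  have h: "0 < h" "h < 1" using return_prob_pos return_prob_less_1[OF assms(1)] by (auto simp: h_def)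
  have e: "e \<noteq> 0" by (simp add: assms)
  have he: "hit_inf 0 {} e = h" "hit_inf 0 {} (0 :: int ^ 'd) = h"
    by (simp_all add: assms(2) hit_inf_unit_step h_def return_prob_def)
  have r: "hit_inf 0 {e} e = hit_inf e {0} 0" "hit_inf e {0} e = hit_inf 0 {e} 0"
    using hit_inf_reflect[of e 0 "{e}" e] hit_inf_reflect[of e e "{0}" e] by simp_all
  define a b where "a = hit_inf 0 {e} 0" and "b = hit_inf e {0} 0"
  have 1: "h = a + b * h" using hit_decompose[OF e, of 0] he by (simp add: a_def b_def)
  have 2: "h = b + a * h" using hit_decompose[OF e, of e] he by (simp add: a_def b_def r)
  have "(a - b) * (1 - h) = 0" using 1 2 by (simp add: algebra_simps)
  then have "a = b" using h by simp
  then have "a * (1 + h) = h" using 1 by (simp add: algebra_simps)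
  then have "a = h / (1 + h)" using h by (simp add: field_simps)
  then show "hit_inf 0 {e} 0 = \<alpha>\<^sub>d TYPE('d)" "hit_inf e {0} 0 = \<alpha>\<^sub>d TYPE('d)"
    "hit_inf 0 {e} e = \<alpha>\<^sub>d TYPE('d)" "hit_inf e {0} e = \<alpha>\<^sub>d TYPE('d)"
    using \<open>a = b\<close> unfolding r by (auto simp: \<alpha>\<^sub>d_def h_def a_def b_def)
qed

text \<open>The increment of \<open>hit\<close> at step \<open>n + 1\<close> is the chance that the
  first arrival happens exactly then, hence at most the chance of being at \<open>z\<close>, to
  which the heat kernel bound applies.\<close>

lemma hit_tail:
  fixes x :: "int ^ 'd"
  assumes "CARD('d) \<ge> 3" "m \<ge> 1"
  shows "hit_inf z A x - hit z A m x \<le> 2 * hk_const TYPE('d) / sqrt (real m)"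
proof -
  have step: "hit z A (Suc n) x - hit z A n x \<le> ret (Suc n) (x - z)" for n x
  proof (induction n arbitrary: x)
    case 0
    show ?case unfolding hit.simps ret_Suc ret_0 diff_0_right
      by (rule avg_mono) (auto simp: algebra_simps)
  next
    case (Suc n)
    show ?case unfolding hit.simps(2)[of z A "Suc n" x] hit.simps(2)[of z A n x] ret_Suc[of "Suc n"] avg_diff[symmetric]
      by (rule avg_mono) (use Suc[of "x + unit_step _"] in \<open>auto simp: ret_nonneg algebra_simps simp del: hit.simps\<close>)
  qed
  have le: "hit z A (m + k) x - hit z A m x \<le> hk_const TYPE('d) * (\<Sum>r\<in>{m<..m + k}. real r powr (-3/2))" for k
  proof (induction k)
    case (Suc k)
    have "{m<..m + Suc k} = insert (Suc (m + k)) {m<..m + k}" by auto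
    then have "hk_const TYPE('d) * (\<Sum>r\<in>{m<..m + Suc k}. real r powr (-3/2)) =
        hk_const TYPE('d) * real (Suc (m + k)) powr (-3/2) + hk_const TYPE('d) * (\<Sum>r\<in>{m<..m + k}. real r powr (-3/2))"
      by (simp add: algebra_simps)
    moreover have "ret (Suc (m + k)) (x - z) \<le> hk_const TYPE('d) * real (Suc (m + k)) powr (-3/2)"
      by (rule ret_le[OF assms(1)]) simp
    ultimately show ?case using Suc step[of "m + k" x] by (simp del: hit.simps)
  qed auto
  have "hit z A n x \<le> hit z A m x + 2 * hk_const TYPE('d) / sqrt (real m)" for n
  proof -
    have "hit z A n x \<le> hit z A (m + n) x"
      using hit_incseq[of z A x] by (simp add: incseq_def)
    also have "\<dots> \<le> hit z A m x + hk_const TYPE('d) * (2 / sqrt (real m))"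
      using le[of n] mult_left_mono[OF three_halves_sum_le[OF assms(2), of n], of "hk_const TYPE('d)"]
        hk_const_pos[where ?'d = 'd] by linarith
    finally show ?thesis by (simp add: mult.commute)
  qed
  from hit_inf_least[OF this] show ?thesis by simp
qed

section \<open>The joint law of two local times\<close>

primrec visits :: "int ^ 'd \<Rightarrow> int ^ 'd \<Rightarrow> (int ^ 'd) list \<Rightarrow> nat" where
  "visits z x [] = 0"
| "visits z x (v # vs) = of_bool (x + v = z) + visits z (x + v) vs"

text \<open>Total weight of all orders in which \<open>k\<close> entries at one site and
  \<open>l\<close> at the other can occur, each entry having probability \<open>a\<close>; the
  factor for the final escape is left out.\<close>

definition mult_weight :: "real \<Rightarrow> nat \<Rightarrow> nat \<Rightarrow> real" where
  "mult_weight a k l = real (k + l choose k) * a ^ (k + l)"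

text \<open>What remains after a first entry at 0. The case \<open>k = 0\<close> is separate because
  \<open>k - 1\<close> truncates.\<close>

definition weight_left :: "real \<Rightarrow> nat \<Rightarrow> nat \<Rightarrow> real" where
  "weight_left a k l = (if k = 0 then 0 else mult_weight a (k - 1) l)"

definition weight_right :: "real \<Rightarrow> nat \<Rightarrow> nat \<Rightarrow> real" where
  "weight_right a k l = (if l = 0 then 0 else mult_weight a k (l - 1))"

lemma mult_weight_00 [simp]: "mult_weight a 0 0 = 1"
  by (simp add: mult_weight_def)

lemma mult_weight_nonneg: "a \<ge> 0 \<Longrightarrow> mult_weight a k l \<ge> 0"
  by (simp add: mult_weight_def)

lemma weight_nonneg: "a \<ge> 0 \<Longrightarrow> weight_left a k l \<ge> 0" "a \<ge> 0 \<Longrightarrow> weight_right a k l \<ge> 0"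
  by (simp_all add: weight_left_def weight_right_def mult_weight_nonneg)

text \<open>Pascal's rule, read as a decision on the site of the first entry.\<close>

lemma mult_weight_pascal:
  assumes "(k, l) \<noteq> (0, 0)"
  shows "mult_weight a k l = a * weight_left a k l + a * weight_right a k l"
proof (cases k)
  case 0
  then show ?thesis using assms by (cases l) (auto simp: mult_weight_def weight_left_def weight_right_def)
next
  case (Suc k')
  show ?thesis
    by (cases l) (auto simp: Suc mult_weight_def weight_left_def weight_right_def algebra_simps)
qed

lemma no_visit_prob:
  assumes "e \<noteq> 0"
  shows "path_avg T (\<lambda>xs. of_bool (visits 0 x xs = 0 \<and> visits e x xs = 0)) = 1 - hit 0 {e} T x - hit e {0} T x"
proof (induction T arbitrary: x)
  case (Suc T)
  have "path_avg (Suc T) (\<lambda>xs. of_bool (visits 0 x xs = 0 \<and> visits e x xs = 0)) =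
     avg (\<lambda>v. 1 - (if x + v = 0 then 1 else if x + v \<in> {e} then 0 else hit 0 {e} T (x + v))
        - (if x + v = e then 1 else if x + v \<in> {0} then 0 else hit e {0} T (x + v)))"
    unfolding path_avg.simps by (rule avg_cong) (use assms in \<open>auto simp: Suc[symmetric]\<close>)
  then show ?case by (simp add: avg_diff)
qed auto

locale neighbour_pair =
  fixes e :: "int ^ 'd" and i :: "'d + 'd"
  assumes dim: "CARD('d) \<ge> 3" and e_step: "e = unit_step i"
begin

abbreviation "\<alpha> \<equiv> hit_inf 0 {e} 0"

lemma \<alpha>_eq: "\<alpha> = \<alpha>\<^sub>d TYPE('d)"
  by (rule hit_pair[OF dim e_step])

lemma hit_eq_\<alpha>: "hit_inf e {0} 0 = \<alpha>" "hit_inf 0 {e} e = \<alpha>" "hit_inf e {0} e = \<alpha>"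
  by (simp_all add: hit_pair[OF dim e_step])

lemma e_nonzero: "e \<noteq> 0" by (simp add: e_step)

lemma \<alpha>_pos: "\<alpha> > 0" and \<alpha>_half: "\<alpha> < 1 / 2"
  using \<alpha>\<^sub>d_bounds[OF dim] by (auto simp: \<alpha>_eq)

text \<open>Induction on the horizon with a first-entry decomposition and arbitrary start: off the
  pair the bound is propagated by the one-step equation of \<open>hit_inf\<close>, on it by Pascal's
  rule. The count \<open>(0, 0)\<close> gets the trivial bound 1.\<close>

lemma visits_upper_aux:
  "path_avg n (\<lambda>xs. of_bool (visits 0 x xs = k \<and> visits e x xs = l)) \<le>
    (if k = 0 \<and> l = 0 then 1 else hit_inf 0 {e} x * weight_left \<alpha> k l + hit_inf e {0} x * weight_right \<alpha> k l)"
proof (induction n arbitrary: k l x)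
  case 0
  show ?case using \<alpha>_pos by (auto simp: hit_inf_nonneg weight_nonneg)
next
  case (Suc n)
  let ?V = "\<lambda>n k l x. path_avg n (\<lambda>xs. of_bool (visits 0 x xs = k \<and> visits e x xs = l))"
  have V0: "?V n k l x \<le> mult_weight \<alpha> k l" if "x = 0 \<or> x = e" for k l x
    using Suc[of x k l] mult_weight_pascal[of k l \<alpha>] that by (auto simp: hit_eq_\<alpha> split: if_splits)
  have inner: "path_avg n (\<lambda>xs. of_bool (visits 0 x (v # xs) = k \<and> visits e x (v # xs) = l)) =
     (if x + v = 0 then (if k = 0 then 0 else ?V n (k - 1) l (x + v))
      else if x + v = e then (if l = 0 then 0 else ?V n k (l - 1) (x + v)) else ?V n k l (x + v))" for v
  proof -
    consider "x + v = 0" | "x + v = e" | "x + v \<noteq> 0" "x + v \<noteq> e" by auto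
    then show ?thesis
      by cases (use e_nonzero in \<open>auto intro!: path_avg_cong arg_cong[where f = of_bool]\<close>)
  qed
  show ?case
  proof (cases "k = 0 \<and> l = 0")
    case True
    have "?V (Suc n) k l x \<le> 1" by (rule path_avg_le_const) simp
    then show ?thesis using True by simp
  next
    case False
    have "?V (Suc n) k l x \<le> avg (\<lambda>v.
       (if x + v = 0 then 1 else if x + v \<in> {e} then 0 else hit_inf 0 {e} (x + v)) * weight_left \<alpha> k l +
       (if x + v = e then 1 else if x + v \<in> {0} then 0 else hit_inf e {0} (x + v)) * weight_right \<alpha> k l)"
      unfolding path_avg.simps inner
      by (rule avg_mono) (use False e_nonzero V0 Suc[of _ k l] in \<open>auto simp: weight_left_def weight_right_def\<close>)
    also have "\<dots> = hit_inf 0 {e} x * weight_left \<alpha> k l + hit_inf e {0} x * weight_right \<alpha> k l"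
      unfolding avg_add avg_multc hit_inf_eq[symmetric] ..
    finally show ?thesis using False by (simp only: if_False)
  qed
qed

lemma visits_upper:
  "path_avg n (\<lambda>xs. of_bool (visits 0 0 xs = k \<and> visits e 0 xs = l)) \<le> mult_weight \<alpha> k l"
  using visits_upper_aux[of n 0 k l] mult_weight_pascal[of k l \<alpha>] by (auto simp: hit_eq_\<alpha> split: if_splits)

lemma no_visit_lower:
  assumes "x = 0 \<or> x = e"
  shows "path_avg T (\<lambda>xs. of_bool (visits 0 x xs = 0 \<and> visits e x xs = 0)) \<ge> 1 - 2 * \<alpha>"
  unfolding no_visit_prob[OF e_nonzero]
  using hit_le_inf[of 0 "{e}" T x] hit_le_inf[of e "{0}" T x] assms by (auto simp: hit_eq_\<alpha>)

text \<open>Equal counts at time \<open>s\<close> and at the end express that no visit occurs after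
  \<open>s\<close>.\<close>

definition settled :: "nat \<Rightarrow> nat \<Rightarrow> nat \<Rightarrow> int ^ 'd \<Rightarrow> (int ^ 'd) list \<Rightarrow> bool" where
  "settled s k l x xs \<longleftrightarrow> visits 0 x (take s xs) = k \<and> visits e x (take s xs) = l \<and>
     visits 0 x xs = k \<and> visits e x xs = l"

lemma settled_Suc:
  "settled (Suc s) k l x (v # xs) =
     (if x + v = 0 then k > 0 \<and> settled s (k - 1) l (x + v) xs
      else if x + v = e then l > 0 \<and> settled s k (l - 1) (x + v) xs else settled s k l (x + v) xs)"
  using e_nonzero by (auto simp: settled_def)

lemma settled_00: "settled s 0 0 x xs \<longleftrightarrow> visits 0 x xs = 0 \<and> visits e x xs = 0"
proof -
  have "visits z x (take s xs) \<le> visits z x xs" for z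
  proof (induction xs arbitrary: x s)
    case (Cons v xs)
    then show ?case by (cases s) auto
  qed auto
  from this[of 0] this[of e] show ?thesis by (auto simp: settled_def)
qed

text \<open>The walk collects the prescribed visits by excursions of length at most \<open>m\<close> each.\<close>

lemma settled_lower_aux:
  fixes m :: nat and \<beta> :: real
  assumes \<beta>: "\<beta> \<ge> 0"
    and \<beta>_le: "\<And>y. y = 0 \<or> y = e \<Longrightarrow> \<beta> \<le> hit 0 {e} m y" "\<And>y. y = 0 \<or> y = e \<Longrightarrow> \<beta> \<le> hit e {0} m y"
  shows "x = 0 \<or> x = e \<Longrightarrow> s \<ge> (k + l) * m \<Longrightarrow> T \<ge> s \<Longrightarrow>
    path_avg T (\<lambda>xs. of_bool (settled s k l x xs)) \<ge> (1 - 2 * \<alpha>) * mult_weight \<beta> k l"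
proof (induction "k + l" arbitrary: k l x s T)
  case 0
  then show ?case using no_visit_lower[of x T] by (simp add: settled_00)
next
  case (Suc n)
  define \<rho> where "\<rho> = 1 - 2 * \<alpha>"
  have \<rho>: "\<rho> \<ge> 0" using \<alpha>_half by (simp add: \<rho>_def)
  let ?D = "\<lambda>T s k l x. path_avg T (\<lambda>xs. of_bool (settled s k l x xs))"
  have D0: "?D T s k l x \<ge> 0" for T s k l x by (rule path_avg_nonneg) simp
  have kl: "(k, l) \<noteq> (0, 0)" using Suc.hyps(2) by auto
  have IH: "?D T s k' l' y \<ge> \<rho> * mult_weight \<beta> k' l'"
    if "k' + l' = n" "y = 0 \<or> y = e" "s \<ge> n * m" "T \<ge> s" for k' l' y s T
    using Suc.hyps(1)[of k' l' y s T] that by (simp add: \<rho>_def)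
  \<comment> \<open>Inner induction on the length \<open>r\<close> still granted to the current
    excursion; \<open>n * m\<close> steps of the budget \<open>s\<close> stay reserved for the
    remaining \<open>n\<close> entries.\<close>
  have "?D T s k l x \<ge> \<rho> * (hit 0 {e} r x * weight_left \<beta> k l + hit e {0} r x * weight_right \<beta> k l)"
    if "s \<ge> n * m + r" "T \<ge> s" for r s T x using that
  proof (induction r arbitrary: x s T)
    case 0
    show ?case by (simp add: D0)
  next
    case (Suc r)
    obtain s' where s': "s = Suc s'" using Suc.prems by (cases s) auto
    obtain T' where T': "T = Suc T'" using Suc.prems s' by (cases T) auto
    have "\<rho> * (hit 0 {e} (Suc r) x * weight_left \<beta> k l + hit e {0} (Suc r) x * weight_right \<beta> k l) =
      avg (\<lambda>v. \<rho> * ((if x + v = 0 then 1 else if x + v \<in> {e} then 0 else hit 0 {e} r (x + v)) * weight_left \<beta> k l +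
       (if x + v = e then 1 else if x + v \<in> {0} then 0 else hit e {0} r (x + v)) * weight_right \<beta> k l))"
      unfolding avg_cmult avg_add avg_multc by simp
    also have "\<dots> \<le> avg (\<lambda>v. if x + v = 0 then (if k > 0 then ?D T' s' (k - 1) l (x + v) else 0)
       else if x + v = e then (if l > 0 then ?D T' s' k (l - 1) (x + v) else 0) else ?D T' s' k l (x + v))"
    proof (rule avg_mono)
      fix j
      let ?y = "x + unit_step j"
      have 1: "\<rho> * weight_left \<beta> k l \<le> (if k > 0 then ?D T' s' (k - 1) l ?y else 0)" if "?y = 0"
        using IH[of "k - 1" l ?y s' T'] that Suc.prems s' T' \<open>Suc n = k + l\<close> by (auto simp: weight_left_def)
      have 2: "\<rho> * weight_right \<beta> k l \<le> (if l > 0 then ?D T' s' k (l - 1) ?y else 0)" if "?y = e"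
        using IH[of k "l - 1" ?y s' T'] that Suc.prems s' T' \<open>Suc n = k + l\<close> by (auto simp: weight_right_def)
      have 3: "\<rho> * (hit 0 {e} r ?y * weight_left \<beta> k l + hit e {0} r ?y * weight_right \<beta> k l) \<le> ?D T' s' k l ?y"
        by (rule Suc.IH) (use Suc.prems s' T' in auto)
      show "\<rho> * ((if ?y = 0 then 1 else if ?y \<in> {e} then 0 else hit 0 {e} r ?y) * weight_left \<beta> k l +
          (if ?y = e then 1 else if ?y \<in> {0} then 0 else hit e {0} r ?y) * weight_right \<beta> k l)
        \<le> (if ?y = 0 then (if k > 0 then ?D T' s' (k - 1) l ?y else 0)
           else if ?y = e then (if l > 0 then ?D T' s' k (l - 1) ?y else 0) else ?D T' s' k l ?y)"
        using 1 2 3 e_nonzero by (cases "?y = 0"; cases "?y = e") simp_all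
    qed
    also have "\<dots> = ?D T s k l x"
      unfolding s' T' path_avg.simps settled_Suc
      by (rule avg_cong) (auto intro!: path_avg_cong)
    finally show ?case .
  qed
  moreover have "n * m + m \<le> s"
    using Suc.prems(2) unfolding Suc.hyps(2)[symmetric] by (simp add: add.commute)
  ultimately
  have "?D T s k l x \<ge> \<rho> * (hit 0 {e} m x * weight_left \<beta> k l + hit e {0} m x * weight_right \<beta> k l)"
    using Suc.prems(3) by blast
  moreover have "\<rho> * (\<beta> * weight_left \<beta> k l + \<beta> * weight_right \<beta> k l) \<le>
      \<rho> * (hit 0 {e} m x * weight_left \<beta> k l + hit e {0} m x * weight_right \<beta> k l)"
    by (intro mult_left_mono add_mono mult_right_mono \<beta>_le Suc.prems weight_nonneg \<beta> \<rho>)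
  ultimately show ?case
    unfolding mult_weight_pascal[OF kl] \<rho>_def by linarith
qed

text \<open>Limiting an excursion to \<open>m\<close> steps costs at most
  \<open>\<delta> = 2 C / sqrt m\<close> in each hitting probability, \<open>C\<close> being the
  heat kernel constant. The hypothesis on \<open>m\<close> says
  \<open>\<delta> (k + l) <= \<alpha> / 2\<close>, so by Bernoulli's inequality all excursions
  together lose at most a factor 2.\<close>

lemma settled_lower:
  assumes m: "real m \<ge> (4 * hk_const TYPE('d) * real (k + l) / \<alpha>)\<^sup>2" "m \<ge> 1"
    and s: "s \<ge> (k + l) * m" "T \<ge> s"
  shows "path_avg T (\<lambda>xs. of_bool (settled s k l 0 xs)) \<ge> (1 - 2 * \<alpha>) / 2 * mult_weight \<alpha> k l"
proof (cases "k + l = 0")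
  case True
  have "(1 - 2 * \<alpha>) / 2 * mult_weight \<alpha> k l \<le> 1 - 2 * \<alpha>" using True \<alpha>_half by simp
  then show ?thesis using no_visit_lower[of 0 T] True by (simp add: settled_00)
next
  case False
  define n where "n = k + l"
  have "n \<ge> 1" using False unfolding n_def by linarith
  then have n: "real n \<ge> 1" by simp
  define \<delta> where "\<delta> = 2 * hk_const TYPE('d) / sqrt (real m)"
  have \<delta>0: "\<delta> \<ge> 0" using hk_const_pos[where ?'d = 'd] by (simp add: \<delta>_def)
  have "4 * hk_const TYPE('d) * real n / \<alpha> \<le> sqrt (real m)"
    using m(1) by (intro real_le_rsqrt) (simp add: n_def)
  then have \<delta>: "\<delta> * real n / \<alpha> \<le> 1 / 2"
    using m(2) \<alpha>_pos by (simp add: \<delta>_def field_simps)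
  have "\<delta> / \<alpha> * 1 \<le> \<delta> / \<alpha> * real n" using n \<delta>0 \<alpha>_pos by (intro mult_left_mono) auto
  then have \<delta>1: "\<delta> / \<alpha> \<le> 1 / 2" using \<delta> unfolding times_divide_eq_left mult_1_right by (rule order_trans)
  define \<beta> where "\<beta> = \<alpha> - \<delta>"
  have \<beta>: "\<beta> \<ge> 0" using \<delta>1 \<alpha>_pos by (simp add: \<beta>_def field_simps)
  have lo: "hit_inf z A y - \<delta> \<le> hit z A m y" for z A and y :: "int ^ 'd"
    using hit_tail[OF dim m(2), of z A y] by (simp add: \<delta>_def)
  have "1 / 2 \<le> 1 + real n * (- (\<delta> / \<alpha>))" using \<delta> by (simp add: mult.commute)
  also have "\<dots> \<le> (1 + - (\<delta> / \<alpha>)) ^ n"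
    by (rule Bernoulli_inequality) (use \<delta>1 in linarith)
  also have "\<dots> = \<beta> ^ n / \<alpha> ^ n"
    using \<alpha>_pos by (simp add: \<beta>_def power_divide[symmetric] diff_divide_distrib)
  finally have pw: "\<alpha> ^ n / 2 \<le> \<beta> ^ n" using \<alpha>_pos by (simp add: field_simps)
  have "(1 - 2 * \<alpha>) / 2 * mult_weight \<alpha> k l = (1 - 2 * \<alpha>) * (real (k + l choose k) * (\<alpha> ^ n / 2))"
    by (simp add: mult_weight_def n_def)
  also have "\<dots> \<le> (1 - 2 * \<alpha>) * mult_weight \<beta> k l"
    unfolding mult_weight_def n_def[symmetric] using \<alpha>_half by (intro mult_left_mono pw) auto
  also have "\<dots> \<le> path_avg T (\<lambda>xs. of_bool (settled s k l 0 xs))"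
    by (rule settled_lower_aux[OF \<beta> _ _ _ s])
      (use lo[of 0 "{e}"] lo[of e "{0}"] in \<open>auto simp: \<beta>_def, (metis hit_eq_\<alpha>)+\<close>)
  finally show ?thesis .
qed

end

section \<open>The rate function\<close>

text \<open>For \<open>x + y > 0\<close> this is \<open>- (x + y) (H + ln a)\<close> with
  \<open>H\<close> the binary entropy of \<open>x / (x + y)\<close>.\<close>

definition rate :: "real \<Rightarrow> real \<Rightarrow> real \<Rightarrow> real" where
  "rate a x y = - (x + y) * ln (x + y) + x * ln x + y * ln y - (x + y) * ln a"

lemma rate_commute: "rate a x y = rate a y x"
  unfolding rate_def add.commute[of y x] by simp

text \<open>The terms with \<open>ln c\<close> cancel, since their coefficients are proportional to
  \<open>- (x + y)\<close>, \<open>x\<close> and \<open>y\<close>.\<close>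

lemma rate_scale:
  assumes "c > 0" "x \<ge> 0" "y \<ge> 0"
  shows "rate a (c * x) (c * y) = c * rate a x y"
proof -
  have xl: "(c * z) * ln (c * z) = c * (z * ln z) + z * (c * ln c)" if "z \<ge> 0" for z
    using assms(1) that by (cases "z = 0") (auto simp: ln_mult algebra_simps)
  show ?thesis
    using xl[OF assms(2)] xl[OF assms(3)] xl[of "x + y"] assms
    by (simp add: rate_def algebra_simps)
qed

lemma scaled_region_iff:
  assumes "c > 0"
  shows "(x, y) \<in> (\<lambda>p. c *\<^sub>R p) ` region a \<longleftrightarrow> x \<ge> 0 \<and> y \<ge> 0 \<and> rate a x y \<le> c"
proof -
  have "(x, y) \<in> (\<lambda>p. c *\<^sub>R p) ` region a \<longleftrightarrow> (x / c, y / c) \<in> region a"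
  proof
    assume "(x, y) \<in> (\<lambda>p. c *\<^sub>R p) ` region a"
    then show "(x / c, y / c) \<in> region a" using assms by auto
  next
    assume "(x / c, y / c) \<in> region a"
    then show "(x, y) \<in> (\<lambda>p. c *\<^sub>R p) ` region a"
      by (rule rev_image_eqI) (use assms in simp)
  qed
  also have "\<dots> \<longleftrightarrow> x / c \<ge> 0 \<and> y / c \<ge> 0 \<and> rate a (x / c) (y / c) \<le> 1"
    by (simp add: region_def rate_def)
  also have "\<dots> \<longleftrightarrow> x \<ge> 0 \<and> y \<ge> 0 \<and> rate a x y \<le> c"
    using rate_scale[OF assms, of "x / c" "y / c" a] assms by (auto simp: field_simps)
  finally show ?thesis .
qed

text \<open>The entropy is at most \<open>ln 2\<close>. For \<open>a < 1/2\<close> the right-hand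
  side grows linearly, which confines the relevant pairs to size \<open>O(log n)\<close> and makes
  the tails summable.\<close>

lemma rate_ge:
  assumes "a > 0" "x \<ge> 0" "y \<ge> 0"
  shows "rate a x y \<ge> (x + y) * ln (1 / (2 * a))"
proof (cases "x + y = 0")
  case False
  then have xy: "x + y > 0" using assms by simp
  have t: "z * ln (x + y) - z * ln z - z * ln 2 \<le> (x + y) / 2 - z" if "z \<ge> 0" for z
  proof (cases "z = 0")
    case False
    then have z: "z > 0" using that by simp
    have "ln ((x + y) / (2 * z)) \<le> (x + y) / (2 * z) - 1"
      using z xy by (intro ln_le_minus_one) simp
    then have "z * ln ((x + y) / (2 * z)) \<le> z * ((x + y) / (2 * z) - 1)"
      using z by (intro mult_left_mono) auto
    also have "\<dots> = (x + y) / 2 - z" using z by (simp add: field_simps)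
    finally show ?thesis using z xy by (simp add: ln_div ln_mult algebra_simps)
  qed (use xy in simp)
  have L: "ln (1 / (2 * a)) = - ln 2 - ln a" using assms by (simp add: ln_div ln_mult)
  show ?thesis unfolding rate_def L using t[OF assms(2)] t[OF assms(3)] by (simp add: algebra_simps)
next
  case True
  then have "x = 0" "y = 0" using assms by linarith+
  then show ?thesis by (simp add: rate_def)
qed

section \<open>Stirling bounds and the size of the weights\<close>

lemma ln_fact_ge: "ln (fact n) \<ge> real n * ln (real n) - real n"
proof (induction n)
  case (Suc n)
  \<comment> \<open>Equivalent to \<open>(1 + 1/n)^n <= e\<close>.\<close>
  have "real n * (ln (real n + 1) - ln (real n)) \<le> 1"
  proof (cases "n = 0")
    case False
    have le: "ln (1 + 1 / real n) \<le> 1 / real n" by (rule ln_add_one_self_le_self) simp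
    have "1 + 1 / real n = (real n + 1) / real n" using False by (simp add: field_simps)
    then have "ln (1 + 1 / real n) = ln (real n + 1) - ln (real n)"
      using False by (simp only:) (subst ln_div, auto)
    then have "real n * (ln (real n + 1) - ln (real n)) \<le> real n * (1 / real n)"
      using le by (intro mult_left_mono) auto
    then show ?thesis using False by simp
  qed auto
  then have "real (Suc n) * ln (real (Suc n)) - real (Suc n) \<le> ln (real n + 1) + (real n * ln (real n) - real n)"
    by (simp add: algebra_simps)
  also have "\<dots> \<le> ln (fact (Suc n))" using Suc by (simp add: ln_mult add.commute)
  finally show ?case .
qed auto

text \<open>Comes from \<open>(1 + 1/n)^(n + 1) >= e\<close>. The induction runs over positive
  \<open>n\<close> with the sharper last term \<open>ln n\<close>.\<close>

lemma ln_fact_le: "ln (fact n) \<le> real n * ln (real n) - real n + 1 + ln (real n + 1)"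
proof (cases n)
  case (Suc m)
  have "ln (fact (Suc m)) \<le> real (Suc m) * ln (real (Suc m)) - real (Suc m) + 1 + ln (real (Suc m))"
  proof (induction m)
    case (Suc m)
    define p where "p = real m + 1"
    have p: "p > 0" by (simp add: p_def)
    have "ln (p / (p + 1)) \<le> p / (p + 1) - 1" using p by (intro ln_le_minus_one) auto
    also have "\<dots> = - (1 / (p + 1))" using p by (simp add: field_simps)
    finally have "1 / (p + 1) \<le> ln (p + 1) - ln p" using p by (simp add: ln_div)
    then have "1 \<le> (p + 1) * (ln (p + 1) - ln p)" using p by (simp add: field_simps)
    moreover have f: "ln (fact (Suc (Suc m))) = ln (p + 1) + ln (fact (Suc m))"
      by (simp only: fact_Suc[of "Suc m"], subst ln_mult) (auto simp: p_def add.commute)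
    moreover have r: "real (Suc m) = p" "real (Suc (Suc m)) = p + 1" by (auto simp: p_def)
    ultimately show ?case using Suc unfolding f r by (simp add: algebra_simps del: fact_Suc of_nat_Suc)
  qed auto
  moreover have "ln (real (Suc m)) \<le> ln (real (Suc m) + 1)" by simp
  ultimately show ?thesis unfolding Suc by linarith
qed auto

lemma ln_power_self: "ln ((real k + real l) ^ (k + l)) = (real k + real l) * ln (real k + real l)"
  by (cases "k + l = 0") (auto simp: ln_realpow simp flip: of_nat_add)

text \<open>A single term of the binomial expansion of \<open>(k + l)^(k + l)\<close> is at most the
  whole, so this direction loses no polynomial factor.\<close>

lemma mult_weight_le_exp:
  assumes "a > 0"
  shows "mult_weight a k l \<le> exp (- rate a (real k) (real l))"
proof -
  have "(k + l choose k) * k ^ k * l ^ l \<le> (\<Sum>i\<le>k + l. (k + l choose i) * k ^ i * l ^ (k + l - i))"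
    by (rule order_trans[OF _ member_le_sum[of k]]) auto
  also have "\<dots> = (k + l) ^ (k + l)" by (simp add: binomial)
  finally have "real ((k + l choose k) * k ^ k * l ^ l) \<le> real ((k + l) ^ (k + l))"
    by (rule of_nat_mono)
  then have le: "real (k + l choose k) * (real k ^ k * real l ^ l) \<le> (real k + real l) ^ (k + l)"
    by simp
  have pos: "real (k + l choose k) > 0" "real k ^ k > 0" "real l ^ l > 0" "(real k + real l) ^ (k + l) > 0"
    by (cases "k + l = 0"; auto simp: add_pos_nonneg)+
  have "ln (real (k + l choose k)) + (ln (real k ^ k) + ln (real l ^ l)) = ln (real (k + l choose k) * (real k ^ k * real l ^ l))"
    using pos by (subst ln_mult, simp, simp, subst ln_mult) auto
  also have "\<dots> \<le> ln ((real k + real l) ^ (k + l))"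
    using le pos by (subst ln_le_cancel_iff) auto
  finally have "ln (real (k + l choose k)) + (real k * ln k + real l * ln l) \<le> (real k + real l) * ln (real k + real l)"
    using ln_power_self[of k 0] ln_power_self[of l 0] by (simp add: ln_power_self)
  then have "ln (mult_weight a k l) \<le> - rate a (real k) (real l)"
    using pos assms by (simp add: mult_weight_def rate_def ln_mult ln_realpow algebra_simps)
  moreover have "mult_weight a k l > 0" using assms by (simp add: mult_weight_def)
  ultimately show ?thesis by (metis exp_le_cancel_iff exp_ln)
qed

text \<open>Stirling costs a factor polynomial in \<open>k\<close> and \<open>l\<close>, harmless
  against the exponential margin available in the lower part.\<close>

lemma mult_weight_ge_exp:
  assumes "a > 0"
  shows "mult_weight a k l \<ge> exp (- rate a (real k) (real l)) / (exp 2 * (real k + 1) * (real l + 1))"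
proof -
  have "real (k + l choose k) = fact (k + l) / (fact k * fact l)"
    using binomial_fact[of k "k + l", where ?'a = real] by simp
  then have "ln (real (k + l choose k)) = ln (fact (k + l)) - ln (fact k) - ln (fact l)"
    by (simp add: ln_div ln_mult)
  then have "- rate a (real k) (real l) - 2 - ln (real k + 1) - ln (real l + 1) \<le> ln (mult_weight a k l)"
    using ln_fact_ge[of "k + l"] ln_fact_le[of k] ln_fact_le[of l] assms
    by (simp add: mult_weight_def rate_def ln_mult ln_realpow algebra_simps)
  then have "exp (- rate a (real k) (real l) - 2 - ln (real k + 1) - ln (real l + 1)) \<le> exp (ln (mult_weight a k l))"
    by simp
  moreover have "mult_weight a k l > 0" using assms by (simp add: mult_weight_def)
  ultimately show ?thesis by (simp add: exp_diff)
qed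

text \<open>A restart at a first visit sees \<open>k\<close> later visits while the local time is
  \<open>k + 1\<close>; this moves the weight to the pair at which the rate is taken.\<close>

lemma mult_weight_le_Suc:
  assumes "a > 0"
  shows "mult_weight a k l \<le> mult_weight a (Suc k) l / a"
proof -
  have "real (k + l choose k) \<le> real (Suc k + l choose Suc k)" by simp
  then show ?thesis using assms by (simp add: mult_weight_def mult_right_mono)
qed

text \<open>The rate is split: the share \<open>1 - \<delta>\<close> is bounded below by
  \<open>t\<close>, the share \<open>\<delta>\<close> by its linear lower bound, which leaves
  geometric factors for the summation over all pairs.\<close>

lemma mult_weight_tail:
  assumes a: "a > 0" "a < 1 / 2" and \<delta>: "0 < \<delta>" "\<delta> < 1" and t: "rate a (real (Suc k)) (real l) > t"
  defines "q \<equiv> exp (- \<delta> * ln (1 / (2 * a)))"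
  shows "mult_weight a k l \<le> exp (- (1 - \<delta>) * t) / a * (q ^ k * q ^ l)"
proof -
  define \<kappa> where "\<kappa> = ln (1 / (2 * a))"
  have \<kappa>: "\<kappa> > 0" using a by (simp add: \<kappa>_def)
  let ?r = "rate a (real (Suc k)) (real l)"
  have "(real k + real l) * \<kappa> \<le> (real (Suc k) + real l) * \<kappa>" using \<kappa> by simp
  also have "\<dots> \<le> ?r" unfolding \<kappa>_def by (rule rate_ge) (use a in auto)
  finally have r: "(real k + real l) * \<kappa> \<le> ?r" .
  have "mult_weight a k l \<le> exp (- ?r) / a"
    using mult_weight_le_Suc[of a k l] mult_weight_le_exp[of a "Suc k" l] a
    by (meson divide_right_mono less_imp_le order_trans)
  also have "\<dots> \<le> exp (- (1 - \<delta>) * t - \<delta> * ((real k + real l) * \<kappa>)) / a"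
  proof -
    have "(1 - \<delta>) * t \<le> (1 - \<delta>) * ?r" "\<delta> * ((real k + real l) * \<kappa>) \<le> \<delta> * ?r"
      using \<delta> t r by (auto intro!: mult_left_mono)
    then have "- ?r \<le> - (1 - \<delta>) * t - \<delta> * ((real k + real l) * \<kappa>)" by (simp add: algebra_simps)
    then show ?thesis using a by (intro divide_right_mono) auto
  qed
  also have "\<dots> = exp (- (1 - \<delta>) * t) / a * (q ^ k * q ^ l)"
  proof -
    have q: "q ^ n = exp (real n * (- \<delta> * \<kappa>))" for n by (simp only: q_def \<kappa>_def exp_of_nat_mult)
    have "- (1 - \<delta>) * t - \<delta> * ((real k + real l) * \<kappa>) =
        - (1 - \<delta>) * t + (real k * (- \<delta> * \<kappa>) + real l * (- \<delta> * \<kappa>))" by algebra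
    then show ?thesis unfolding q by (simp only: exp_add times_divide_eq_left)
  qed
  finally show ?thesis .
qed

section \<open>The random walk\<close>

lemma inj_unit_step: "inj (unit_step :: 'd::finite + 'd \<Rightarrow> int ^ 'd)"
proof (rule injI)
  fix i j :: "'d + 'd" assume eq: "unit_step i = (unit_step j :: int ^ 'd)"
  have nn: "(axis a 1 :: int ^ 'd) \<noteq> - axis b 1" for a b
  proof
    assume "(axis a 1 :: int ^ 'd) = - axis b 1"
    then have "(axis a 1 :: int ^ 'd) $ a = (- axis b 1) $ a" by simp
    then show False by (simp add: axis_def split: if_splits)
  qed
  from eq nn nn[symmetric] show "i = j"
    by (auto simp: unit_step_def axis_eq_axis split: sum.splits)
qed

context simple_random_walk
begin

section \<open>The law of finite segments of steps\<close>

lemma X_measurable: "k \<ge> 1 \<Longrightarrow> X k \<in> M \<rightarrow>\<^sub>M count_space UNIV"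
  using steps_indep by (simp add: indep_vars_def)

definition seg :: "nat \<Rightarrow> nat \<Rightarrow> 'a \<Rightarrow> (int ^ 'd) list" where
  "seg j n \<omega> = map (\<lambda>r. X r \<omega>) [Suc j..<Suc (j + n)]"

lemma seg_0 [simp]: "seg j 0 \<omega> = []"
  by (simp add: seg_def)

lemma seg_Suc: "seg j (Suc n) \<omega> = seg j n \<omega> @ [X (Suc (j + n)) \<omega>]"
  by (simp add: seg_def)

lemma seg_Suc': "seg j (Suc n) \<omega> = X (Suc j) \<omega> # seg (Suc j) n \<omega>"
  by (simp add: seg_def upt_conv_Cons del: upt_Suc)

lemma length_seg [simp]: "length (seg j n \<omega>) = n"
  by (simp add: seg_def)

lemma seg_append: "seg j (m + n) \<omega> = seg j m \<omega> @ seg (j + m) n \<omega>"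
  by (induction n) (auto simp: seg_Suc add.assoc)

lemma seg_measurable: "seg j n \<in> M \<rightarrow>\<^sub>M count_space UNIV"
proof (induction n)
  case (Suc n)
  have "(\<lambda>\<omega>. (\<lambda>xs \<omega>. xs @ [X (Suc (j + n)) \<omega>]) (seg j n \<omega>) \<omega>) \<in> M \<rightarrow>\<^sub>M count_space UNIV"
    by (rule measurable_compose_countable[OF _ Suc], rule measurable_compose[OF X_measurable]) auto
  then show ?case by (simp add: seg_Suc[abs_def])
qed simp

lemma seg_event [measurable]: "{\<omega> \<in> space M. Q (seg j n \<omega>)} \<in> events"
  using measurable_sets[OF seg_measurable, of "{xs. Q xs}" j n] by (simp add: vimage_def Int_def conj_commute)

lemma seg_event2: "{\<omega> \<in> space M. Q (seg j n \<omega>) \<and> R (seg k m \<omega>)} \<in> events"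
  using sets.Int[OF seg_event[of Q j n] seg_event[of R k m]] by (simp add: Int_def conj_ac cong: conj_cong) 

text \<open>The \<open>2d\<close> directions already have total probability 1, so almost surely a
  step is one of them although its type admits any lattice vector.\<close>

lemma step_split:
  assumes "k \<ge> 1" and E: "{\<omega> \<in> space M. P \<omega>} \<in> events"
  shows "prob {\<omega> \<in> space M. P \<omega>} = (\<Sum>i\<in>UNIV. prob {\<omega> \<in> space M. X k \<omega> = unit_step i \<and> P \<omega>})"
proof -
  have Xm: "{\<omega> \<in> space M. X k \<omega> = v} \<in> events" for v
    using measurable_sets[OF X_measurable[OF assms(1)], of "{v}"] by (simp add: vimage_def Int_def conj_commute)
  have disj: "disjoint_family (\<lambda>i. {\<omega> \<in> space M. X k \<omega> = unit_step i})"
    by (auto simp: disjoint_family_on_def dest: injD[OF inj_unit_step])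
  have "prob (\<Union>i\<in>UNIV. {\<omega> \<in> space M. X k \<omega> = unit_step i}) = (\<Sum>i\<in>(UNIV::('d + 'd) set). prob {\<omega> \<in> space M. X k \<omega> = unit_step i})"
    by (rule finite_measure_finite_Union) (use Xm disj in auto)
  also have "\<dots> = 1" by (simp add: steps_uniform[OF assms(1)])
  finally have "AE \<omega> in M. \<omega> \<in> (\<Union>i\<in>UNIV. {\<omega> \<in> space M. X k \<omega> = unit_step i})"
    using Xm by (subst (asm) prob_eq_1) auto
  then have "prob {\<omega> \<in> space M. P \<omega>} = prob (\<Union>i\<in>UNIV. {\<omega> \<in> space M. X k \<omega> = unit_step i \<and> P \<omega>})"
    using E Xm by (intro finite_measure_eq_AE) auto
  also have "\<dots> = (\<Sum>i\<in>UNIV. prob {\<omega> \<in> space M. X k \<omega> = unit_step i \<and> P \<omega>})"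
  proof (rule finite_measure_finite_Union)
    show "(\<lambda>i. {\<omega> \<in> space M. X k \<omega> = unit_step i \<and> P \<omega>}) ` UNIV \<subseteq> events"
      using sets.Int[OF Xm E] by (auto simp: Int_def conj_ac cong: conj_cong)
    show "disjoint_family (\<lambda>i. {\<omega> \<in> space M. X k \<omega> = unit_step i \<and> P \<omega>})"
      using disj by (auto simp: disjoint_family_on_def)
  qed simp
  finally show ?thesis .
qed

lemma prob_seg_eq:
  assumes "length us = n"
  shows "prob {\<omega> \<in> space M. seg j n \<omega> = us} = (\<Prod>r<n. prob {\<omega> \<in> space M. X (Suc (j + r)) \<omega> = us ! r})"
proof (cases "n = 0")
  case False
  have *: "prob (\<Inter>k\<in>{Suc j..j + n}. X k -` {us ! (k - Suc j)} \<inter> space M) = (\<Prod>k\<in>{Suc j..j + n}. prob (X k -` {us ! (k - Suc j)} \<inter> space M))"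
    by (rule indep_varsD[OF steps_indep]) (use False in auto)
  have "seg j n \<omega> = us \<longleftrightarrow> (\<forall>k\<in>{Suc j..j + n}. X k \<omega> = us ! (k - Suc j))" for \<omega>
  proof -
    have "seg j n \<omega> = us \<longleftrightarrow> (\<forall>r<n. X (Suc (j + r)) \<omega> = us ! r)"
      using assms by (auto simp: list_eq_iff_nth_eq seg_def simp del: upt_Suc)
    also have "\<dots> \<longleftrightarrow> (\<forall>k\<in>{Suc j..j + n}. X k \<omega> = us ! (k - Suc j))"
    proof safe
      fix k assume "\<forall>r<n. X (Suc (j + r)) \<omega> = us ! r" "k \<in> {Suc j..j + n}"
      then show "X k \<omega> = us ! (k - Suc j)" by (auto dest!: spec[of _ "k - Suc j"])
    next
      fix r assume "\<forall>k\<in>{Suc j..j + n}. X k \<omega> = us ! (k - Suc j)" "r < n"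
      then show "X (Suc (j + r)) \<omega> = us ! r" by (auto dest!: bspec[of _ _ "Suc (j + r)"])
    qed
    finally show ?thesis .
  qed
  then have "{\<omega> \<in> space M. seg j n \<omega> = us} = (\<Inter>k\<in>{Suc j..j + n}. X k -` {us ! (k - Suc j)} \<inter> space M)"
    using False by auto
  also have "prob \<dots> = (\<Prod>r<n. prob (X (Suc (j + r)) -` {us ! r} \<inter> space M))"
    unfolding * by (rule prod.reindex_bij_witness[of _ "\<lambda>r. Suc (j + r)" "\<lambda>k. k - Suc j"]) auto
  finally show ?thesis by (simp add: vimage_def Int_def conj_commute)
qed (use assms in \<open>simp add: prob_space\<close>)

text \<open>Induction on the later segment, whose first step is moved to the end of the fixed word
  \<open>us\<close>; independence then enters only through the probabilities of single
  words.\<close>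

lemma prob_seg_aux:
  "prob {\<omega> \<in> space M. seg j m \<omega> = us \<and> Q (seg (j + m) n \<omega>)} =
    prob {\<omega> \<in> space M. seg j m \<omega> = us} * path_avg n (\<lambda>xs. of_bool (Q xs))"
proof (induction n arbitrary: m us Q)
  case 0
  then show ?case by (cases "Q []") auto
next
  case (Suc n)
  have "prob {\<omega> \<in> space M. seg j m \<omega> = us \<and> Q (seg (j + m) (Suc n) \<omega>)} =
     (\<Sum>i\<in>UNIV. prob {\<omega> \<in> space M. X (Suc (j + m)) \<omega> = unit_step i \<and> seg j m \<omega> = us \<and> Q (seg (j + m) (Suc n) \<omega>)})"
    by (rule step_split) (auto intro: seg_event2)
  also have "\<dots> = (\<Sum>i\<in>UNIV. prob {\<omega> \<in> space M. seg j (Suc m) \<omega> = us @ [unit_step i] \<and> Q (unit_step i # seg (j + Suc m) n \<omega>)})"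
  proof (intro sum.cong refl arg_cong[of _ _ prob] Collect_cong)
    fix i \<omega>
    have "X (Suc (j + m)) \<omega> = unit_step i \<and> seg j m \<omega> = us \<and> Q (seg (j + m) (Suc n) \<omega>) \<longleftrightarrow>
        seg j (Suc m) \<omega> = us @ [unit_step i] \<and> Q (unit_step i # seg (j + Suc m) n \<omega>)"
      by (subst seg_Suc', subst seg_Suc) auto
    then show "\<omega> \<in> space M \<and> X (Suc (j + m)) \<omega> = unit_step i \<and> seg j m \<omega> = us \<and> Q (seg (j + m) (Suc n) \<omega>) \<longleftrightarrow>
        \<omega> \<in> space M \<and> seg j (Suc m) \<omega> = us @ [unit_step i] \<and> Q (unit_step i # seg (j + Suc m) n \<omega>)"
      by simp
  qed
  also have "\<dots> = (\<Sum>i\<in>UNIV. prob {\<omega> \<in> space M. seg j (Suc m) \<omega> = us @ [unit_step i]} * path_avg n (\<lambda>xs. of_bool (Q (unit_step i # xs))))"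
    using Suc[of "Suc m" "us @ [unit_step _]" "\<lambda>xs. Q (unit_step _ # xs)"] by simp
  also have "\<dots> = (\<Sum>i\<in>(UNIV::('d+'d) set). prob {\<omega> \<in> space M. seg j m \<omega> = us} / (2 * real CARD('d)) * path_avg n (\<lambda>xs. of_bool (Q (unit_step i # xs))))"
  proof (intro sum.cong refl arg_cong2[of _ _ _ _ "(*)"])
    fix i :: "'d + 'd"
    show "prob {\<omega> \<in> space M. seg j (Suc m) \<omega> = us @ [unit_step i]} = prob {\<omega> \<in> space M. seg j m \<omega> = us} / (2 * real CARD('d))"
    proof (cases "length us = m")
      case True
      then show ?thesis
        by (subst prob_seg_eq, simp, subst prob_seg_eq, simp)
          (auto simp: nth_append steps_uniform intro!: prod.cong)
    next
      case False
      then have "seg j (Suc m) \<omega> \<noteq> us @ [unit_step i]" "seg j m \<omega> \<noteq> us" for \<omega>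
        by (metis length_seg length_append_singleton nat.inject)+
      then show ?thesis by simp
    qed
  qed
  also have "\<dots> = prob {\<omega> \<in> space M. seg j m \<omega> = us} * path_avg (Suc n) (\<lambda>xs. of_bool (Q xs))"
    by (simp add: avg_def sum_distrib_left sum_divide_distrib)
  finally show ?case .
qed

lemma prob_seg: "prob {\<omega> \<in> space M. Q (seg j n \<omega>)} = path_avg n (\<lambda>xs. of_bool (Q xs))"
  using prob_seg_aux[of j 0 "[]" Q n] by (simp add: prob_space)

section \<open>The walk, its transience and the value of \<open>alpha\<close>\<close>

lemma walk_Suc: "walk X (Suc n) \<omega> = walk X n \<omega> + X (Suc n) \<omega>"
  by (simp add: walk_def)

lemma walk_0 [simp]: "walk X 0 \<omega> = 0"
  by (simp add: walk_def)

lemma sum_list_seg: "sum_list (seg j n \<omega>) = walk X (j + n) \<omega> - walk X j \<omega>"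
  by (induction n) (auto simp: seg_Suc walk_Suc)

lemma visits_seg:
  "visits z x (seg j n \<omega>) = card {r \<in> {j<..j + n}. x + walk X r \<omega> - walk X j \<omega> = z}"
proof -
  have snoc: "visits z x (xs @ [v]) = visits z x xs + of_bool (x + sum_list xs + v = z)" for v :: "int ^ 'd" and xs
    by (induction xs arbitrary: x) (auto simp: add.assoc)
  show ?thesis
  proof (induction n)
    case (Suc n)
    have "{r \<in> {j<..j + Suc n}. x + walk X r \<omega> - walk X j \<omega> = z} =
      (if x + walk X (Suc (j + n)) \<omega> - walk X j \<omega> = z then insert (Suc (j + n)) else id)
        {r \<in> {j<..j + n}. x + walk X r \<omega> - walk X j \<omega> = z}"
      by (auto simp: le_Suc_eq)
    then show ?case by (auto simp: seg_Suc snoc Suc sum_list_seg walk_Suc algebra_simps)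
  qed simp
qed

lemma prob_walk_eq_le:
  assumes "CARD('d) \<ge> 3" "n \<ge> 1"
  shows "prob {\<omega> \<in> space M. walk X (j + n) \<omega> = walk X j \<omega> + z} \<le> hk_const TYPE('d) * real n powr (-3/2)"
proof -
  have "prob {\<omega> \<in> space M. walk X (j + n) \<omega> = walk X j \<omega> + z} = path_avg n (\<lambda>xs. of_bool (sum_list xs = z))"
    by (subst prob_seg[of "\<lambda>xs. sum_list xs = z" j n, symmetric]) (simp add: sum_list_seg algebra_simps)
  then show ?thesis using heat_kernel_le[OF assms, of 0 z] by simp
qed

lemma walk_event: "{\<omega> \<in> space M. walk X n \<omega> = z} \<in> events"
  using seg_event[of "\<lambda>xs. sum_list xs = z" 0 n] by (simp add: sum_list_seg)

text \<open>The exponent 3/2 exceeds 1, so the probabilities of standing at \<open>z\<close> are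
  summable and Borel--Cantelli applies; the lattice is countable.\<close>

lemma AE_finite_visits:
  assumes "CARD('d) \<ge> 3"
  shows "AE \<omega> in M. \<forall>z. finite {k. walk X k \<omega> = z}"
proof -
  have "AE \<omega> in M. finite {k. walk X k \<omega> = z}" for z
  proof -
    have "summable (\<lambda>n. prob {\<omega> \<in> space M. walk X n \<omega> = z})"
    proof (rule summable_comparison_test)
      have "summable (\<lambda>m. real m powr (-3/2))" by (subst summable_real_powr_iff) simp
      then show "summable (\<lambda>m. hk_const TYPE('d) * real m powr (-3/2))" by (rule summable_mult)
      show "\<exists>N. \<forall>n\<ge>N. norm (prob {\<omega> \<in> space M. walk X n \<omega> = z}) \<le> hk_const TYPE('d) * real n powr (-3/2)"
        using prob_walk_eq_le[OF assms, of _ 0 z] by (intro exI[of _ 1]) simp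
    qed
    then have "AE \<omega> in M. eventually (\<lambda>n. \<omega> \<in> space M - {\<omega> \<in> space M. walk X n \<omega> = z}) sequentially"
      by (intro borel_cantelli_AE1 walk_event) (auto simp: emeasure_eq_measure)
    then show ?thesis
    proof (rule AE_mp, intro AE_I2 impI)
      fix \<omega> assume "\<omega> \<in> space M" "eventually (\<lambda>n. \<omega> \<in> space M - {\<omega> \<in> space M. walk X n \<omega> = z}) sequentially"
      then obtain N where "\<And>n. n \<ge> N \<Longrightarrow> walk X n \<omega> \<noteq> z" by (auto simp: eventually_sequentially)
      then have "{k. walk X k \<omega> = z} \<subseteq> {..<N}" by (auto simp: not_le[symmetric] simp del: not_le) (metis not_le)
      then show "finite {k. walk X k \<omega> = z}" by (rule finite_subset) simp
    qed
  qed
  then show ?thesis by (simp add: AE_all_countable)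
qed

text \<open>Never returning is the decreasing limit of not returning within \<open>n\<close> steps.
  With \<open>h\<close> the return probability this gives \<open>\<gamma> = 1 - h\<close> and
  \<open>(1 - \<gamma>) / (2 - \<gamma>) = h / (1 + h)\<close>.\<close>

lemma alpha_eq: "alpha M X = \<alpha>\<^sub>d TYPE('d)"
proof -
  define A where "A n = {\<omega> \<in> space M. visits 0 0 (seg 0 n \<omega>) = 0}" for n
  have nv: "path_avg n (\<lambda>xs. of_bool (visits 0 x xs = 0)) = 1 - hit 0 {} n x" for n and x :: "int ^ 'd"
  proof (induction n arbitrary: x)
    case (Suc n)
    have "path_avg (Suc n) (\<lambda>xs. of_bool (visits 0 x xs = 0)) = avg (\<lambda>v. 1 - (if x + v = 0 then 1 else if x + v \<in> {} then 0 else hit 0 {} n (x + v)))"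
      unfolding path_avg.simps by (rule avg_cong) (auto simp: Suc[symmetric])
    then show ?case by (simp add: avg_diff)
  qed simp
  have A: "A n = {\<omega> \<in> space M. \<forall>k\<in>{0<..n}. walk X k \<omega> \<noteq> 0}" for n
    unfolding A_def visits_seg by auto
  have "decseq A" unfolding A by (auto simp: decseq_def)
  moreover have "range A \<subseteq> events" unfolding A_def by (auto intro: seg_event)
  ultimately have "(\<lambda>n. prob (A n)) \<longlonglongrightarrow> prob (\<Inter>n. A n)"
    by (intro finite_Lim_measure_decseq)
  moreover have "(\<Inter>n. A n) = {\<omega> \<in> space M. \<forall>k>0. walk X k \<omega> \<noteq> 0}"
    unfolding A by (auto dest: spec[of _ "_ :: nat"] bspec) (metis greaterThanAtMost_iff order_refl)
  moreover have "(\<lambda>n. prob (A n)) = (\<lambda>n. 1 - hit 0 {} n (0 :: int ^ 'd))"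
    unfolding A_def by (simp add: prob_seg[of "\<lambda>xs. visits 0 0 xs = 0"] nv)
  ultimately have "(\<lambda>n. 1 - hit 0 {} n (0 :: int ^ 'd)) \<longlonglongrightarrow> escape_prob M X"
    by (simp add: escape_prob_def)
  moreover have "(\<lambda>n. 1 - hit 0 {} n (0 :: int ^ 'd)) \<longlonglongrightarrow> 1 - return_prob TYPE('d)"
    unfolding return_prob_def by (intro tendsto_diff tendsto_const hit_tendsto)
  ultimately have "escape_prob M X = 1 - return_prob TYPE('d)" by (rule LIMSEQ_unique)
  then show ?thesis by (simp add: alpha_def \<alpha>\<^sub>d_def)
qed

subsection \<open>Upper bound for the local times\<close>

definition total_visits :: "int ^ 'd \<Rightarrow> 'a \<Rightarrow> nat" where
  "total_visits z \<omega> = card {k. k > 0 \<and> walk X k \<omega> = z}"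

lemma local_time_eq: "finite {k. walk X k \<omega> = z} \<Longrightarrow> local_time X z \<omega> = enat (total_visits z \<omega>)"
  by (auto simp: local_time_def total_visits_def Let_def elim: finite_subset[rotated])

text \<open>Phrased as stabilisation of finite counts, which makes it a countable combination of
  events on finite segments.\<close>

definition future :: "nat \<Rightarrow> int ^ 'd \<Rightarrow> nat \<Rightarrow> nat \<Rightarrow> 'a \<Rightarrow> bool" where
  "future j e k l \<omega> \<longleftrightarrow> (\<exists>n0. \<forall>n\<ge>n0. visits 0 0 (seg j n \<omega>) = k \<and> visits e 0 (seg j n \<omega>) = l)"

lemma future_card:
  assumes "\<And>z. finite {k. walk X k \<omega> = z}"
  shows "future j e (card {r. j < r \<and> walk X r \<omega> = walk X j \<omega>}) (card {r. j < r \<and> walk X r \<omega> = walk X j \<omega> + e}) \<omega>"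
proof -
  obtain N where N: "\<And>r. walk X r \<omega> = walk X j \<omega> \<or> walk X r \<omega> = walk X j \<omega> + e \<Longrightarrow> r \<le> N"
    using finite_nat_set_iff_bounded_le[THEN iffD1, OF finite_UnI[OF assms[of "walk X j \<omega>"] assms[of "walk X j \<omega> + e"]]]
    by auto
  have *: "{r \<in> {j<..j + n}. 0 + walk X r \<omega> - walk X j \<omega> = z} = {r. j < r \<and> walk X r \<omega> = walk X j \<omega> + z}"
    if "n \<ge> N" "z = 0 \<or> z = e" for n z
  proof -
    have "r \<le> j + n" if "walk X r \<omega> = walk X j \<omega> + z" for r
      using N[of r] that \<open>n \<ge> N\<close> \<open>z = 0 \<or> z = e\<close> by auto
    then show ?thesis by (auto simp: algebra_simps)
  qed
  show ?thesis
    unfolding future_def visits_seg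
  proof (intro exI[of _ N] allI impI)
    fix n assume n: "n \<ge> N"
    show "card {r \<in> {j<..j + n}. 0 + walk X r \<omega> - walk X j \<omega> = 0} = card {r. j < r \<and> walk X r \<omega> = walk X j \<omega>} \<and>
      card {r \<in> {j<..j + n}. 0 + walk X r \<omega> - walk X j \<omega> = e} = card {r. j < r \<and> walk X r \<omega> = walk X j \<omega> + e}"
      using *[OF n disjI1[OF refl]] *[OF n disjI2[OF refl]] by (simp only: add_0_right simp_thms)
  qed
qed

lemma future_event: "{\<omega> \<in> space M. future j e k l \<omega>} \<in> events"
proof -
  have "{\<omega> \<in> space M. \<exists>n0. \<forall>n\<in>{n0..}. visits 0 0 (seg j n \<omega>) = k \<and> visits e 0 (seg j n \<omega>) = l} \<in> events"
    by (intro sets.sets_Collect_countable_Ex sets.sets_Collect_countable_All' sets.sets_Collect_countable_Ball)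
      (auto intro: seg_event[of "\<lambda>xs. visits 0 0 xs = k \<and> visits e 0 xs = l"])
  then show ?thesis by (simp add: future_def)
qed

text \<open>Counts that have stabilised by \<open>m\<close> already show at horizon
  \<open>m\<close>, where the bound does not depend on \<open>m\<close>; these events increase to
  the claim.\<close>

lemma prob_future_le:
  assumes "CARD('d) \<ge> 3"
  shows "prob {\<omega> \<in> space M. future j (unit_step i) k l \<omega>} \<le> mult_weight (alpha M X) k l"
proof -
  interpret np: neighbour_pair "unit_step i" i by unfold_locales (simp_all add: assms)
  let ?P = "\<lambda>xs. visits 0 0 xs = k \<and> visits (unit_step i) 0 xs = l"
  define E where "E m = {\<omega> \<in> space M. \<forall>n\<in>{m..}. ?P (seg j n \<omega>)}" for m
  have E: "E m \<in> events" for m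
    unfolding E_def by (intro sets.sets_Collect_countable_Ball) (auto intro: seg_event[of ?P])
  have "incseq E" by (auto simp: E_def incseq_def)
  then have "(\<lambda>m. prob (E m)) \<longlonglongrightarrow> prob (\<Union>m. E m)"
    using E by (intro finite_Lim_measure_incseq) auto
  moreover have "(\<Union>m. E m) = {\<omega> \<in> space M. future j (unit_step i) k l \<omega>}"
    by (auto simp: E_def future_def)
  moreover have "prob (E m) \<le> mult_weight (alpha M X) k l" for m
  proof -
    have "prob (E m) \<le> prob {\<omega> \<in> space M. ?P (seg j m \<omega>)}"
      by (rule finite_measure_mono[OF _ seg_event]) (auto simp: E_def)
    also have "\<dots> = path_avg m (\<lambda>xs. of_bool (?P xs))" by (rule prob_seg)
    also have "\<dots> \<le> mult_weight (alpha M X) k l"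
      unfolding alpha_eq np.\<alpha>_eq[symmetric] by (rule np.visits_upper)
    finally show ?thesis .
  qed
  ultimately show ?thesis by (auto intro: LIMSEQ_le_const2)
qed

section \<open>Exceedance events and Borel--Cantelli\<close>

lemma prob_countable_UN_le:
  assumes "\<And>n. A n \<in> events" "\<And>n. prob (A n) \<le> f n" "summable f"
  shows "prob (\<Union>n. A n) \<le> suminf f"
proof -
  have "summable (\<lambda>n. prob (A n))"
    by (rule summable_comparison_test'[OF assms(3), of 0]) (simp add: assms)
  then have "prob (\<Union>n. A n) \<le> (\<Sum>n. prob (A n))"
    by (intro finite_measure_subadditive_countably) (use assms in auto)
  also have "\<dots> \<le> suminf f"
    by (rule suminf_le) (use assms \<open>summable (\<lambda>n. prob (A n))\<close> in auto)
  finally show ?thesis .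
qed

text \<open>\<open>Suc k\<close> accounts for the visit at time \<open>j\<close> itself, which
  \<open>future\<close> leaves out.\<close>

definition excess :: "nat \<Rightarrow> 'd + 'd \<Rightarrow> real \<Rightarrow> 'a set" where
  "excess j i t = {\<omega> \<in> space M. \<exists>k l. rate (alpha M X) (real (Suc k)) (real l) > t \<and> future j (unit_step i) k l \<omega>}"

lemma excess_event: "excess j i t \<in> events"
proof -
  have "{\<omega> \<in> space M. rate (alpha M X) (real (Suc k)) (real l) > t \<and> future j (unit_step i) k l \<omega>} \<in> events" for k l
    by (cases "rate (alpha M X) (real (Suc k)) (real l) > t") (auto intro: future_event)
  then show ?thesis unfolding excess_def by (intro sets.sets_Collect_countable_Ex)
qed

lemma prob_excess_le:
  assumes dim: "CARD('d) \<ge> 3" and \<delta>: "0 < \<delta>" "\<delta> < 1"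
  defines "q \<equiv> exp (- \<delta> * ln (1 / (2 * alpha M X)))"
  shows "prob (excess j i t) \<le> exp (- (1 - \<delta>) * t) / alpha M X * (1 / (1 - q) * (1 / (1 - q)))"
proof -
  let ?a = "alpha M X"
  have a: "?a > 0" "?a < 1 / 2" unfolding alpha_eq using \<alpha>\<^sub>d_bounds[OF dim] by auto
  have "ln (1 / (2 * ?a)) > 0" using a by simp
  then have "- \<delta> * ln (1 / (2 * ?a)) < 0" using \<delta> by (simp add: mult_pos_pos)
  then have q: "0 < q" "q < 1" unfolding q_def by auto
  have geo: "summable (\<lambda>n. q ^ n)" "(\<Sum>n. q ^ n) = 1 / (1 - q)"
    using q by (auto intro: summable_geometric suminf_geometric)
  define c where "c = exp (- (1 - \<delta>) * t) / ?a"
  have c: "c \<ge> 0" using a by (simp add: c_def)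
  define B where "B k l = {\<omega> \<in> space M. rate ?a (real (Suc k)) (real l) > t \<and> future j (unit_step i) k l \<omega>}" for k l
  have B: "B k l \<in> events" for k l
    unfolding B_def by (cases "rate ?a (real (Suc k)) (real l) > t") (auto intro: future_event)
  have pB: "prob (B k l) \<le> c * q ^ k * q ^ l" for k l
  proof (cases "rate ?a (real (Suc k)) (real l) > t")
    case True
    then have "prob (B k l) \<le> mult_weight ?a k l"
      using prob_future_le[OF dim, of j i k l] by (simp add: B_def)
    also have "\<dots> \<le> c * (q ^ k * q ^ l)"
      unfolding c_def q_def by (rule mult_weight_tail[OF a \<delta> True])
    finally show ?thesis by (simp add: mult.assoc)
  qed (use c q in \<open>simp add: B_def\<close>)
  have pk: "prob (\<Union>l. B k l) \<le> c * q ^ k * (1 / (1 - q))" for k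
  proof -
    have "prob (\<Union>l. B k l) \<le> (\<Sum>l. c * q ^ k * q ^ l)"
      by (rule prob_countable_UN_le[OF B pB]) (intro summable_mult geo)
    then show ?thesis using suminf_mult[OF geo(1), of "c * q ^ k"] geo(2) by simp
  qed
  have UB: "(\<Union>l. B k l) \<in> events" for k using B by auto
  have sm: "summable (\<lambda>k. c * q ^ k * (1 / (1 - q)))" by (intro summable_mult2 summable_mult geo)
  have "excess j i t = (\<Union>k. \<Union>l. B k l)"
    by (auto simp: excess_def B_def)
  also have "prob \<dots> \<le> (\<Sum>k. c * q ^ k * (1 / (1 - q)))"
    by (rule prob_countable_UN_le[OF UB pk sm])
  also have "\<dots> = c * (1 / (1 - q) * (1 / (1 - q)))"
    using suminf_mult[OF geo(1), of "c * (1 / (1 - q))"] geo(2) q by (simp add: mult_ac)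
  finally show ?thesis by (simp add: c_def)
qed

lemma AE_excess:
  assumes dim: "CARD('d) \<ge> 3" and \<epsilon>: "\<epsilon> > 0"
  shows "AE \<omega> in M. \<exists>J. \<forall>j\<ge>J. \<forall>i. \<omega> \<notin> excess j i ((1 + \<epsilon>) * ln (real j))"
proof -
  have "AE \<omega> in M. \<exists>J. \<forall>j\<ge>J. \<omega> \<notin> excess j i ((1 + \<epsilon>) * ln (real j))" for i
  proof -
    \<comment> \<open>Chosen so that
      \<open>(1 - \<delta>) (1 + \<epsilon>) = 1 + \<epsilon> / 2\<close>: half of the margin pays
      for the sum over pairs, the other half keeps the sum over \<open>j\<close> convergent.\<close>
    define \<delta> where "\<delta> = \<epsilon> / (2 * (1 + \<epsilon>))"
    have \<delta>: "0 < \<delta>" "\<delta> < 1" using \<epsilon> by (auto simp: \<delta>_def field_simps)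
    have \<delta>\<epsilon>: "(1 - \<delta>) * (1 + \<epsilon>) = 1 + \<epsilon> / 2" using \<epsilon> by (simp add: \<delta>_def field_simps)
    define q where "q = exp (- \<delta> * ln (1 / (2 * alpha M X)))"
    define C where "C = 1 / alpha M X * (1 / (1 - q) * (1 / (1 - q)))"
    have le: "prob (excess j i ((1 + \<epsilon>) * ln (real j))) \<le> C * real j powr (- (1 + \<epsilon> / 2))" if "j \<ge> 1" for j
    proof -
      have "exp (- (1 - \<delta>) * ((1 + \<epsilon>) * ln (real j))) = exp (- ((1 - \<delta>) * (1 + \<epsilon>)) * ln (real j))"
        by (simp only: mult_minus_left mult.assoc)
      also have "\<dots> = real j powr (- (1 + \<epsilon> / 2))"
        unfolding \<delta>\<epsilon> using that by (simp add: powr_def)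
      finally show ?thesis
        using prob_excess_le[OF dim \<delta>, of j i "(1 + \<epsilon>) * ln (real j)"] by (simp add: C_def q_def)
    qed
    have "summable (\<lambda>j. prob (excess j i ((1 + \<epsilon>) * ln (real j))))"
    proof (rule summable_comparison_test)
      have "summable (\<lambda>j. real j powr (- (1 + \<epsilon> / 2)))" using \<epsilon> by (subst summable_real_powr_iff) simp
      then show "summable (\<lambda>j. C * real j powr (- (1 + \<epsilon> / 2)))" by (rule summable_mult)
      show "\<exists>N. \<forall>j\<ge>N. norm (prob (excess j i ((1 + \<epsilon>) * ln (real j)))) \<le> C * real j powr (- (1 + \<epsilon> / 2))"
        using le by (intro exI[of _ 1]) simp
    qed
    then have "AE \<omega> in M. eventually (\<lambda>j. \<omega> \<in> space M - excess j i ((1 + \<epsilon>) * ln (real j))) sequentially"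
      by (intro borel_cantelli_AE1 excess_event) (auto simp: emeasure_eq_measure)
    then show ?thesis by (auto simp: eventually_sequentially)
  qed
  then have "AE \<omega> in M. \<forall>i\<in>(UNIV :: ('d + 'd) set). \<exists>J. \<forall>j\<ge>J. \<omega> \<notin> excess j i ((1 + \<epsilon>) * ln (real j))"
    by (intro AE_finite_allI) auto
  then show ?thesis
  proof (rule AE_mp, intro AE_I2 impI)
    fix \<omega> assume "\<forall>i\<in>(UNIV :: ('d + 'd) set). \<exists>J. \<forall>j\<ge>J. \<omega> \<notin> excess j i ((1 + \<epsilon>) * ln (real j))"
    then obtain J :: "'d + 'd \<Rightarrow> nat" where J: "\<forall>i. \<forall>j\<ge>J i. \<omega> \<notin> excess j i ((1 + \<epsilon>) * ln (real j))"
      using choice[of "\<lambda>i J. \<forall>j\<ge>J. \<omega> \<notin> excess j i ((1 + \<epsilon>) * ln (real j))"] by auto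
    show "\<exists>J. \<forall>j\<ge>J. \<forall>i. \<omega> \<notin> excess j i ((1 + \<epsilon>) * ln (real j))"
    proof (intro exI allI impI)
      fix j i assume "Max (range J) \<le> j"
      then have "J i \<le> j" by (meson Max_ge finite finite_imageI order_trans rangeI)
      then show "\<omega> \<notin> excess j i ((1 + \<epsilon>) * ln (real j))" using J by blast
    qed
  qed
qed

text \<open>It suffices to look at the first visit to the pair, since all other visits then lie in
  the future. If the neighbour is met first, the roles are exchanged, using the opposite direction
  and the symmetry of the rate.\<close>

lemma upper_part:
  assumes dim: "CARD('d) \<ge> 3" and \<epsilon>: "\<epsilon> > 0"
  shows "AE \<omega> in M. \<exists>n0. \<forall>n\<ge>n0. \<forall>j\<le>n. \<forall>i.
    rate (alpha M X) (real (total_visits (walk X j \<omega>) \<omega>)) (real (total_visits (walk X j \<omega> + unit_step i) \<omega>))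
      \<le> (1 + \<epsilon>) * ln (real n)"
  using AE_excess[OF assms] AE_finite_visits[OF dim] AE_space
proof eventually_elim
  case (elim \<omega>)
  note fin = elim(2)[rule_format]
  let ?a = "alpha M X"
  obtain J0 where J0: "\<And>j i. j \<ge> J0 \<Longrightarrow> \<omega> \<notin> excess j i ((1 + \<epsilon>) * ln (real j))" using elim(1) by auto
  show ?case
  proof -
    \<comment> \<open>\<open>J >= 1\<close> puts time 0, which local times do not count, among the
      finitely many exceptional times.\<close>
    define J where "J = max 1 J0"
    define R where "R j i = rate ?a (real (total_visits (walk X j \<omega>) \<omega>)) (real (total_visits (walk X j \<omega> + unit_step i) \<omega>))" for j i
    \<comment> \<open>Early first visits contribute only a finite maximum, which \<open>ln n\<close>
      eventually exceeds.\<close>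
    define C where "C = Max ((\<lambda>(j, i). R j i) ` ({..<J} \<times> UNIV))"
    have C: "R j i \<le> C" if "j < J" for j i
      unfolding C_def by (rule Max_ge) (use that in auto)
    have key: "R j i \<le> max C ((1 + \<epsilon>) * ln (real n))" if jn: "j \<le> n" and first: "\<And>r. r < j \<Longrightarrow> walk X r \<omega> \<noteq> walk X j \<omega> \<and> walk X r \<omega> \<noteq> walk X j \<omega> + unit_step i" for j i n
    proof (cases "j < J")
      case True
      then show ?thesis using C[of j i] by (simp add: le_max_iff_disj)
    next
      case False
      let ?k = "card {r. j < r \<and> walk X r \<omega> = walk X j \<omega>}"
      let ?l = "card {r. j < r \<and> walk X r \<omega> = walk X j \<omega> + unit_step i}"
      have j: "j \<ge> J0" "j > 0" using False by (auto simp: J_def)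
      have "{k. k > 0 \<and> walk X k \<omega> = walk X j \<omega>} = insert j {r. j < r \<and> walk X r \<omega> = walk X j \<omega>}"
        using j first by (auto simp: not_less) (metis linorder_neqE_nat)
      then have 1: "total_visits (walk X j \<omega>) \<omega> = Suc ?k"
        unfolding total_visits_def
        by (simp only:) (rule card_insert_disjoint, rule finite_subset[OF _ fin[of "walk X j \<omega>"]], auto)
      have "{k. k > 0 \<and> walk X k \<omega> = walk X j \<omega> + unit_step i} = {r. j < r \<and> walk X r \<omega> = walk X j \<omega> + unit_step i}"
        using j first by (auto simp: not_less) (metis linorder_neqE_nat add_cancel_right_right unit_step_nonzero)
      then have 2: "total_visits (walk X j \<omega> + unit_step i) \<omega> = ?l"
        by (simp add: total_visits_def)
      have "rate ?a (real (Suc ?k)) (real ?l) \<le> (1 + \<epsilon>) * ln (real j)"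
        using J0[OF j(1), of i] future_card[OF fin, of j "unit_step i"] elim(3)
        unfolding excess_def by (auto simp: not_less[symmetric] simp del: not_less of_nat_Suc)
      also have "\<dots> \<le> (1 + \<epsilon>) * ln (real n)"
        using j jn \<epsilon> by (intro mult_left_mono) auto
      finally show ?thesis unfolding R_def 1 2 by simp
    qed
    have bound: "R j i \<le> max C ((1 + \<epsilon>) * ln (real n))" if "j \<le> n" for j i n
    proof -
      let ?S = "\<lambda>r. walk X r \<omega> = walk X j \<omega> \<or> walk X r \<omega> = walk X j \<omega> + unit_step i"
      define r where "r = (LEAST r. ?S r)"
      have r: "?S r" unfolding r_def by (rule LeastI[of ?S j]) simp
      have rj: "r \<le> j" unfolding r_def by (rule Least_le) simp
      have lt: "\<not> ?S r'" if "r' < r" for r' using that unfolding r_def by (rule not_less_Least)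
      from r show ?thesis
      proof
        assume eq: "walk X r \<omega> = walk X j \<omega>"
        have "R r i \<le> max C ((1 + \<epsilon>) * ln (real n))"
          by (rule key) (use rj that lt eq in auto)
        then show ?thesis by (simp add: R_def eq)
      next
        assume eq: "walk X r \<omega> = walk X j \<omega> + unit_step i"
        then have eq': "walk X j \<omega> = walk X r \<omega> + unit_step (flip i)" by simp
        have "R r (flip i) \<le> max C ((1 + \<epsilon>) * ln (real n))"
          by (rule key) (use rj that lt eq in auto)
        then show ?thesis using rate_commute by (simp add: R_def eq)
      qed
    qed
    have "eventually (\<lambda>n. (1 + \<epsilon>) * ln (real n) \<ge> C) sequentially"
    proof -
      have "filterlim (\<lambda>n. (1 + \<epsilon>) * ln (real n)) at_top sequentially"
        using \<epsilon> by (intro filterlim_tendsto_pos_mult_at_top[OF tendsto_const]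
            filterlim_compose[OF ln_at_top filterlim_real_sequentially]) auto
      then show ?thesis by (simp add: filterlim_at_top)
    qed
    then obtain n0 where "\<And>n. n \<ge> n0 \<Longrightarrow> (1 + \<epsilon>) * ln (real n) \<ge> C" by (auto simp: eventually_sequentially)
    then have "\<forall>n\<ge>n0. \<forall>j\<le>n. \<forall>i. R j i \<le> (1 + \<epsilon>) * ln (real n)"
      using bound by (metis max.absorb2)
    then show ?thesis unfolding R_def by blast
  qed
qed

end

section \<open>Independent blocks\<close>

primrec block_count :: "((int ^ 'd) list \<Rightarrow> bool) \<Rightarrow> nat \<Rightarrow> nat \<Rightarrow> (int ^ 'd) list \<Rightarrow> real" where
  "block_count W b 0 xs = 0"
| "block_count W b (Suc K) xs = of_bool (W (take b xs)) + block_count W b K (drop b xs)"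

text \<open>By independence of the blocks the mixed term is a product with the vanishing mean of a
  centred indicator, so the variance is that of a binomial law.\<close>

lemma block_count_variance:
  fixes W :: "(int ^ 'd) list \<Rightarrow> bool" and b K :: nat
  defines "q \<equiv> path_avg b (\<lambda>xs. of_bool (W xs))"
  shows "path_avg (K * b) (\<lambda>xs. (block_count W b K xs - real K * q)\<^sup>2) = real K * (q * (1 - q))"
proof (induction K)
  case (Suc K)
  let ?I = "\<lambda>xs. of_bool (W xs) - q" and ?Z = "\<lambda>xs. block_count W b K xs - real K * q"
  have I1: "path_avg b ?I = 0" by (simp add: path_avg_diff q_def)
  have sq: "(\<lambda>xs. (?I xs)\<^sup>2) = (\<lambda>xs. (1 - 2 * q) * of_bool (W xs) + q\<^sup>2)"
    by (auto simp: power2_eq_square algebra_simps)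
  have I2: "path_avg b (\<lambda>xs. (?I xs)\<^sup>2) = q * (1 - q)"
    unfolding sq path_avg_add path_avg_cmult path_avg_const q_def[symmetric]
    by (simp add: power2_eq_square algebra_simps)
  have eq: "block_count W b (Suc K) xs - real (Suc K) * q = ?I (take b xs) + ?Z (drop b xs)" for xs
    by (simp add: algebra_simps)
  have left: "path_avg (b + K * b) (\<lambda>xs. F (take b xs)) = path_avg b F" for F :: "(int ^ 'd) list \<Rightarrow> real"
    using path_avg_prod[of b "K * b" F "\<lambda>_. 1"] by simp
  have right: "path_avg (b + K * b) (\<lambda>xs. F (drop b xs)) = path_avg (K * b) F" for F :: "(int ^ 'd) list \<Rightarrow> real"
    using path_avg_prod[of b "K * b" "\<lambda>_. 1" F] by simp
  have "(?I (take b xs) + ?Z (drop b xs))\<^sup>2 =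
      (?I (take b xs))\<^sup>2 + (2 * (?I (take b xs) * ?Z (drop b xs)) + (?Z (drop b xs))\<^sup>2)" for xs
    by (simp add: power2_eq_square algebra_simps)
  then have "path_avg (b + K * b) (\<lambda>xs. (?I (take b xs) + ?Z (drop b xs))\<^sup>2) =
      q * (1 - q) + (2 * (path_avg b ?I * path_avg (K * b) ?Z) + real K * (q * (1 - q)))"
    unfolding path_avg_add path_avg_cmult left[of "\<lambda>xs. (?I xs)\<^sup>2"] right[of "\<lambda>xs. (?Z xs)\<^sup>2"]
      path_avg_prod[of b "K * b" ?I ?Z]
    by (simp only: path_avg_add path_avg_cmult left[of "\<lambda>xs. (?I xs)\<^sup>2"] right[of "\<lambda>xs. (?Z xs)\<^sup>2"]
      path_avg_prod[of b "K * b" ?I ?Z] I2 Suc)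
  then show ?case
    unfolding eq I1 by (simp add: algebra_simps)
qed auto

text \<open>Chebyshev at distance \<open>K q / 2\<close> below the mean, with the variance bounded
  by \<open>K q\<close>.\<close>

lemma block_count_deviation:
  fixes W :: "(int ^ 'd) list \<Rightarrow> bool" and b K :: nat
  defines "q \<equiv> path_avg b (\<lambda>xs. of_bool (W xs))"
  assumes "q > 0" "K > 0"
  shows "path_avg (K * b) (\<lambda>xs. of_bool (block_count W b K xs \<le> real K * q / 2)) \<le> 4 / (real K * q)"
proof -
  define c where "c = real K * q"
  have c: "c > 0" using assms by (simp add: c_def)
  have "path_avg (K * b) (\<lambda>xs. of_bool (block_count W b K xs \<le> c / 2)) \<le>
      path_avg (K * b) (\<lambda>xs. (4 / c\<^sup>2) * (block_count W b K xs - c)\<^sup>2)"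
  proof (rule path_avg_mono)
    fix xs :: "(int ^ 'd) list"
    show "of_bool (block_count W b K xs \<le> c / 2) \<le> (4 / c\<^sup>2) * (block_count W b K xs - c)\<^sup>2"
    proof (cases "block_count W b K xs \<le> c / 2")
      case True
      then have "(c / 2)\<^sup>2 \<le> (c - block_count W b K xs)\<^sup>2" using c by (intro power_mono) auto
      then show ?thesis using True c by (simp add: field_simps power2_commute)
    qed simp
  qed
  also have "\<dots> = (4 / c\<^sup>2) * (real K * (q * (1 - q)))"
    unfolding path_avg_cmult c_def q_def block_count_variance ..
  also have "\<dots> \<le> (4 / c\<^sup>2) * c"
    using assms unfolding c_def by (intro mult_left_mono) auto
  also have "\<dots> = 4 / c" using c by (simp add: power2_eq_square)
  finally show ?thesis by (simp add: c_def)
qed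

lemma visits_eq_0_iff: "visits z x xs = 0 \<longleftrightarrow> (\<forall>r\<in>{1..length xs}. x + sum_list (take r xs) \<noteq> z)"
proof (induction xs arbitrary: x)
  case (Cons v xs)
  have "(\<forall>r\<in>{1..length (v # xs)}. x + sum_list (take r (v # xs)) \<noteq> z) \<longleftrightarrow>
      x + v \<noteq> z \<and> (\<forall>r\<in>{1..length xs}. x + v + sum_list (take r xs) \<noteq> z)" (is "?L \<longleftrightarrow> ?R")
  proof
    assume L: ?L
    show ?R
    proof (intro conjI ballI)
      show "x + v \<noteq> z" using bspec[OF L, of 1] by simp
      fix r assume "r \<in> {1..length xs}"
      then show "x + v + sum_list (take r xs) \<noteq> z" using bspec[OF L, of "Suc r"] by (simp add: add.assoc)
    qed
  next
    assume R: ?R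
    show ?L
    proof
      fix r assume "r \<in> {1..length (v # xs)}"
      then show "x + sum_list (take r (v # xs)) \<noteq> z"
        using R by (cases r; cases "r = 1") (auto simp: add.assoc)
    qed
  qed
  then show ?case using Cons by simp
qed simp

section \<open>Good blocks and their spoiling from outside\<close>

locale walk_pair = simple_random_walk M X + neighbour_pair e i
  for M :: "'a measure" and X :: "nat \<Rightarrow> 'a \<Rightarrow> int ^ 'd" and e :: "int ^ 'd" and i
begin

text \<open>The centre sits at step \<open>L\<close>. The past is read backwards, where sums of
  reversed steps are centre minus earlier position; an earlier visit to the neighbour in direction
  \<open>e\<close> therefore shows up at \<open>- e\<close>.\<close>

definition good_block :: "nat \<Rightarrow> nat \<Rightarrow> nat \<Rightarrow> (int ^ 'd) list \<Rightarrow> bool" where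
  "good_block L k l xs \<longleftrightarrow>
     (visits 0 0 (rev (take L xs)) = 0 \<and> visits (- e) 0 (rev (take L xs)) = 0) \<and> settled L k l 0 (drop L xs)"

definition outside :: "nat \<Rightarrow> nat \<Rightarrow> 'a \<Rightarrow> bool" where
  "outside L c \<omega> \<longleftrightarrow> (\<exists>r. walk X (c + 2 * L + Suc r) \<omega> \<in> {walk X c \<omega>, walk X c \<omega> + e}) \<or>
     (\<exists>r\<in>{L<..c}. walk X (c - r) \<omega> \<in> {walk X c \<omega>, walk X c \<omega> + e})"

text \<open>Past and future of the centre are independent. Reversed, the past is again a walk, and
  it avoids 0 and its neighbour \<open>- e\<close> with probability at least
  \<open>1 - 2 \<alpha>\<close>.\<close>

lemma prob_good_block_ge:
  assumes m: "real m \<ge> (4 * hk_const TYPE('d) * real (k + l) / \<alpha>)\<^sup>2" "m \<ge> 1" and L: "L \<ge> (k + l) * m"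
  shows "path_avg (L + 2 * L) (\<lambda>xs. of_bool (good_block L k l xs)) \<ge> (1 - 2 * \<alpha>)\<^sup>2 / 2 * mult_weight \<alpha> k l"
proof -
  interpret neg: neighbour_pair "- e" "flip i" by unfold_locales (simp_all add: dim e_step)
  have past: "path_avg L (\<lambda>xs. of_bool (visits 0 0 (rev xs) = 0 \<and> visits (- e) 0 (rev xs) = 0)) \<ge> 1 - 2 * \<alpha>"
    unfolding path_avg_rev[of L "\<lambda>xs. of_bool (visits 0 0 xs = 0 \<and> visits (- e) 0 xs = 0)"]
    using neg.no_visit_lower[of 0 L] by (simp add: \<alpha>_eq neg.\<alpha>_eq)
  have "(1 - 2 * \<alpha>)\<^sup>2 / 2 * mult_weight \<alpha> k l = (1 - 2 * \<alpha>) * ((1 - 2 * \<alpha>) / 2 * mult_weight \<alpha> k l)"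
    by (simp add: power2_eq_square)
  also have "\<dots> \<le> path_avg L (\<lambda>xs. of_bool (visits 0 0 (rev xs) = 0 \<and> visits (- e) 0 (rev xs) = 0)) *
      path_avg (2 * L) (\<lambda>xs. of_bool (settled L k l 0 xs))"
    using \<alpha>_half \<alpha>_pos
    by (intro mult_mono past settled_lower[OF m L] path_avg_nonneg mult_nonneg_nonneg mult_weight_nonneg) auto
  also have "\<dots> = path_avg (L + 2 * L) (\<lambda>xs. of_bool (good_block L k l xs))"
    unfolding path_avg_prod[symmetric] by (simp add: good_block_def of_bool_conj mult.assoc)
  finally show ?thesis .
qed

lemma good_block_local_time:
  assumes L: "L \<ge> 1" "L \<le> c" and good: "good_block L k l (seg (c - L) (L + 2 * L) \<omega>)" and out: "\<not> outside L c \<omega>"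
  shows "local_time X (walk X c \<omega>) \<omega> = enat (k + 1)" "local_time X (walk X c \<omega> + e) \<omega> = enat l"
proof -
  let ?V = "\<lambda>z. {r \<in> {c<..c + 2 * L}. walk X r \<omega> = walk X c \<omega> + z}"
  have split: "seg (c - L) (L + 2 * L) \<omega> = seg (c - L) L \<omega> @ seg c (2 * L) \<omega>"
    using L by (subst seg_append) simp
  have past: "visits 0 0 (rev (seg (c - L) L \<omega>)) = 0" "visits (- e) 0 (rev (seg (c - L) L \<omega>)) = 0"
    and "visits 0 0 (seg c (2 * L) \<omega>) = k" "visits e 0 (seg c (2 * L) \<omega>) = l"
    using good unfolding good_block_def split settled_def by auto
  moreover have "{r \<in> {c<..c + 2 * L}. 0 + walk X r \<omega> - walk X c \<omega> = z} = ?V z" for z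
    by (auto simp: algebra_simps)
  ultimately have card: "card (?V 0) = k" "card (?V e) = l" unfolding visits_seg by simp_all
  have no_past: "walk X r \<omega> \<noteq> walk X c \<omega> + z" if "z = 0 \<or> z = e" "r < c" for r z
  proof (cases "c - r \<le> L")
    case True
    define s where "s = c - r"
    have s: "s \<in> {1..L}" "r = c - s" using True that by (auto simp: s_def)
    have "seg (c - L) L \<omega> = seg (c - L) (L - s) \<omega> @ seg (c - s) s \<omega>"
      using seg_append[of "c - L" "L - s" s \<omega>] s L by simp
    then have "sum_list (take s (rev (seg (c - L) L \<omega>))) = walk X c \<omega> - walk X r \<omega>"
      using s L by (simp add: sum_list_seg sum_list_rev)
    then have "walk X c \<omega> - walk X r \<omega> \<noteq> 0" "walk X c \<omega> - walk X r \<omega> \<noteq> - e"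
      using past s(1) unfolding visits_eq_0_iff by (auto dest!: bspec[of _ _ s])
    then show ?thesis using that(1) by (auto simp: algebra_simps)
  next
    case False
    then have "c - r \<in> {L<..c}" "c - (c - r) = r" using that(2) by auto
    then have "walk X r \<omega> \<notin> {walk X c \<omega>, walk X c \<omega> + e}"
      using out unfolding outside_def by metis
    then show ?thesis using that(1) by auto
  qed
  have no_future: "walk X r \<omega> \<noteq> walk X c \<omega> + z" if "z = 0 \<or> z = e" "r > c + 2 * L" for r z
  proof -
    have "c + 2 * L + Suc (r - Suc (c + 2 * L)) = r" using that(2) by simp
    then have "walk X r \<omega> \<notin> {walk X c \<omega>, walk X c \<omega> + e}"
      using out unfolding outside_def by metis
    then show ?thesis using that(1) by auto
  qed
  have "r \<in> {c<..c + 2 * L} \<or> r = c" if "walk X r \<omega> = walk X c \<omega> + z" "z = 0 \<or> z = e" for r z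
    using no_past[OF that(2), of r] no_future[OF that(2), of r] that(1) by (metis greaterThanAtMost_iff linorder_neqE_nat not_le)
  note range = this
  \<comment> \<open>As \<open>c >= L >= 1\<close>, the visit at the centre is counted; it is the
    extra one in \<open>k + 1\<close>.\<close>
  have set0: "{r. r > 0 \<and> walk X r \<omega> = walk X c \<omega>} = insert c (?V 0)"
    using range[of _ 0] L by auto
  have rg: "r \<in> {c<..c + 2 * L}" if "walk X r \<omega> = walk X c \<omega> + e" for r
    using range[OF that] e_nonzero that by auto
  have sete: "{r. r > 0 \<and> walk X r \<omega> = walk X c \<omega> + e} = ?V e"
    by (auto dest: rg)
  show "local_time X (walk X c \<omega>) \<omega> = enat (k + 1)"
    unfolding local_time_def set0 by (simp add: Let_def card(1)[simplified])
  show "local_time X (walk X c \<omega> + e) \<omega> = enat l"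
    unfolding local_time_def sete by (simp add: Let_def card(2)[simplified])
qed

text \<open>The counts use the first \<open>L\<close> steps and the return comes at least
  \<open>L + 1\<close> steps later. Given these first steps, the heat kernel bound is uniform in
  their endpoint, so weight and decay multiply.\<close>

lemma prob_return_after:
  "prob {\<omega> \<in> space M. (visits 0 0 (seg c L \<omega>) = k \<and> visits e 0 (seg c L \<omega>) = l) \<and> walk X (c + 2 * L + Suc r) \<omega> = walk X c \<omega> + z}
    \<le> mult_weight \<alpha> k l * (hk_const TYPE('d) * real (L + Suc r) powr (-3/2))"
proof -
  let ?P = "\<lambda>xs. visits 0 0 xs = k \<and> visits e 0 xs = l" and ?n = "L + Suc r"
  have eq: "(?P (seg c L \<omega>) \<and> walk X (c + 2 * L + Suc r) \<omega> = walk X c \<omega> + z) \<longleftrightarrow>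
      (\<lambda>xs. ?P (take L xs) \<and> sum_list xs = z) (seg c (L + ?n) \<omega>)" for \<omega>
  proof -
    have "take L (seg c (L + ?n) \<omega>) = seg c L \<omega>" by (subst seg_append) simp
    moreover have "c + 2 * L + Suc r = c + (L + ?n)" by simp
    ultimately show ?thesis by (simp only: sum_list_seg) (auto simp: algebra_simps)
  qed
  have "prob {\<omega> \<in> space M. ?P (seg c L \<omega>) \<and> walk X (c + 2 * L + Suc r) \<omega> = walk X c \<omega> + z} =
      path_avg (L + ?n) (\<lambda>xs. of_bool (?P (take L xs) \<and> sum_list xs = z))"
    unfolding eq by (rule prob_seg)
  also have "\<dots> = path_avg L (\<lambda>xs. of_bool (?P xs) * path_avg ?n (\<lambda>ys. of_bool (sum_list xs + sum_list ys = z)))"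
    unfolding path_avg_append by (rule path_avg_cong) (simp add: path_avg_cmult[symmetric] of_bool_conj)
  also have "\<dots> \<le> path_avg L (\<lambda>xs. of_bool (?P xs) * (hk_const TYPE('d) * real ?n powr (-3/2)))"
    by (intro path_avg_mono mult_left_mono heat_kernel_le[OF dim]) auto
  also have "\<dots> = path_avg L (\<lambda>xs. of_bool (?P xs)) * (hk_const TYPE('d) * real ?n powr (-3/2))"
    by (rule path_avg_multc)
  also have "\<dots> \<le> mult_weight \<alpha> k l * (hk_const TYPE('d) * real ?n powr (-3/2))"
    by (intro mult_right_mono visits_upper mult_nonneg_nonneg) (auto simp: hk_const_pos less_imp_le)
  finally show ?thesis .
qed

text \<open>The counts depend on steps after \<open>c\<close>, the displacement back to the earlier
  position on steps before \<open>c\<close>; the two are independent.\<close>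

lemma prob_return_before:
  assumes "r \<in> {L<..c}"
  shows "prob {\<omega> \<in> space M. (visits 0 0 (seg c L \<omega>) = k \<and> visits e 0 (seg c L \<omega>) = l) \<and> walk X (c - r) \<omega> = walk X c \<omega> + z}
    \<le> mult_weight \<alpha> k l * (hk_const TYPE('d) * real r powr (-3/2))"
proof -
  let ?P = "\<lambda>xs. visits 0 0 xs = k \<and> visits e 0 xs = l"
  have eq: "(?P (seg c L \<omega>) \<and> walk X (c - r) \<omega> = walk X c \<omega> + z) \<longleftrightarrow>
      (\<lambda>xs. sum_list (take r xs) = - z \<and> ?P (drop r xs)) (seg (c - r) (r + L) \<omega>)" for \<omega>
  proof -
    have "seg (c - r) (r + L) \<omega> = seg (c - r) r \<omega> @ seg c L \<omega>" using assms by (subst seg_append) simp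
    then have "take r (seg (c - r) (r + L) \<omega>) = seg (c - r) r \<omega>" "drop r (seg (c - r) (r + L) \<omega>) = seg c L \<omega>" by simp_all
    then show ?thesis using assms by (simp add: sum_list_seg) (auto simp: algebra_simps)
  qed
  have "prob {\<omega> \<in> space M. ?P (seg c L \<omega>) \<and> walk X (c - r) \<omega> = walk X c \<omega> + z} =
      path_avg (r + L) (\<lambda>xs. of_bool (sum_list (take r xs) = - z \<and> ?P (drop r xs)))"
    unfolding eq by (rule prob_seg)
  also have "\<dots> = path_avg r (\<lambda>xs. of_bool (sum_list xs = - z)) * path_avg L (\<lambda>xs. of_bool (?P xs))"
    unfolding path_avg_prod[symmetric] by (simp add: of_bool_conj)
  also have "\<dots> \<le> (hk_const TYPE('d) * real r powr (-3/2)) * mult_weight \<alpha> k l"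
    using heat_kernel_le[OF dim, of r 0 "- z"] assms
    by (intro mult_mono visits_upper path_avg_nonneg) (auto simp: hk_const_pos less_imp_le)
  finally show ?thesis by (simp add: mult.commute)
qed

lemma outside_event: "{\<omega> \<in> space M. outside L c \<omega>} \<in> events"
proof -
  have ev: "{\<omega> \<in> space M. walk X a \<omega> = walk X b \<omega> + z} \<in> events" for a b z
  proof -
    have "{\<omega> \<in> space M. \<exists>y. walk X b \<omega> = y \<and> walk X a \<omega> = y + z} \<in> events"
      by (intro sets.sets_Collect_countable_Ex sets.sets_Collect_conj walk_event)
    then show ?thesis by simp
  qed
  have "{\<omega> \<in> space M. (\<exists>r. walk X (c + 2 * L + Suc r) \<omega> = walk X c \<omega> + 0 \<or> walk X (c + 2 * L + Suc r) \<omega> = walk X c \<omega> + e) \<or>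
     (\<exists>r\<in>{L<..c}. walk X (c - r) \<omega> = walk X c \<omega> + 0 \<or> walk X (c - r) \<omega> = walk X c \<omega> + e)} \<in> events"
    by (intro sets.sets_Collect_disj sets.sets_Collect_countable_Ex sets.sets_Collect_countable_Bex ev)
  then show ?thesis by (simp add: outside_def)
qed

text \<open>Two sites, before and after, make four families, each contributing
  \<open>2 C w / sqrt L\<close>. Keeping the weight \<open>w\<close> is essential: the good event is
  itself of order at least \<open>w\<close>, so the spoilt share is small uniformly in
  \<open>(k, l)\<close>.\<close>

lemma prob_good_outside_le:
  assumes L: "L \<ge> 1" "L \<le> c"
  shows "prob {\<omega> \<in> space M. good_block L k l (seg (c - L) (L + 2 * L) \<omega>) \<and> outside L c \<omega>}
    \<le> 8 * hk_const TYPE('d) * mult_weight \<alpha> k l / sqrt (real L)"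
proof -
  let ?w = "mult_weight \<alpha> k l" and ?C = "hk_const TYPE('d)"
  have w: "?w \<ge> 0" using \<alpha>_pos by (intro mult_weight_nonneg) simp
  have C: "?C \<ge> 0" by (simp add: hk_const_pos less_imp_le)
  define P where "P \<omega> \<longleftrightarrow> visits 0 0 (seg c L \<omega>) = k \<and> visits e 0 (seg c L \<omega>) = l" for \<omega>
  define A where "A z r = {\<omega> \<in> space M. P \<omega> \<and> walk X (c + 2 * L + Suc r) \<omega> = walk X c \<omega> + z}" for z r
  define B where "B z r = {\<omega> \<in> space M. P \<omega> \<and> walk X (c - r) \<omega> = walk X c \<omega> + z}" for z r
  have ev: "{\<omega> \<in> space M. P \<omega> \<and> walk X a \<omega> = walk X c \<omega> + z} \<in> events" for a z
  proof -
    have "{\<omega> \<in> space M. P \<omega> \<and> (\<exists>y. walk X c \<omega> = y \<and> walk X a \<omega> = y + z)} \<in> events"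
      unfolding P_def
      by (intro sets.sets_Collect_countable_Ex sets.sets_Collect_conj walk_event
          seg_event[of "\<lambda>xs. visits 0 0 xs = k"] seg_event[of "\<lambda>xs. visits e 0 xs = l"])
    then show ?thesis by simp
  qed
  have A: "A z r \<in> events" and B: "B z r \<in> events" for z r unfolding A_def B_def by (rule ev)+
  have pA: "prob (\<Union>r. A z r) \<le> ?w * ?C * (2 / sqrt (real L))" for z
  proof -
    define f where "f r = ?w * (?C * real (L + Suc r) powr (-3/2))" for r
    have part: "(\<Sum>r<n. f r) \<le> ?w * ?C * (2 / sqrt (real L))" for n
    proof -
      have "(\<Sum>r<n. f r) = ?w * ?C * (\<Sum>r<n. real (L + Suc r) powr (-3/2))"
        by (simp add: f_def sum_distrib_left mult.assoc)
      also have "(\<Sum>r<n. real (L + Suc r) powr (-3/2)) = (\<Sum>r\<in>{L<..L + n}. real r powr (-3/2))"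
        by (rule sum.reindex_bij_witness[of _ "\<lambda>r. r - Suc L" "\<lambda>r. L + Suc r"]) auto
      also have "?w * ?C * \<dots> \<le> ?w * ?C * (2 / sqrt (real L))"
        using w C by (intro mult_left_mono three_halves_sum_le L) auto
      finally show ?thesis .
    qed
    have "f r \<ge> 0" for r using w C by (simp add: f_def)
    then have f: "summable f"
      by (intro summableI_nonneg_bounded[of f "?w * ?C * (2 / sqrt (real L))"] part)
    have "prob (\<Union>r. A z r) \<le> suminf f"
      by (rule prob_countable_UN_le[OF A _ f]) (unfold A_def P_def f_def, rule prob_return_after)
    also have "\<dots> \<le> ?w * ?C * (2 / sqrt (real L))"
      by (rule suminf_le_const[OF f part])
    finally show ?thesis .
  qed
  have pB: "prob (\<Union>r\<in>{L<..c}. B z r) \<le> ?w * ?C * (2 / sqrt (real L))" for z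
  proof -
    have "prob (\<Union>r\<in>{L<..c}. B z r) \<le> (\<Sum>r\<in>{L<..c}. prob (B z r))"
      by (rule finite_measure_subadditive_finite) (use B in auto)
    also have "\<dots> \<le> (\<Sum>r\<in>{L<..c}. ?w * (?C * real r powr (-3/2)))"
      unfolding B_def P_def by (intro sum_mono prob_return_before)
    also have "\<dots> = ?w * ?C * (\<Sum>r\<in>{L<..L + (c - L)}. real r powr (-3/2))"
      using L by (simp add: sum_distrib_left mult.assoc)
    also have "\<dots> \<le> ?w * ?C * (2 / sqrt (real L))"
      using w C by (intro mult_left_mono three_halves_sum_le L) auto
    finally show ?thesis .
  qed
  \<comment> \<open>Of a good block only the counts over the \<open>L\<close> steps after its centre
    are retained.\<close>
  have "P \<omega>" if "good_block L k l (seg (c - L) (L + 2 * L) \<omega>)" for \<omega>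
  proof -
    have "seg (c - L) (L + 2 * L) \<omega> = seg (c - L) L \<omega> @ seg c L \<omega> @ seg (c + L) L \<omega>"
      using L seg_append[of "c - L" L "L + L" \<omega>] seg_append[of c L L \<omega>] by (simp add: mult_2)
    then show ?thesis using that unfolding good_block_def settled_def P_def by simp
  qed
  then have "{\<omega> \<in> space M. good_block L k l (seg (c - L) (L + 2 * L) \<omega>) \<and> outside L c \<omega>} \<subseteq>
      ((\<Union>r. A 0 r) \<union> (\<Union>r. A e r)) \<union> ((\<Union>r\<in>{L<..c}. B 0 r) \<union> (\<Union>r\<in>{L<..c}. B e r))"
    unfolding outside_def A_def B_def by fastforce
  then have "prob {\<omega> \<in> space M. good_block L k l (seg (c - L) (L + 2 * L) \<omega>) \<and> outside L c \<omega>} \<le>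
      prob (((\<Union>r. A 0 r) \<union> (\<Union>r. A e r)) \<union> ((\<Union>r\<in>{L<..c}. B 0 r) \<union> (\<Union>r\<in>{L<..c}. B e r)))"
    using A B by (intro finite_measure_mono) auto
  also have "\<dots> \<le> prob ((\<Union>r. A 0 r) \<union> (\<Union>r. A e r)) + prob ((\<Union>r\<in>{L<..c}. B 0 r) \<union> (\<Union>r\<in>{L<..c}. B e r))"
    using A B by (intro measure_Un_le) auto
  also have "\<dots> \<le> (prob (\<Union>r. A 0 r) + prob (\<Union>r. A e r)) + (prob (\<Union>r\<in>{L<..c}. B 0 r) + prob (\<Union>r\<in>{L<..c}. B e r))"
    using A B by (intro add_mono measure_Un_le) auto
  also have "\<dots> \<le> (?w * ?C * (2 / sqrt (real L)) + ?w * ?C * (2 / sqrt (real L))) + (?w * ?C * (2 / sqrt (real L)) + ?w * ?C * (2 / sqrt (real L)))"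
    by (intro add_mono pA pB)
  also have "\<dots> = 8 * ?C * ?w / sqrt (real L)" by simp
  finally show ?thesis .
qed

lemma block_count_seg:
  "block_count W b K (seg j (K * b) \<omega>) = (\<Sum>t<K. of_bool (W (seg (j + t * b) b \<omega>)))"
proof (induction K arbitrary: j)
  case (Suc K)
  have "seg j (Suc K * b) \<omega> = seg j b \<omega> @ seg (j + b) (K * b) \<omega>"
    using seg_append[of j b "K * b" \<omega>] by simp
  then show ?case using Suc[of "j + b"] by (simp add: sum.lessThan_Suc_shift add.assoc del: sum.lessThan_Suc)
qed simp

text \<open>Handled through measurable supersets, with its own measurability left aside.\<close>

definition missed :: "nat \<Rightarrow> nat \<Rightarrow> nat \<Rightarrow> 'a set" where
  "missed N k l = {\<omega> \<in> space M. \<not> (\<exists>j\<le>N. local_time X (walk X j \<omega>) \<omega> = enat (k + 1) \<and> local_time X (walk X j \<omega> + e) \<omega> = enat l)}"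

text \<open>Chebyshev bounds the number of good blocks from below, Markov bounds the number of those
  spoilt by a visit outside the block from above.\<close>

lemma missed_subset:
  assumes m: "real m \<ge> (4 * hk_const TYPE('d) * real (k + l) / \<alpha>)\<^sup>2" "m \<ge> 1"
    and L: "L \<ge> (k + l) * m" "L \<ge> 1" and K: "K \<ge> 1" "K * (3 * L) \<le> N"
  defines "q \<equiv> (1 - 2 * \<alpha>)\<^sup>2 / 2 * mult_weight \<alpha> k l"
  shows "\<exists>E\<in>events. missed N k l \<subseteq> E \<and>
    prob E \<le> 4 / (real K * q) + 32 * hk_const TYPE('d) / ((1 - 2 * \<alpha>)\<^sup>2 * sqrt (real L))"
proof -
  let ?w = "mult_weight \<alpha> k l" and ?C = "hk_const TYPE('d)"
  define \<rho> where "\<rho> = (1 - 2 * \<alpha>)\<^sup>2"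
  have \<rho>: "\<rho> > 0" using \<alpha>_half by (simp add: \<rho>_def)
  have w: "?w > 0" using \<alpha>_pos by (simp add: mult_weight_def)
  define b where "b = L + 2 * L"
  \<comment> \<open>\<open>Q\<close> is the true probability of a good block, \<open>q\<close> its
    explicit lower bound: the block count concentrates around \<open>K Q\<close>, while spoilt
    blocks are compared with \<open>K q / 2\<close>.\<close>
  define Q where "Q = path_avg b (\<lambda>xs. of_bool (good_block L k l xs))"
  have qQ: "q \<le> Q" unfolding q_def Q_def b_def by (rule prob_good_block_ge[OF m L(1)])
  have q: "q > 0" unfolding q_def \<rho>_def[symmetric] using \<rho> w by simp
  then have Q: "Q > 0" using qQ by simp
  define W where "W t \<omega> \<longleftrightarrow> good_block L k l (seg (t * b) b \<omega>)" for t \<omega>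
  define O' where "O' t \<omega> \<longleftrightarrow> outside L (t * b + L) \<omega>" for t \<omega>
  define WO where "WO t = {\<omega> \<in> space M. W t \<omega> \<and> O' t \<omega>}" for t
  have WO: "WO t \<in> events" for t
    unfolding WO_def W_def O'_def by (intro sets.sets_Collect_conj seg_event outside_event)
  have pWO: "prob (WO t) \<le> 8 * ?C * ?w / sqrt (real L)" for t
    using prob_good_outside_le[of L "t * b + L" k l] L(2) by (simp add: WO_def W_def O'_def b_def)
  define E1 where "E1 = {\<omega> \<in> space M. block_count (good_block L k l) b K (seg 0 (K * b) \<omega>) \<le> real K * Q / 2}"
  define u where "u \<omega> = (\<Sum>t<K. indicator (WO t) \<omega> :: real)" for \<omega>
  define E2 where "E2 = {\<omega> \<in> space M. real K * q / 2 \<le> u \<omega>}"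
  have E1: "E1 \<in> events" unfolding E1_def by (rule seg_event)
  have um: "u \<in> borel_measurable M" unfolding u_def[abs_def] using WO by measurable
  then have E2: "E2 \<in> events" unfolding E2_def by measurable
  have "prob E1 = path_avg (K * b) (\<lambda>xs. of_bool (block_count (good_block L k l) b K xs \<le> real K * Q / 2))"
    unfolding E1_def by (rule prob_seg)
  also have "\<dots> \<le> 4 / (real K * Q)"
    unfolding Q_def by (rule block_count_deviation) (use Q K Q_def in auto)
  also have "\<dots> \<le> 4 / (real K * q)" using q qQ K by (intro divide_left_mono mult_left_mono) auto
  finally have p1: "prob E1 \<le> 4 / (real K * q)" .
  have p2: "prob E2 \<le> 32 * ?C / (\<rho> * sqrt (real L))"
  proof -
    have int: "integrable M (\<lambda>\<omega>. indicator (WO t) \<omega> :: real)" for t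
      using WO by (intro integrable_real_indicator) (auto simp: emeasure_eq_measure)
    have "prob E2 \<le> (\<integral>\<omega>. u \<omega> \<partial>M) / (real K * q / 2)"
      unfolding E2_def
      by (rule integral_Markov_inequality_measure[where A = "space M"])
        (use q K int in \<open>auto simp: u_def[abs_def] intro!: sum_nonneg\<close>)
    also have "(\<integral>\<omega>. u \<omega> \<partial>M) = (\<Sum>t<K. prob (WO t))"
      unfolding u_def using int WO by (subst Bochner_Integration.integral_sum) auto
    also have "\<dots> / (real K * q / 2) \<le> (real K * (8 * ?C * ?w / sqrt (real L))) / (real K * q / 2)"
      using q K sum_mono[of "{..<K}" "\<lambda>t. prob (WO t)" "\<lambda>_. 8 * ?C * ?w / sqrt (real L)"] pWO
      by (intro divide_right_mono) auto
    \<comment> \<open>The weight cancels against \<open>q\<close>. The constant is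
      \<open>8 * 2 * 2\<close>, one 2 from the threshold \<open>K q / 2\<close> and one from the
      half in \<open>q\<close>.\<close>
    also have "\<dots> = 32 * ?C / (\<rho> * sqrt (real L))"
      unfolding q_def \<rho>_def[symmetric] using w \<rho> K L by (simp add: field_simps)
    finally show ?thesis .
  qed
  have "missed N k l \<subseteq> E1 \<union> E2"
  proof
    fix \<omega> assume ms: "\<omega> \<in> missed N k l"
    then have sp: "\<omega> \<in> space M" by (simp add: missed_def)
    show "\<omega> \<in> E1 \<union> E2"
    proof (rule ccontr)
      assume "\<omega> \<notin> E1 \<union> E2"
      then have 1: "block_count (good_block L k l) b K (seg 0 (K * b) \<omega>) > real K * Q / 2" and 2: "u \<omega> < real K * q / 2"
        using sp by (auto simp: E1_def E2_def)
      have "real K * q / 2 \<le> real K * Q / 2" using qQ by (simp add: mult_left_mono)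
      then have "u \<omega> < (\<Sum>t<K. of_bool (W t \<omega>))"
        using 1 2 unfolding block_count_seg W_def by simp
      \<comment> \<open>There are more good blocks than spoilt good ones, so some good block is
        unspoilt.\<close>
      then obtain t where t: "t < K" "indicator (WO t) \<omega> < (of_bool (W t \<omega>) :: real)"
        unfolding u_def by (meson lessThan_iff not_le sum_mono)
      then have "W t \<omega>" "\<not> O' t \<omega>" using sp by (cases "W t \<omega>"; cases "O' t \<omega>"; simp add: WO_def indicator_def)+
      moreover define c where "c = t * b + L"
      ultimately have "good_block L k l (seg (c - L) (L + 2 * L) \<omega>)" "\<not> outside L c \<omega>"
        by (auto simp: W_def O'_def b_def)
      then have "local_time X (walk X c \<omega>) \<omega> = enat (k + 1)" "local_time X (walk X c \<omega> + e) \<omega> = enat l"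
        using good_block_local_time[of L c k l \<omega>] L by (auto simp: c_def)
      moreover have "c \<le> N"
      proof -
        have "c \<le> Suc t * b" by (simp add: c_def b_def)
        also have "\<dots> \<le> K * b" using t by (intro mult_right_mono) auto
        finally show ?thesis using K by (simp add: b_def)
      qed
      ultimately show False using ms by (auto simp: missed_def)
    qed
  qed
  moreover have "prob (E1 \<union> E2) \<le> 4 / (real K * q) + 32 * ?C / (\<rho> * sqrt (real L))"
    using measure_Un_le[OF E1 E2] p1 p2 by linarith
  ultimately show ?thesis using E1 E2 unfolding \<rho>_def by blast
qed

end

section \<open>Lower bound along powers of two\<close>

text \<open>The number of pairs times the failure bound of one pair. The exponential term is
  negligible and the other decays like \<open>m^2 / m^4\<close>.\<close>

lemma rate_prob_asymptotics:
  fixes c A B \<kappa> :: real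
  assumes "c > 0" "\<kappa> > 0" "A > 0" "B > 0"
  shows "summable (\<lambda>M::nat. (c * real M + 1)\<^sup>2 * (A * (real M ^ 8 * (c * real M + 1)\<^sup>2 * exp (- \<kappa> * real M)) + B / real M ^ 4))"
proof (rule summable_comparison_test_bigo)
  show "summable (\<lambda>M. norm (real M powr (-2)))"
    by (simp add: summable_real_powr_iff)
  show "(\<lambda>M::nat. (c * real M + 1)\<^sup>2 * (A * (real M ^ 8 * (c * real M + 1)\<^sup>2 * exp (- \<kappa> * real M)) + B / real M ^ 4)) \<in> O(\<lambda>M. real M powr (-2))"
    using assms by real_asymp
qed

context walk_pair
begin

lemma prob_missed_le:
  fixes \<theta> :: real
  assumes \<theta>: "\<theta> < 1"
  shows "\<exists>c>0. \<exists>A>0. \<exists>B>0. \<forall>\<^sub>F m in sequentially. \<forall>k l. rate \<alpha> (real k) (real l) \<le> \<theta> * (real m * ln 2) \<longrightarrow>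
    real k \<le> c * real m \<and> real l \<le> c * real m \<and>
    (\<exists>E\<in>events. missed (2 ^ m) k l \<subseteq> E \<and>
      prob E \<le> A * (real m ^ 8 * (c * real m + 1)\<^sup>2 * exp (- ((1 - \<theta>) * ln 2) * real m)) + B / real m ^ 4)"
proof -
  let ?C = "hk_const TYPE('d)"
  define \<kappa> where "\<kappa> = ln (1 / (2 * \<alpha>))"
  have \<kappa>: "\<kappa> > 0" using \<alpha>_half \<alpha>_pos by (simp add: \<kappa>_def)
  \<comment> \<open>From the linear lower bound of the rate, which gives
    \<open>(k + l) \<kappa> <= m ln 2\<close>.\<close>
  define c where "c = ln 2 / \<kappa>"
  have c: "c > 0" using \<kappa> by (simp add: c_def)
  define \<rho> where "\<rho> = (1 - 2 * \<alpha>)\<^sup>2"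
  have \<rho>: "\<rho> > 0" using \<alpha>_half by (simp add: \<rho>_def)
  \<comment> \<open>\<open>48 = 4 * 6 * 2\<close>: 4 from Chebyshev, 6 from
    \<open>K >= 2^m / (6 L)\<close>, 2 from the half in \<open>q\<close>.\<close>
  define A where "A = 48 * exp 2 / \<rho>"
  define B where "B = 32 * ?C / \<rho>"
  have AB: "A > 0" "B > 0" using \<rho> by (auto simp: A_def B_def hk_const_pos)
  define c1 where "c1 = 4 * ?C * c / \<alpha>"
  have c1: "c1 \<ge> 0" using c \<alpha>_pos by (simp add: c1_def hk_const_pos less_imp_le)
  have ev: "\<forall>\<^sub>F m in sequentially. m \<ge> 1 \<and> real m \<ge> c \<and> real m \<ge> c1 \<and> 2 ^ m \<ge> 6 * real m ^ 8"
    by (intro eventually_conj eventually_ge_at_top) (real_asymp)+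
  have main: "real k \<le> c * real m \<and> real l \<le> c * real m \<and> (\<exists>E\<in>events. missed (2 ^ m) k l \<subseteq> E \<and>
      prob E \<le> A * (real m ^ 8 * (c * real m + 1)\<^sup>2 * exp (- ((1 - \<theta>) * ln 2) * real m)) + B / real m ^ 4)"
    if m: "m \<ge> 1" "real m \<ge> c" "real m \<ge> c1" "2 ^ m \<ge> 6 * real m ^ 8"
      and r: "rate \<alpha> (real k) (real l) \<le> \<theta> * (real m * ln 2)" for m k l
  proof -
    define n where "n = k + l"
    have "real n * \<kappa> \<le> rate \<alpha> (real k) (real l)"
      using rate_ge[OF \<alpha>_pos, of "real k" "real l"] by (simp add: n_def \<kappa>_def)
    also have "\<dots> \<le> real m * ln 2" using r \<theta> mult_right_mono[of \<theta> 1 "real m * ln 2"] by simp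
    finally have n: "real n \<le> c * real m" using \<kappa> by (simp add: c_def field_simps)
    then have kl: "real k \<le> c * real m" "real l \<le> c * real m" by (auto simp: n_def)
    \<comment> \<open>Each excursion gets \<open>m^6\<close> steps, more than the required square of
      order \<open>m^2\<close>; at most \<open>c m\<close> of them fit into \<open>m^8\<close> once
      \<open>m >= c\<close>, and \<open>sqrt L = m^4\<close> outweighs the number of pairs.\<close>
    define L where "L = m ^ 8"
    define K where "K = 2 ^ m div (3 * L)"
    have m0: "real m \<ge> 1" using m by simp
    have Lpos: "L \<ge> 1" "real L > 0" using m by (auto simp: L_def)
    \<comment> \<open>Rounding down loses at most a factor 2 because
      \<open>2^m >= 6 L\<close>.\<close>
    have Kr: "real K \<ge> 2 ^ m / (6 * real L)"
    proof -
      have "real (2 ^ m) = real K * real (3 * L) + real (2 ^ m mod (3 * L))"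
        unfolding K_def by (metis div_mult_mod_eq of_nat_add of_nat_mult)
      moreover have "2 ^ m mod (3 * L) < 3 * L" using Lpos by simp
      then have "real (2 ^ m mod (3 * L)) < real (3 * L)" by (simp only: of_nat_less_iff)
      moreover have "6 * real L \<le> 2 ^ m" using m by (simp add: L_def)
      ultimately have "2 ^ m \<le> real K * (6 * real L)" by simp
      then show ?thesis using Lpos by (simp add: field_simps)
    qed
    have "1 \<le> 2 ^ m / (6 * real L)" using m Lpos by (simp add: L_def)
    then have K1: "K \<ge> 1" using Kr by linarith
    have mm: "real (m ^ 6) \<ge> (4 * ?C * real (k + l) / \<alpha>)\<^sup>2"
    proof -
      have "4 * ?C * real n / \<alpha> \<le> 4 * ?C * (c * real m) / \<alpha>"
        using n \<alpha>_pos by (intro divide_right_mono mult_left_mono) (auto simp: hk_const_pos less_imp_le)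
      also have "\<dots> = c1 * real m" by (simp add: c1_def)
      also have "\<dots> \<le> real m * real m" using m by (intro mult_right_mono) auto
      also have "\<dots> \<le> real m ^ 3" using m0 power_increasing[of 2 3 "real m"] by (simp add: power2_eq_square)
      finally have "(4 * ?C * real n / \<alpha>)\<^sup>2 \<le> (real m ^ 3)\<^sup>2"
        using \<alpha>_pos by (intro power_mono) (auto simp: hk_const_pos less_imp_le)
      then show ?thesis by (simp add: n_def power_mult[symmetric])
    qed
    have LL: "L \<ge> (k + l) * m ^ 6"
    proof -
      have "real n * real m ^ 6 \<le> (real m * real m) * real m ^ 6"
        using n m by (intro mult_right_mono order_trans[OF n]) auto
      also have "\<dots> = real L" by (simp add: L_def power_add[symmetric] numeral_eq_Suc)
      finally have "real ((k + l) * m ^ 6) \<le> real L" by (simp add: n_def)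
      then show ?thesis by (simp only: of_nat_le_iff)
    qed
    have KL: "K * (3 * L) \<le> 2 ^ m" by (simp add: K_def)
    have m6: "m ^ 6 \<ge> 1" using m by simp
    define q where "q = \<rho> / 2 * mult_weight \<alpha> k l"
    obtain E where E: "E \<in> events" "missed (2 ^ m) k l \<subseteq> E"
      and pE: "prob E \<le> 4 / (real K * q) + 32 * ?C / (\<rho> * sqrt (real L))"
      using missed_subset[OF mm m6 LL Lpos(1) K1 KL] unfolding q_def \<rho>_def by blast
    have "real L = (real m ^ 4)\<^sup>2" by (simp add: L_def power_mult[symmetric])
    then have sL: "sqrt (real L) = real m ^ 4" by (intro real_sqrt_unique) auto
    define x where "x = exp (- (\<theta> * (real m * ln 2)))"
    have w: "mult_weight \<alpha> k l \<ge> x / (exp 2 * (c * real m + 1)\<^sup>2)"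
    proof -
      have "x / (exp 2 * (c * real m + 1)\<^sup>2) \<le> exp (- rate \<alpha> (real k) (real l)) / (exp 2 * (real k + 1) * (real l + 1))"
        unfolding power2_eq_square mult.assoc x_def
        using r kl c by (intro frac_le mult_mono) auto
      also have "\<dots> \<le> mult_weight \<alpha> k l" by (rule mult_weight_ge_exp[OF \<alpha>_pos])
      finally show ?thesis .
    qed
    have "4 / (real K * q) \<le> 4 / ((2 ^ m / (6 * real L)) * (\<rho> / 2 * (x / (exp 2 * (c * real m + 1)\<^sup>2))))"
    proof (intro divide_left_mono mult_mono)
      show "2 ^ m / (6 * real L) \<le> real K" by (rule Kr)
      have cm: "c * real m + 1 > 0" using c by (simp add: add_nonneg_pos)
      show le: "\<rho> / 2 * (x / (exp 2 * (c * real m + 1)\<^sup>2)) \<le> q" unfolding q_def using w \<rho> by (intro mult_left_mono) auto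
      have pos: "0 < \<rho> / 2 * (x / (exp 2 * (c * real m + 1)\<^sup>2))"
        using \<rho> cm by (intro mult_pos_pos divide_pos_pos zero_less_power) (auto simp: x_def)
      show "0 \<le> \<rho> / 2 * (x / (exp 2 * (c * real m + 1)\<^sup>2))" using pos by simp
      show "0 < real K * q * (2 ^ m / (6 * real L) * (\<rho> / 2 * (x / (exp 2 * (c * real m + 1)\<^sup>2))))"
      proof (rule mult_pos_pos[OF mult_pos_pos mult_pos_pos[OF divide_pos_pos pos]])
        show "0 < q" by (rule less_le_trans[OF pos le])
      qed (use K1 Lpos in auto)
    qed auto
    also have "\<dots> = A * (real L * (c * real m + 1)\<^sup>2 * (1 / (2 ^ m * x)))"
    proof -
      have "4 / (a / (6 * b) * (r / 2 * (y / (E * p)))) = 48 * E / r * (b * p * (1 / (a * y)))" for a b r y E p :: real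
        by (simp add: mult_ac)
      then show ?thesis unfolding A_def .
    qed
    also have "1 / (2 ^ m * x) = exp (- ((1 - \<theta>) * ln 2) * real m)"
    proof -
      have "(2::real) ^ m = exp (real m * ln 2)" by (simp add: exp_of_nat_mult)
      then have "2 ^ m * x = exp (real m * ln 2 + - (\<theta> * (real m * ln 2)))" by (simp only: x_def exp_add)
      also have "real m * ln 2 + - (\<theta> * (real m * ln 2)) = (1 - \<theta>) * ln 2 * real m" by (simp add: algebra_simps)
      finally show ?thesis by (simp only: mult_minus_left exp_minus inverse_eq_divide)
    qed
    finally have "4 / (real K * q) \<le> A * (real m ^ 8 * (c * real m + 1)\<^sup>2 * exp (- ((1 - \<theta>) * ln 2) * real m))"
      by (simp add: L_def)
    moreover have "32 * ?C / (\<rho> * sqrt (real L)) = B / real m ^ 4" by (simp add: sL B_def)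
    ultimately have "prob E \<le> A * (real m ^ 8 * (c * real m + 1)\<^sup>2 * exp (- ((1 - \<theta>) * ln 2) * real m)) + B / real m ^ 4"
      using pE by linarith
    then show ?thesis using kl E by (intro conjI bexI[of _ E])
  qed
  have fin: "\<forall>\<^sub>F m in sequentially. \<forall>k l. rate \<alpha> (real k) (real l) \<le> \<theta> * (real m * ln 2) \<longrightarrow>
    real k \<le> c * real m \<and> real l \<le> c * real m \<and>
    (\<exists>E\<in>events. missed (2 ^ m) k l \<subseteq> E \<and>
      prob E \<le> A * (real m ^ 8 * (c * real m + 1)\<^sup>2 * exp (- ((1 - \<theta>) * ln 2) * real m)) + B / real m ^ 4)"
    using ev
  proof (rule eventually_mono, intro allI impI)
    fix m k l
    assume "m \<ge> 1 \<and> real m \<ge> c \<and> real m \<ge> c1 \<and> 2 ^ m \<ge> 6 * real m ^ 8"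
      and r: "rate \<alpha> (real k) (real l) \<le> \<theta> * (real m * ln 2)"
    then show "real k \<le> c * real m \<and> real l \<le> c * real m \<and> (\<exists>E\<in>events. missed (2 ^ m) k l \<subseteq> E \<and>
      prob E \<le> A * (real m ^ 8 * (c * real m + 1)\<^sup>2 * exp (- ((1 - \<theta>) * ln 2) * real m)) + B / real m ^ 4)"
      by (intro main r) blast+
  qed
  show ?thesis
    by (rule exI[of _ c], rule conjI[OF c], rule exI[of _ A], rule conjI[OF AB(1)], rule exI[of _ B],
        rule conjI[OF AB(2)], rule fin)
qed

text \<open>Union bound over the at most \<open>(c m + 1)^2\<close> admissible pairs, then
  Borel--Cantelli in \<open>m\<close>.\<close>

lemma AE_not_missed:
  fixes \<theta> :: real
  assumes \<theta>: "\<theta> < 1"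
  shows "AE \<omega> in M. \<exists>m0. \<forall>m\<ge>m0. \<forall>k l. rate \<alpha> (real k) (real l) \<le> \<theta> * (real m * ln 2) \<longrightarrow> \<omega> \<notin> missed (2 ^ m) k l"
proof -
  obtain c A B where c: "c > 0" and A: "A > 0" and B: "B > 0"
    and ev: "\<forall>\<^sub>F m in sequentially. \<forall>k l. rate \<alpha> (real k) (real l) \<le> \<theta> * (real m * ln 2) \<longrightarrow>
    real k \<le> c * real m \<and> real l \<le> c * real m \<and>
    (\<exists>E\<in>events. missed (2 ^ m) k l \<subseteq> E \<and>
      prob E \<le> A * (real m ^ 8 * (c * real m + 1)\<^sup>2 * exp (- ((1 - \<theta>) * ln 2) * real m)) + B / real m ^ 4)"
    using prob_missed_le[OF \<theta>] by (elim exE conjE) (rule that)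
  define g where "g m = A * (real m ^ 8 * (c * real m + 1)\<^sup>2 * exp (- ((1 - \<theta>) * ln 2) * real m)) + B / real m ^ 4" for m
  have g: "g m \<ge> 0" for m unfolding g_def using A B by simp
  obtain m0 where m0': "\<forall>m\<ge>m0. \<forall>k l. rate \<alpha> (real k) (real l) \<le> \<theta> * (real m * ln 2) \<longrightarrow>
    real k \<le> c * real m \<and> real l \<le> c * real m \<and> (\<exists>E\<in>events. missed (2 ^ m) k l \<subseteq> E \<and> prob E \<le> g m)"
    using ev[unfolded eventually_sequentially, folded g_def] by (elim exE) (rule that)
  note m0 = m0'[rule_format]
  define S where "S m = {(k, l). rate \<alpha> (real k) (real l) \<le> \<theta> * (real m * ln 2)}" for m
  have "\<exists>F\<in>events. (\<forall>k l. (k, l) \<in> S m \<longrightarrow> missed (2 ^ m) k l \<subseteq> F) \<and> prob F \<le> (c * real m + 1)\<^sup>2 * g m" if "m \<ge> m0" for m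
  proof -
    have "\<forall>p\<in>S m. \<exists>E. E \<in> events \<and> missed (2 ^ m) (fst p) (snd p) \<subseteq> E \<and> prob E \<le> g m"
    proof
      fix p assume p: "p \<in> S m"
      obtain k l where kl: "p = (k, l)" by (cases p)
      then have "rate \<alpha> (real k) (real l) \<le> \<theta> * (real m * ln 2)" using p by (simp add: S_def)
      from m0[OF that this] show "\<exists>E. E \<in> events \<and> missed (2 ^ m) (fst p) (snd p) \<subseteq> E \<and> prob E \<le> g m"
        unfolding kl fst_conv snd_conv by blast
    qed
    from bchoice[OF this] obtain E where E: "\<forall>p\<in>S m. E p \<in> events \<and> missed (2 ^ m) (fst p) (snd p) \<subseteq> E p \<and> prob (E p) \<le> g m"
      by blast
    define N where "N = nat \<lfloor>c * real m\<rfloor>"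
    have sub: "S m \<subseteq> {..N} \<times> {..N}"
    proof
      fix p assume p: "p \<in> S m"
      obtain k l where kl: "p = (k, l)" by (cases p)
      then have "rate \<alpha> (real k) (real l) \<le> \<theta> * (real m * ln 2)" using p by (simp add: S_def)
      from m0[OF that this] show "p \<in> {..N} \<times> {..N}"
        unfolding kl N_def by (simp add: le_nat_floor)
    qed
    then have fin: "finite (S m)" by (rule finite_subset) simp
    have "real (card (S m)) \<le> real (card ({..N} \<times> {..N}))"
      by (intro of_nat_mono card_mono[OF _ sub]) simp
    also have "\<dots> = (real N + 1)\<^sup>2" by (simp add: card_cartesian_product power2_eq_square algebra_simps)
    also have "\<dots> \<le> (c * real m + 1)\<^sup>2" using c by (intro power_mono) (auto simp: N_def)
    finally have card: "real (card (S m)) \<le> (c * real m + 1)\<^sup>2" .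
    have "prob (\<Union>p\<in>S m. E p) \<le> (\<Sum>p\<in>S m. prob (E p))"
      by (rule finite_measure_subadditive_finite[OF fin]) (use E in auto)
    also have "\<dots> \<le> real (card (S m)) * g m" using E by (intro sum_bounded_above) auto
    also have "\<dots> \<le> (c * real m + 1)\<^sup>2 * g m" using card g by (intro mult_right_mono) auto
    finally have "prob (\<Union>p\<in>S m. E p) \<le> (c * real m + 1)\<^sup>2 * g m" .
    moreover have "(\<Union>p\<in>S m. E p) \<in> events" using E fin by auto
    moreover have "missed (2 ^ m) k l \<subseteq> (\<Union>p\<in>S m. E p)" if "(k, l) \<in> S m" for k l
      using bspec[OF E that] that by auto
    ultimately show ?thesis by (intro bexI[of _ "\<Union>p\<in>S m. E p"] conjI allI impI)
  qed
  note cover = this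
  have "\<forall>m. \<exists>F. m \<ge> m0 \<longrightarrow> F \<in> events \<and> (\<forall>k l. (k, l) \<in> S m \<longrightarrow> missed (2 ^ m) k l \<subseteq> F) \<and> prob F \<le> (c * real m + 1)\<^sup>2 * g m"
  proof
    fix m
    show "\<exists>F. m \<ge> m0 \<longrightarrow> F \<in> events \<and> (\<forall>k l. (k, l) \<in> S m \<longrightarrow> missed (2 ^ m) k l \<subseteq> F) \<and> prob F \<le> (c * real m + 1)\<^sup>2 * g m"
    proof (cases "m \<ge> m0")
      case True
      from cover[OF True] show ?thesis unfolding Bex_def by (rule ex_forward) (rule impI)
    qed simp
  qed
  from choice[OF this] obtain F0 where F0': "\<forall>m. m \<ge> m0 \<longrightarrow> F0 m \<in> events \<and> (\<forall>k l. (k, l) \<in> S m \<longrightarrow> missed (2 ^ m) k l \<subseteq> F0 m) \<and> prob (F0 m) \<le> (c * real m + 1)\<^sup>2 * g m"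
    by (elim exE) (rule that)
  note F0 = F0'[THEN spec, THEN mp]
  \<comment> \<open>Small \<open>m\<close> get the empty event, so that Borel--Cantelli receives a
    full sequence of events.\<close>
  define F where "F m = (if m \<ge> m0 then F0 m else {})" for m
  have Fe: "F m \<in> events" for m using F0[of m] by (simp add: F_def)
  have "summable (\<lambda>m. prob (F m))"
  proof (rule summable_comparison_test')
    show "summable (\<lambda>m. (c * real m + 1)\<^sup>2 * g m)"
      unfolding g_def using c A B \<theta> by (intro rate_prob_asymptotics) auto
    show "norm (prob (F m)) \<le> (c * real m + 1)\<^sup>2 * g m" if "m \<ge> m0" for m
      using F0[OF that] that by (simp add: F_def)
  qed
  then have "AE \<omega> in M. eventually (\<lambda>m. \<omega> \<in> space M - F m) sequentially"
    by (intro borel_cantelli_AE1 Fe) (auto simp: emeasure_eq_measure)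
  then show ?thesis
  proof eventually_elim
    case (elim \<omega>)
    then obtain m1 where m1: "\<And>m. m \<ge> m1 \<Longrightarrow> \<omega> \<notin> F m" by (auto simp: eventually_sequentially)
    show ?case
    proof (rule exI[of _ "max m0 m1"], intro allI impI)
      fix m k l assume m: "max m0 m1 \<le> m" and "rate \<alpha> (real k) (real l) \<le> \<theta> * (real m * ln 2)"
      then have "(k, l) \<in> S m" by (simp add: S_def)
      then have "missed (2 ^ m) k l \<subseteq> F m" using F0[of m] m by (simp add: F_def)
      then show "\<omega> \<notin> missed (2 ^ m) k l" using m1[of m] m by auto
    qed
  qed
qed

end

section \<open>From powers of two to all \<open>n\<close>\<close>

context simple_random_walk
begin

text \<open>For \<open>2^m <= n < 2^(m + 1)\<close> a witness found up to \<open>2^m\<close> also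
  serves \<open>n\<close>; passing from \<open>\<epsilon>\<close> to \<open>\<epsilon> / 2\<close>
  absorbs the gap between \<open>ln n\<close> and \<open>m ln 2\<close>.\<close>

lemma lower_part:
  assumes dim: "CARD('d) \<ge> 3" and \<epsilon>: "0 < \<epsilon>" "\<epsilon> < 1"
  shows "AE \<omega> in M. \<exists>n0. \<forall>n\<ge>n0. \<forall>k l i. rate (alpha M X) (real k) (real l) \<le> (1 - \<epsilon>) * ln (real n) \<longrightarrow>
    (\<exists>j\<le>n. local_time X (walk X j \<omega>) \<omega> = enat (k + 1) \<and> local_time X (walk X j \<omega> + unit_step i) \<omega> = enat l)"
proof -
  define \<theta> where "\<theta> = 1 - \<epsilon> / 2"
  have \<theta>: "\<theta> < 1" using \<epsilon> by (simp add: \<theta>_def)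
  have "AE \<omega> in M. \<exists>n0. \<forall>n\<ge>n0. \<forall>k l. rate (alpha M X) (real k) (real l) \<le> (1 - \<epsilon>) * ln (real n) \<longrightarrow>
    (\<exists>j\<le>n. local_time X (walk X j \<omega>) \<omega> = enat (k + 1) \<and> local_time X (walk X j \<omega> + unit_step i) \<omega> = enat l)" for i
  proof -
    interpret walk_pair M X "unit_step i" i by unfold_locales (simp_all add: dim)
    have a: "alpha M X = \<alpha>" by (simp add: alpha_eq \<alpha>_eq)
    show ?thesis using AE_not_missed[OF \<theta>] AE_space
    proof eventually_elim
      case (elim \<omega>)
      then obtain m0 where m0: "\<And>m k l. m \<ge> m0 \<Longrightarrow> rate \<alpha> (real k) (real l) \<le> \<theta> * (real m * ln 2) \<Longrightarrow> \<omega> \<notin> missed (2 ^ m) k l"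
        by blast
      \<comment> \<open>\<open>m >= 2 / \<epsilon>\<close> yields
        \<open>(1 - \<epsilon>) (m + 1) <= (1 - \<epsilon> / 2) m\<close>.\<close>
      define m1 where "m1 = max m0 (nat \<lceil>2 / \<epsilon>\<rceil>)"
      show ?case
      proof (rule exI[of _ "2 ^ m1"], intro allI impI)
        fix n k l assume n: "2 ^ m1 \<le> n" and r: "rate (alpha M X) (real k) (real l) \<le> (1 - \<epsilon>) * ln (real n)"
        have "n \<ge> 1" using n by (metis one_le_numeral one_le_power order_trans)
        then obtain m where m: "2 ^ m \<le> n" "n < 2 ^ (m + 1)"
          using ex_power_ivl1[of 2 n] by auto
        have pw: "(2::nat) ^ m1 < 2 ^ (m + 1)" using n m(2) by (rule le_less_trans)
        have "m1 < m + 1" by (rule power_less_imp_less_exp[OF _ pw]) simp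
        then have "m1 \<le> m" by simp
        then have mm: "m \<ge> m0" "real m \<ge> 2 / \<epsilon>" unfolding m1_def by linarith+
        have "real n \<le> real (2 ^ (m + 1))" using m(2) by (intro of_nat_mono less_imp_le)
        then have le: "real n \<le> 2 ^ (m + 1)" by simp
        have "ln (real n) \<le> ln (2 ^ (m + 1))" using \<open>n \<ge> 1\<close> le by (subst ln_le_cancel_iff) simp_all
        also have "\<dots> = (real m + 1) * ln 2" by (subst ln_realpow) auto
        finally have "(1 - \<epsilon>) * ln (real n) \<le> (1 - \<epsilon>) * ((real m + 1) * ln 2)" using \<epsilon> by (intro mult_left_mono) auto
        also have "\<dots> = ((1 - \<epsilon>) * (real m + 1)) * ln 2" by simp
        also have "\<dots> \<le> (\<theta> * real m) * ln 2"
        proof (rule mult_right_mono)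
          have "1 \<le> \<epsilon> * real m / 2" using mm \<epsilon> by (simp add: field_simps)
          then show "(1 - \<epsilon>) * (real m + 1) \<le> \<theta> * real m" using \<epsilon> by (simp add: \<theta>_def algebra_simps)
        qed simp
        finally have "rate \<alpha> (real k) (real l) \<le> \<theta> * (real m * ln 2)" using r by (simp add: a mult.assoc)
        from m0[OF mm(1) this] elim(2) m(1)
        show "\<exists>j\<le>n. local_time X (walk X j \<omega>) \<omega> = enat (k + 1) \<and> local_time X (walk X j \<omega> + unit_step i) \<omega> = enat l"
          unfolding missed_def by (auto intro: order_trans)
      qed
    qed
  qed
  then have "AE \<omega> in M. \<forall>i\<in>(UNIV :: ('d + 'd) set). \<exists>n0. \<forall>n\<ge>n0. \<forall>k l. rate (alpha M X) (real k) (real l) \<le> (1 - \<epsilon>) * ln (real n) \<longrightarrow>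
    (\<exists>j\<le>n. local_time X (walk X j \<omega>) \<omega> = enat (k + 1) \<and> local_time X (walk X j \<omega> + unit_step i) \<omega> = enat l)"
    by (intro AE_finite_allI) auto
  then show ?thesis
  proof eventually_elim
    case (elim \<omega>)
    then obtain J :: "'d + 'd \<Rightarrow> nat" where J: "\<forall>i. \<forall>n\<ge>J i. \<forall>k l. rate (alpha M X) (real k) (real l) \<le> (1 - \<epsilon>) * ln (real n) \<longrightarrow>
      (\<exists>j\<le>n. local_time X (walk X j \<omega>) \<omega> = enat (k + 1) \<and> local_time X (walk X j \<omega> + unit_step i) \<omega> = enat l)"
      using choice[of "\<lambda>i J. \<forall>n\<ge>J. \<forall>k l. rate (alpha M X) (real k) (real l) \<le> (1 - \<epsilon>) * ln (real n) \<longrightarrow>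
      (\<exists>j\<le>n. local_time X (walk X j \<omega>) \<omega> = enat (k + 1) \<and> local_time X (walk X j \<omega> + unit_step i) \<omega> = enat l)"] by auto
    have "J i \<le> n" if "Max (range J) \<le> n" for n i
      using that by (meson Max_ge finite finite_imageI order_trans rangeI)
    then show ?case using J by (intro exI[of _ "Max (range J)"]) blast
  qed
qed

end

theorem theorem1p2:
  fixes M :: "'a measure" and X :: "nat \<Rightarrow> 'a \<Rightarrow> int ^ 'd" and \<epsilon> :: real
  assumes "CARD('d) \<ge> 3"
    and "simple_random_walk M X"
    and "\<epsilon> > 0"
  shows "AE \<omega> in M. \<exists>n0::nat. \<forall>n\<ge>n0.
     (\<forall>j\<le>n. \<forall>i :: 'd + 'd. \<exists>a b :: nat.
        (local_time X (walk X j \<omega>) \<omega>, local_time X (walk X j \<omega> + unit_step i) \<omega>) = (enat a, enat b) \<and>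
        (real a, real b) \<in> (\<lambda>p. ((1 + \<epsilon>) * ln (real n)) *\<^sub>R p) ` region (alpha M X)) \<and>
     (\<forall>k l :: nat. (real k, real l) \<in> (\<lambda>p. ((1 - \<epsilon>) * ln (real n)) *\<^sub>R p) ` region (alpha M X) \<longrightarrow>
        (\<forall>i :: 'd + 'd. \<exists>j\<le>n.
           (local_time X (walk X j \<omega>) \<omega>, local_time X (walk X j \<omega> + unit_step i) \<omega>) =
             (enat (k + 1), enat l)))"
proof -
  interpret simple_random_walk M X by fact
  \<comment> \<open>For \<open>\<epsilon> >= 1\<close> the scale
    \<open>(1 - \<epsilon>) ln n\<close> is not positive; capping at 1/2 brings this case under the
    lower part as well.\<close>
  define \<epsilon>' where "\<epsilon>' = min \<epsilon> (1 / 2)"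
  have \<epsilon>': "0 < \<epsilon>'" "\<epsilon>' < 1" "\<epsilon>' \<le> \<epsilon>" using assms(3) by (auto simp: \<epsilon>'_def)
  show ?thesis
    using upper_part[OF assms(1,3)] lower_part[OF assms(1) \<epsilon>'(1,2)] AE_finite_visits[OF assms(1)]
  proof eventually_elim
    case (elim \<omega>)
    obtain n1 where n1: "\<And>n j i. n \<ge> n1 \<Longrightarrow> j \<le> n \<Longrightarrow>
        rate (alpha M X) (real (total_visits (walk X j \<omega>) \<omega>)) (real (total_visits (walk X j \<omega> + unit_step i) \<omega>)) \<le> (1 + \<epsilon>) * ln (real n)"
      using elim(1) by blast
    obtain n2 where n2: "\<And>n k l i. n \<ge> n2 \<Longrightarrow> rate (alpha M X) (real k) (real l) \<le> (1 - \<epsilon>') * ln (real n) \<Longrightarrow>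
        \<exists>j\<le>n. local_time X (walk X j \<omega>) \<omega> = enat (k + 1) \<and> local_time X (walk X j \<omega> + unit_step i) \<omega> = enat l"
      using elim(2) by blast
    show ?case
    \<comment> \<open>From 2 on \<open>ln n\<close> is positive, as the sublevel description of the
      scaled region requires.\<close>
    proof (rule exI[of _ "max 2 (max n1 n2)"], intro allI impI conjI)
      fix n j i assume n: "max 2 (max n1 n2) \<le> n" and j: "j \<le> n"
      then have "(1 + \<epsilon>) * ln (real n) > 0" using assms(3) by (intro mult_pos_pos) auto
      then show "\<exists>a b :: nat. (local_time X (walk X j \<omega>) \<omega>, local_time X (walk X j \<omega> + unit_step i) \<omega>) = (enat a, enat b) \<and>
          (real a, real b) \<in> (\<lambda>p. ((1 + \<epsilon>) * ln (real n)) *\<^sub>R p) ` region (alpha M X)"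
        using n1[of n j i] n j elim(3) by (simp add: local_time_eq scaled_region_iff)
    next
      fix n k l :: nat and i :: "'d + 'd"
      assume n: "max 2 (max n1 n2) \<le> n"
        and kl: "(real k, real l) \<in> (\<lambda>p. ((1 - \<epsilon>) * ln (real n)) *\<^sub>R p) ` region (alpha M X)"
      have ln: "ln (real n) > 0" using n by simp
      have "rate (alpha M X) (real k) (real l) \<le> (1 - \<epsilon>') * ln (real n)"
      proof (cases "\<epsilon> < 1")
        case True
        then have "rate (alpha M X) (real k) (real l) \<le> (1 - \<epsilon>) * ln (real n)"
          using kl ln by (subst (asm) scaled_region_iff) (auto simp: mult_pos_pos)
        also have "\<dots> \<le> (1 - \<epsilon>') * ln (real n)" using ln \<epsilon>' by (intro mult_right_mono) auto
        finally show ?thesis .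
      next
        case False
        \<comment> \<open>A nonpositive scale sends the region into the nonpositive quadrant, which
          leaves only \<open>k = l = 0\<close>, a pair of rate 0.\<close>
        then have s: "(1 - \<epsilon>) * ln (real n) \<le> 0" using ln by (simp add: mult_nonpos_nonneg)
        from kl obtain x y where "(x, y) \<in> region (alpha M X)"
          "real k = (1 - \<epsilon>) * ln (real n) * x" "real l = (1 - \<epsilon>) * ln (real n) * y" by auto
        then have "real k \<le> 0" "real l \<le> 0" using s by (auto simp: region_def intro: mult_nonpos_nonneg)
        then have "rate (alpha M X) (real k) (real l) = 0" by (simp add: rate_def)
        also have "0 \<le> (1 - \<epsilon>') * ln (real n)" using ln \<epsilon>' by simp
        finally show ?thesis .
      qed
      then show "\<exists>j\<le>n. (local_time X (walk X j \<omega>) \<omega>, local_time X (walk X j \<omega> + unit_step i) \<omega>) = (enat (k + 1), enat l)"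
        using n2[of n k l i] n by simp
    qed
  qed
qed

end
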